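(* Let $R$ be an associative ring with unity and let $\mathcal{X}$ be a class of $R$-modules that is closed under direct sums and closed under extensions. Let $C(\mathcal{X}^{*})$ be the class of all complexes of $R$-modules all of whose terms lie in $\mathcal{X}$, and assume that $C(\mathcal{X}^{*})$ is closed under inverse limits and direct limits. If every $R$-module has an $\mathcal{X}$-cover, then every complex of $R$-modules has a $C(\mathcal{X}^{*})$-cover.
   Context: Complexes are indexed by $\mathbb{Z}$ and may be unbounded. $C(\mathcal{X}^{*})$ is regarded as a class of objects in the abelian category of complexes of $R$-modules with chain maps as morphisms; limits are taken in that category. Closed under extensions means: if $0\to A\to B\to C\to 0$ is exact with $A,C\in\mathcal{X}$, then $B\in\mathcal{X}$. Let $\mathcal{A}$ be an abelian category, $\mathcal{Y}$ a class of objects of $\mathcal{A}$, and $M$ an object of $\mathcal{A}$. A morphism $\phi: Y\to M$ with $Y\in\mathcal{Y}$ is a $\mathcal{Y}$-precover of $M$ if for every morphism $f: Y'\to M$ with $Y'\in\mathcal{Y}$ there is $g: Y'\to Y$ with $\phi g=f$. It is a $\mathcal{Y}$-cover if moreover every endomorphism $g: Y\to Y$ with $\phi g=\phi$ is an automorphism. An $\mathcal{X}$-cover of a module is taken in the category of $R$-modules; a $C(\mathcal{X}^{*})$-cover of a complex is taken in the category of complexes. *)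

theory Defs
  imports "HOL-Algebra.Module"
begin

unbundle cardinal_syntax

section \<open>Size\<close>

text \<open>
  HOL has no proper classes, so classes of modules are taken relative to a Grothendieck universe,
  represented by a type \<open>'u\<close>: the carriers of modules are subsets of \<open>'u\<close>, and rings, modules and
  index sets are required to be small, i.e. to have fewer elements than \<open>'u\<close>. Every small set is
  in bijection with a subset of \<open>'u\<close>, so every small module is isomorphic to one of these.
\<close>

definition small :: "'u itself \<Rightarrow> 'a set \<Rightarrow> bool" where
  "small (_ :: 'u itself) A \<longleftrightarrow> |A| <o |UNIV :: 'u set|"

text \<open>
  The cardinality of the universe is uncountable, regular and a strong limit, i.e. inaccessible, so
  that the small sets are closed under all the usual constructions, as the sets of ZFC are.
\<close>

definition universe :: "'u itself \<Rightarrow> bool" where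
  "universe (_ :: 'u itself) \<longleftrightarrow>
     small TYPE('u) (UNIV :: nat set) \<and>
     regularCard |UNIV :: 'u set| \<and>
     (\<forall>A :: 'u set. small TYPE('u) A \<longrightarrow> small TYPE('u) (Pow A))"


section \<open>Categories, covers and limits\<close>

text \<open>
  \<open>Comp C A g f\<close> is g after f, where \<open>A\<close> is the domain of f; the domain is an argument because
  morphisms are functions made extensional on it, so that equality of morphisms is equality in HOL.
\<close>

record ('o, 'm) category =
  Obj :: "'o set"
  Hom :: "'o \<Rightarrow> 'o \<Rightarrow> 'm set"
  Comp :: "'o \<Rightarrow> 'm \<Rightarrow> 'm \<Rightarrow> 'm"
  Ident :: "'o \<Rightarrow> 'm"

definition automorphism :: "('o, 'm) category \<Rightarrow> 'o \<Rightarrow> 'm \<Rightarrow> bool" where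
  "automorphism C Y g \<longleftrightarrow> g \<in> Hom C Y Y \<and>
     (\<exists>h\<in>Hom C Y Y. Comp C Y h g = Ident C Y \<and> Comp C Y g h = Ident C Y)"

definition is_precover :: "('o, 'm) category \<Rightarrow> 'o set \<Rightarrow> 'o \<Rightarrow> 'o \<Rightarrow> 'm \<Rightarrow> bool" where
  "is_precover C \<Y> M Y \<phi> \<longleftrightarrow> Y \<in> \<Y> \<and> \<phi> \<in> Hom C Y M \<and>
     (\<forall>Y'\<in>\<Y>. \<forall>f\<in>Hom C Y' M. \<exists>g\<in>Hom C Y' Y. Comp C Y' \<phi> g = f)"

definition is_cover :: "('o, 'm) category \<Rightarrow> 'o set \<Rightarrow> 'o \<Rightarrow> 'o \<Rightarrow> 'm \<Rightarrow> bool" where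
  "is_cover C \<Y> M Y \<phi> \<longleftrightarrow> is_precover C \<Y> M Y \<phi> \<and>
     (\<forall>g\<in>Hom C Y Y. Comp C Y \<phi> g = \<phi> \<longrightarrow> automorphism C Y g)"

definition has_cover :: "('o, 'm) category \<Rightarrow> 'o set \<Rightarrow> 'o \<Rightarrow> bool" where
  "has_cover C \<Y> M \<longleftrightarrow> (\<exists>Y \<phi>. is_cover C \<Y> M Y \<phi>)"

definition is_direct_sum ::
  "('o, 'm) category \<Rightarrow> 'i set \<Rightarrow> ('i \<Rightarrow> 'o) \<Rightarrow> 'o \<Rightarrow> ('i \<Rightarrow> 'm) \<Rightarrow> bool" where
  "is_direct_sum C I F S u \<longleftrightarrow>
     S \<in> Obj C \<and> (\<forall>i\<in>I. u i \<in> Hom C (F i) S) \<and>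
     (\<forall>N\<in>Obj C. \<forall>v. (\<forall>i\<in>I. v i \<in> Hom C (F i) N) \<longrightarrow>
        (\<exists>!h. h \<in> Hom C S N \<and> (\<forall>i\<in>I. Comp C (F i) h (u i) = v i)))"

definition directed_poset :: "'i set \<Rightarrow> 'i rel \<Rightarrow> bool" where
  "directed_poset I r \<longleftrightarrow> I \<noteq> {} \<and> partial_order_on I r \<and>
     (\<forall>i\<in>I. \<forall>j\<in>I. \<exists>k\<in>I. (i, k) \<in> r \<and> (j, k) \<in> r)"

definition direct_system ::
  "('o, 'm) category \<Rightarrow> 'i set \<Rightarrow> 'i rel \<Rightarrow> ('i \<Rightarrow> 'o) \<Rightarrow> ('i \<Rightarrow> 'i \<Rightarrow> 'm) \<Rightarrow> bool" where
  "direct_system C I r F t \<longleftrightarrow>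
     (\<forall>i\<in>I. F i \<in> Obj C \<and> t i i = Ident C (F i)) \<and>
     (\<forall>i j. (i, j) \<in> r \<longrightarrow> t i j \<in> Hom C (F i) (F j)) \<and>
     (\<forall>i j k. (i, j) \<in> r \<and> (j, k) \<in> r \<longrightarrow> Comp C (F i) (t j k) (t i j) = t i k)"

definition compatible_cocone ::
  "('o, 'm) category \<Rightarrow> 'i set \<Rightarrow> 'i rel \<Rightarrow> ('i \<Rightarrow> 'o) \<Rightarrow> ('i \<Rightarrow> 'i \<Rightarrow> 'm)
     \<Rightarrow> 'o \<Rightarrow> ('i \<Rightarrow> 'm) \<Rightarrow> bool" where
  "compatible_cocone C I r F t N v \<longleftrightarrow>
     N \<in> Obj C \<and> (\<forall>i\<in>I. v i \<in> Hom C (F i) N) \<and>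
     (\<forall>i j. (i, j) \<in> r \<longrightarrow> Comp C (F i) (v j) (t i j) = v i)"

definition is_direct_limit ::
  "('o, 'm) category \<Rightarrow> 'i set \<Rightarrow> 'i rel \<Rightarrow> ('i \<Rightarrow> 'o) \<Rightarrow> ('i \<Rightarrow> 'i \<Rightarrow> 'm)
     \<Rightarrow> 'o \<Rightarrow> ('i \<Rightarrow> 'm) \<Rightarrow> bool" where
  "is_direct_limit C I r F t L u \<longleftrightarrow>
     compatible_cocone C I r F t L u \<and>
     (\<forall>N v. compatible_cocone C I r F t N v \<longrightarrow>
        (\<exists>!h. h \<in> Hom C L N \<and> (\<forall>i\<in>I. Comp C (F i) h (u i) = v i)))"

text \<open>In an inverse system, \<open>p i j\<close> is the transition morphism from \<open>F j\<close> to \<open>F i\<close> for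
  \<open>i \<le> j\<close>.\<close>

definition inverse_system ::
  "('o, 'm) category \<Rightarrow> 'i set \<Rightarrow> 'i rel \<Rightarrow> ('i \<Rightarrow> 'o) \<Rightarrow> ('i \<Rightarrow> 'i \<Rightarrow> 'm) \<Rightarrow> bool" where
  "inverse_system C I r F p \<longleftrightarrow>
     (\<forall>i\<in>I. F i \<in> Obj C \<and> p i i = Ident C (F i)) \<and>
     (\<forall>i j. (i, j) \<in> r \<longrightarrow> p i j \<in> Hom C (F j) (F i)) \<and>
     (\<forall>i j k. (i, j) \<in> r \<and> (j, k) \<in> r \<longrightarrow> Comp C (F k) (p i j) (p j k) = p i k)"

definition compatible_cone ::
  "('o, 'm) category \<Rightarrow> 'i set \<Rightarrow> 'i rel \<Rightarrow> ('i \<Rightarrow> 'o) \<Rightarrow> ('i \<Rightarrow> 'i \<Rightarrow> 'm)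
     \<Rightarrow> 'o \<Rightarrow> ('i \<Rightarrow> 'm) \<Rightarrow> bool" where
  "compatible_cone C I r F p N v \<longleftrightarrow>
     N \<in> Obj C \<and> (\<forall>i\<in>I. v i \<in> Hom C N (F i)) \<and>
     (\<forall>i j. (i, j) \<in> r \<longrightarrow> Comp C N (p i j) (v j) = v i)"

definition is_inverse_limit ::
  "('o, 'm) category \<Rightarrow> 'i set \<Rightarrow> 'i rel \<Rightarrow> ('i \<Rightarrow> 'o) \<Rightarrow> ('i \<Rightarrow> 'i \<Rightarrow> 'm)
     \<Rightarrow> 'o \<Rightarrow> ('i \<Rightarrow> 'm) \<Rightarrow> bool" where
  "is_inverse_limit C I r F p L u \<longleftrightarrow>
     compatible_cone C I r F p L u \<and>
     (\<forall>N v. compatible_cone C I r F p N v \<longrightarrow>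
        (\<exists>!h. h \<in> Hom C N L \<and> (\<forall>i\<in>I. Comp C N (u i) h = v i)))"

text \<open>
  Index sets range over the small subsets of the universe, hence, up to bijection, over all small
  sets. Direct sums and limits are determined only up to isomorphism, and a closed class contains
  all of them.
\<close>

definition closed_under_direct_sums ::
  "'u itself \<Rightarrow> ('o, 'm) category \<Rightarrow> 'o set \<Rightarrow> bool" where
  "closed_under_direct_sums (_ :: 'u itself) C \<Y> \<longleftrightarrow>
     (\<forall>(I :: 'u set) F S u. small TYPE('u) I \<and> (\<forall>i\<in>I. F i \<in> \<Y>) \<and>
        is_direct_sum C I F S u \<longrightarrow> S \<in> \<Y>)"

definition closed_under_direct_limits ::
  "'u itself \<Rightarrow> ('o, 'm) category \<Rightarrow> 'o set \<Rightarrow> bool" where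
  "closed_under_direct_limits (_ :: 'u itself) C \<Y> \<longleftrightarrow>
     (\<forall>(I :: 'u set) r F t L u. small TYPE('u) I \<and> directed_poset I r \<and>
        direct_system C I r F t \<and> (\<forall>i\<in>I. F i \<in> \<Y>) \<and>
        is_direct_limit C I r F t L u \<longrightarrow> L \<in> \<Y>)"

definition closed_under_inverse_limits ::
  "'u itself \<Rightarrow> ('o, 'm) category \<Rightarrow> 'o set \<Rightarrow> bool" where
  "closed_under_inverse_limits (_ :: 'u itself) C \<Y> \<longleftrightarrow>
     (\<forall>(I :: 'u set) r F p L u. small TYPE('u) I \<and> directed_poset I r \<and>
        inverse_system C I r F p \<and> (\<forall>i\<in>I. F i \<in> \<Y>) \<and>
        is_inverse_limit C I r F p L u \<longrightarrow> L \<in> \<Y>)"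


section \<open>Modules\<close>

text \<open>
  The locale \<^locale>\<open>module\<close> requires a commutative ring. The fields for a multiplication and a
  one that the record type \<open>module\<close> inherits from rings are irrelevant throughout.
\<close>

locale left_module = R?: ring R + M?: abelian_group M for R (structure) and M (structure) +
  assumes smult_closed:
      "\<lbrakk>a \<in> carrier R; x \<in> carrier M\<rbrakk> \<Longrightarrow> a \<odot>\<^bsub>M\<^esub> x \<in> carrier M"
    and smult_l_distr:
      "\<lbrakk>a \<in> carrier R; b \<in> carrier R; x \<in> carrier M\<rbrakk> \<Longrightarrow>
         (a \<oplus> b) \<odot>\<^bsub>M\<^esub> x = a \<odot>\<^bsub>M\<^esub> x \<oplus>\<^bsub>M\<^esub> b \<odot>\<^bsub>M\<^esub> x"
    and smult_r_distr:
      "\<lbrakk>a \<in> carrier R; x \<in> carrier M; y \<in> carrier M\<rbrakk> \<Longrightarrow>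
         a \<odot>\<^bsub>M\<^esub> (x \<oplus>\<^bsub>M\<^esub> y) = a \<odot>\<^bsub>M\<^esub> x \<oplus>\<^bsub>M\<^esub> a \<odot>\<^bsub>M\<^esub> y"
    and smult_assoc1:
      "\<lbrakk>a \<in> carrier R; b \<in> carrier R; x \<in> carrier M\<rbrakk> \<Longrightarrow>
         (a \<otimes> b) \<odot>\<^bsub>M\<^esub> x = a \<odot>\<^bsub>M\<^esub> (b \<odot>\<^bsub>M\<^esub> x)"
    and smult_one:
      "x \<in> carrier M \<Longrightarrow> \<one> \<odot>\<^bsub>M\<^esub> x = x"

definition module_homs ::
  "('r, 'e) ring_scheme \<Rightarrow> ('r, 'u) module \<Rightarrow> ('r, 'u) module \<Rightarrow> ('u \<Rightarrow> 'u) set" where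
  "module_homs R M N = {f \<in> carrier M \<rightarrow>\<^sub>E carrier N.
     (\<forall>x\<in>carrier M. \<forall>y\<in>carrier M. f (x \<oplus>\<^bsub>M\<^esub> y) = f x \<oplus>\<^bsub>N\<^esub> f y) \<and>
     (\<forall>a\<in>carrier R. \<forall>x\<in>carrier M. f (a \<odot>\<^bsub>M\<^esub> x) = a \<odot>\<^bsub>N\<^esub> f x)}"

definition Mod :: "('r, 'e) ring_scheme \<Rightarrow> (('r, 'u) module, 'u \<Rightarrow> 'u) category" where
  "Mod R = \<lparr>
     Obj = {M. left_module R M \<and> small TYPE('u) (carrier M)},
     Hom = module_homs R,
     Comp = (\<lambda>A g f. compose (carrier A) g f),
     Ident = (\<lambda>A. restrict id (carrier A))\<rparr>"

definition short_exact ::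
  "('r, 'e) ring_scheme \<Rightarrow> ('r, 'u) module \<Rightarrow> ('u \<Rightarrow> 'u) \<Rightarrow> ('r, 'u) module \<Rightarrow> ('u \<Rightarrow> 'u)
     \<Rightarrow> ('r, 'u) module \<Rightarrow> bool" where
  "short_exact R A f B g C \<longleftrightarrow>
     f \<in> module_homs R A B \<and> g \<in> module_homs R B C \<and>
     inj_on f (carrier A) \<and> f ` carrier A = {x \<in> carrier B. g x = \<zero>\<^bsub>C\<^esub>} \<and>
     g ` carrier B = carrier C"

definition closed_under_extensions ::
  "('r, 'e) ring_scheme \<Rightarrow> ('r, 'u) module set \<Rightarrow> bool" where
  "closed_under_extensions R \<X> \<longleftrightarrow>
     (\<forall>A f B g C. A \<in> \<X> \<and> B \<in> Obj (Mod R) \<and> C \<in> \<X> \<and> short_exact R A f B g C \<longrightarrow> B \<in> \<X>)"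


section \<open>Complexes\<close>

record ('r, 'u) chain_complex =
  Term :: "int \<Rightarrow> ('r, 'u) module"
  Diff :: "int \<Rightarrow> 'u \<Rightarrow> 'u"

definition is_complex :: "('r, 'e) ring_scheme \<Rightarrow> ('r, 'u) chain_complex \<Rightarrow> bool" where
  "is_complex R K \<longleftrightarrow>
     (\<forall>n. Term K n \<in> Obj (Mod R)) \<and>
     (\<forall>n. Diff K n \<in> module_homs R (Term K n) (Term K (n - 1))) \<and>
     (\<forall>n. \<forall>x\<in>carrier (Term K n). Diff K (n - 1) (Diff K n x) = \<zero>\<^bsub>Term K (n - 2)\<^esub>)"

definition chain_maps ::
  "('r, 'e) ring_scheme \<Rightarrow> ('r, 'u) chain_complex \<Rightarrow> ('r, 'u) chain_complex
     \<Rightarrow> (int \<Rightarrow> 'u \<Rightarrow> 'u) set" where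
  "chain_maps R K L = {f.
     (\<forall>n. f n \<in> module_homs R (Term K n) (Term L n)) \<and>
     (\<forall>n. \<forall>x\<in>carrier (Term K n). f (n - 1) (Diff K n x) = Diff L n (f n x))}"

definition Ch :: "('r, 'e) ring_scheme \<Rightarrow> (('r, 'u) chain_complex, int \<Rightarrow> 'u \<Rightarrow> 'u) category" where
  "Ch R = \<lparr>
     Obj = {K. is_complex R K},
     Hom = chain_maps R,
     Comp = (\<lambda>K g f n. compose (carrier (Term K n)) (g n) (f n)),
     Ident = (\<lambda>K n. restrict id (carrier (Term K n)))\<rparr>"

definition complexes_of ::
  "('r, 'e) ring_scheme \<Rightarrow> ('r, 'u) module set \<Rightarrow> ('r, 'u) chain_complex set" where
  "complexes_of R \<X> = {K \<in> Obj (Ch R). \<forall>n. Term K n \<in> \<X>}"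

end

theory Submission
  imports Defs "HOL-Library.Countable"
begin

text \<open>
  A precover of a complex is built from precovers of modules by a tower of pullbacks, and is then
  improved to a cover by Enochs' argument, in which direct limits bound the kernels and the images
  of endomorphisms.

  \<^bold>\<open>Precovers.\<close> Let \<open>Q\<close> be a complex and choose an \<open>\<X>\<close>-precover \<open>\<phi>\<^sub>n : P\<^sub>n \<rightarrow> Q\<^sub>n\<close> of each
  term. The modules \<open>{(x, y) \<in> P\<^sub>n \<times> P\<^sub>n\<^sub>-\<^sub>1. d (\<phi> x) = \<phi> y}\<close> form a complex \<open>Q'\<close> with differential
  \<open>(x, y) \<mapsto> (y, 0)\<close>, and \<open>(x, y) \<mapsto> \<phi> x\<close> is a chain map from \<open>Q'\<close> to \<open>Q\<close>. A chain map \<open>f\<close> from a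
  complex \<open>Y\<close> with terms in \<open>\<X>\<close> to \<open>Q\<close> factors through \<open>Q'\<close>: if \<open>g\<close> is a termwise lift of \<open>f\<close>
  along \<open>\<phi>\<close>, then \<open>y \<mapsto> (g y, g (d y))\<close> is a chain map (\<open>precover_step\<close>). The terms of \<open>Q'\<close> need
  not lie in \<open>\<X>\<close>, but \<open>Q'\<^sub>n \<rightarrow> Q\<^sub>n\<close> factors through \<open>P\<^sub>n \<in> \<X>\<close>. Hence in the tower
  \<open>\<dots> \<rightarrow> Q\<^sub>2 \<rightarrow> Q\<^sub>1 \<rightarrow> Q\<^sub>0 = K\<close> obtained by iteration the terms are interleaved with modules in \<open>\<X>\<close>,
  so that each term of the limit of the tower is an inverse limit of modules in \<open>\<X>\<close>. It lies in \<open>\<X>\<close>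
  by closure under inverse limits, applied to complexes with zero differential
  (\<open>sequence_limits_in_class\<close>). Since chain maps lift step by step along the tower, its limit is
  a precover of \<open>K\<close> (\<open>precovers_of_complexes\<close>).

  \<^bold>\<open>Covers.\<close> Let \<open>F \<rightarrow> K\<close> be a precover. The limit of a direct system of copies of \<open>F\<close> over \<open>K\<close>
  again maps to \<open>F\<close> over \<open>K\<close>, so such a system can always be prolonged by one more copy of \<open>F\<close>; by
  Zorn's lemma there are linearly ordered systems indexed by arbitrarily large small sets
  (\<open>chain_of_endomorphisms\<close>). If every endomorphism could be followed by one that enlarges its
  kernel, a large system would produce more kernels in \<open>F\<close> than there are sets of elements. So there
  is an endomorphism \<open>h\<close> whose kernel is not enlarged by following it with any other
  (\<open>stable_kernel_endomorphism\<close>). The direct limit of \<open>F \<rightarrow> F \<rightarrow> F \<rightarrow> \<dots>\<close> along \<open>h\<close> is a precover with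
  injective endomorphisms only (\<open>precover_with_injective_endomorphisms\<close>). If one of these were not
  surjective, a large system would produce too many images in the same way
  (\<open>injective_endomorphisms_surjective\<close>). So all of them are bijective, hence automorphisms.
\<close>

section \<open>Small sets\<close>

lemma small_mono:
  assumes "small TYPE('u) B" and "inj_on f A" and "f ` A \<subseteq> B"
  shows "small TYPE('u) A"
proof -
  have "|A| \<le>o |B|"
    using assms(2,3) by (intro iffD1[OF card_of_ordLeq]) auto
  then show ?thesis
    using assms(1) unfolding small_def by (rule ordLeq_ordLess_trans)
qed

lemma small_subset: "small TYPE('u) B \<Longrightarrow> A \<subseteq> B \<Longrightarrow> small TYPE('u) A"
  by (rule small_mono[of B "\<lambda>x. x"]) auto

lemma small_image: "small TYPE('u) A \<Longrightarrow> small TYPE('u) (f ` A)"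
  unfolding small_def by (rule ordLeq_ordLess_trans[OF card_of_image])

lemma small_embeds:
  assumes "small TYPE('u) A"
  obtains f :: "'a \<Rightarrow> 'u" where "inj_on f A"
proof -
  have "|A| \<le>o |UNIV :: 'u set|"
    using assms unfolding small_def by (rule ordLess_imp_ordLeq)
  then show ?thesis
    using that by (auto simp: card_of_ordLeq[symmetric])
qed

locale small_sets =
  fixes U :: "'u itself"
  assumes universe: "universe TYPE('u)"
begin

lemma small_nat: "small TYPE('u) (UNIV :: nat set)"
  using universe unfolding universe_def by blast

lemma infinite_UNIV: "infinite (UNIV :: 'u set)"
  using card_of_ordLeq_finite[OF ordLess_imp_ordLeq[OF small_nat[unfolded small_def]]] by auto

lemma small_countable: "small TYPE('u) (A :: 'a :: countable set)"
  by (rule small_mono[OF small_nat, of to_nat]) (auto simp: inj_on_def)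

lemma small_Sigma:
  assumes "small TYPE('u) A" and "\<And>a. a \<in> A \<Longrightarrow> small TYPE('u) (B a)"
  shows "small TYPE('u) (Sigma A B)"
proof -
  have "stable |UNIV :: 'u set|"
    using universe infinite_UNIV unfolding universe_def
    by (intro regularCard_stable card_of_Card_order) (auto simp: Field_card_of)
  from stable_elim[OF this, of A B] show ?thesis
    using assms unfolding small_def by blast
qed

lemma small_Pow:
  assumes "small TYPE('u) A"
  shows "small TYPE('u) (Pow A)"
proof -
  obtain f :: "'a \<Rightarrow> 'u" where f: "inj_on f A"
    using small_embeds[OF assms] by blast
  have "small TYPE('u) (Pow (f ` A))"
    using universe small_image[OF assms] unfolding universe_def by blast
  moreover have "inj_on ((`) f) (Pow A)"
    using f by (meson PowD inj_onI inj_on_image_eq_iff)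
  ultimately show ?thesis
    by (rule small_mono) blast
qed

text \<open>
  A family is determined by its graph, which is a subset of a small set.
\<close>

lemma small_countable_sequences:
  fixes B :: "'j :: countable \<Rightarrow> 'a set"
  assumes "\<And>j. small TYPE('u) (B j)"
  shows "small TYPE('u) {s. \<forall>j. s j \<in> B j}"
proof -
  have "small TYPE('u) (Pow (Sigma UNIV B))"
    by (intro small_Pow small_Sigma small_countable assms)
  then show ?thesis
  proof (rule small_mono)
    show "inj_on (\<lambda>s. range (\<lambda>j. (j, s j))) {s. \<forall>j. s j \<in> B j}"
    proof (rule inj_onI)
      fix s s' assume eq: "range (\<lambda>j. (j, s j)) = range (\<lambda>j. (j, s' j))"
      show "s = s'"
      proof
        fix j
        have "(j, s j) \<in> range (\<lambda>j. (j, s' j))"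
          unfolding eq[symmetric] by simp
        then show "s j = s' j" by blast
      qed
    qed
  qed blast
qed

text \<open>
  This is Cantor's theorem. The index set is found inside the universe because direct systems are
  indexed by subsets of the universe.
\<close>

lemma large_index_set:
  assumes "small TYPE('u) A"
  obtains W :: "'u set" where "small TYPE('u) W" and "\<not> (\<exists>f. inj_on f W \<and> f ` W \<subseteq> A)"
    and "W \<noteq> {}"
proof -
  have P: "small TYPE('u) (Pow A)"
    by (rule small_Pow[OF assms])
  obtain e :: "'a set \<Rightarrow> 'u" where e: "inj_on e (Pow A)"
    using small_embeds[OF P] by blast
  have "\<not> (\<exists>f. inj_on f (e ` Pow A) \<and> f ` (e ` Pow A) \<subseteq> A)"
  proof
    assume "\<exists>f. inj_on f (e ` Pow A) \<and> f ` (e ` Pow A) \<subseteq> A"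
    then obtain f where f: "inj_on f (e ` Pow A)" "f ` (e ` Pow A) \<subseteq> A"
      by blast
    have "inj_on (f \<circ> e) (Pow A)" and "(f \<circ> e) ` Pow A \<subseteq> A"
      using comp_inj_on[OF e f(1)] f(2) by (simp_all only: image_comp)
    then have "|Pow A| \<le>o |A|"
      unfolding card_of_ordLeq[symmetric] by blast
    with card_of_Pow[of A] show False
      by (simp add: not_ordLess_ordLeq)
  qed
  then show ?thesis
    using that[of "e ` Pow A"] small_image[OF P] by blast
qed

end

section \<open>Modules and their homomorphisms\<close>

lemma Mod_simps [simp]:
  "M \<in> Obj (Mod R) \<longleftrightarrow> left_module R (M :: ('r, 'u) module) \<and> small TYPE('u) (carrier M)"
  "Hom (Mod R) = module_homs R"
  "Comp (Mod R) M g f = compose (carrier M) g f"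
  "Ident (Mod R) M = restrict id (carrier M)"
  by (simp_all add: Mod_def)

lemma left_moduleI:
  fixes M :: "('r, 'a) module"
  assumes "ring R"
    and add: "\<And>x y. x \<in> carrier M \<Longrightarrow> y \<in> carrier M \<Longrightarrow> x \<oplus>\<^bsub>M\<^esub> y \<in> carrier M"
    and zero: "\<zero>\<^bsub>M\<^esub> \<in> carrier M"
    and smult: "\<And>a x. a \<in> carrier R \<Longrightarrow> x \<in> carrier M \<Longrightarrow> a \<odot>\<^bsub>M\<^esub> x \<in> carrier M"
    and "\<And>x y z. x \<in> carrier M \<Longrightarrow> y \<in> carrier M \<Longrightarrow> z \<in> carrier M \<Longrightarrow>
           (x \<oplus>\<^bsub>M\<^esub> y) \<oplus>\<^bsub>M\<^esub> z = x \<oplus>\<^bsub>M\<^esub> (y \<oplus>\<^bsub>M\<^esub> z)"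
    and "\<And>x y. x \<in> carrier M \<Longrightarrow> y \<in> carrier M \<Longrightarrow> x \<oplus>\<^bsub>M\<^esub> y = y \<oplus>\<^bsub>M\<^esub> x"
    and "\<And>x. x \<in> carrier M \<Longrightarrow> \<zero>\<^bsub>M\<^esub> \<oplus>\<^bsub>M\<^esub> x = x"
    and "\<And>x. x \<in> carrier M \<Longrightarrow> \<exists>y\<in>carrier M. y \<oplus>\<^bsub>M\<^esub> x = \<zero>\<^bsub>M\<^esub>"
    and "\<And>a b x. a \<in> carrier R \<Longrightarrow> b \<in> carrier R \<Longrightarrow> x \<in> carrier M \<Longrightarrow>
           (a \<oplus>\<^bsub>R\<^esub> b) \<odot>\<^bsub>M\<^esub> x = a \<odot>\<^bsub>M\<^esub> x \<oplus>\<^bsub>M\<^esub> b \<odot>\<^bsub>M\<^esub> x"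
    and "\<And>a x y. a \<in> carrier R \<Longrightarrow> x \<in> carrier M \<Longrightarrow> y \<in> carrier M \<Longrightarrow>
           a \<odot>\<^bsub>M\<^esub> (x \<oplus>\<^bsub>M\<^esub> y) = a \<odot>\<^bsub>M\<^esub> x \<oplus>\<^bsub>M\<^esub> a \<odot>\<^bsub>M\<^esub> y"
    and "\<And>a b x. a \<in> carrier R \<Longrightarrow> b \<in> carrier R \<Longrightarrow> x \<in> carrier M \<Longrightarrow>
           (a \<otimes>\<^bsub>R\<^esub> b) \<odot>\<^bsub>M\<^esub> x = a \<odot>\<^bsub>M\<^esub> (b \<odot>\<^bsub>M\<^esub> x)"
    and "\<And>x. x \<in> carrier M \<Longrightarrow> \<one>\<^bsub>R\<^esub> \<odot>\<^bsub>M\<^esub> x = x"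
  shows "left_module R M"
  unfolding left_module_def left_module_axioms_def
  using assms by (auto intro!: abelian_groupI)

text \<open>
  The module axioms are equations between at most three elements, so they can be checked on the
  images of maps from modules, as long as any three elements lie in one of these images. Both
  submodules of products and direct limits, moved into the universe along an injection, are
  recognised as modules in this way.
\<close>

lemma left_module_locally:
  fixes L :: "('r, 'b) module" and N :: "'i \<Rightarrow> ('r, 'a) module"
  assumes R: "ring R" and I: "I \<noteq> {}"
    and N: "\<And>i. i \<in> I \<Longrightarrow> left_module R (N i)"
    and mem: "\<And>i x. i \<in> I \<Longrightarrow> x \<in> carrier (N i) \<Longrightarrow> u i x \<in> carrier L"
    and zero: "\<And>i. i \<in> I \<Longrightarrow> u i \<zero>\<^bsub>N i\<^esub> = \<zero>\<^bsub>L\<^esub>"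
    and add: "\<And>i x y. i \<in> I \<Longrightarrow> x \<in> carrier (N i) \<Longrightarrow> y \<in> carrier (N i) \<Longrightarrow>
                u i (x \<oplus>\<^bsub>N i\<^esub> y) = u i x \<oplus>\<^bsub>L\<^esub> u i y"
    and smult: "\<And>i a x. i \<in> I \<Longrightarrow> a \<in> carrier R \<Longrightarrow> x \<in> carrier (N i) \<Longrightarrow>
                u i (a \<odot>\<^bsub>N i\<^esub> x) = a \<odot>\<^bsub>L\<^esub> u i x"
    and three: "\<And>x y z. x \<in> carrier L \<Longrightarrow> y \<in> carrier L \<Longrightarrow> z \<in> carrier L \<Longrightarrow>
                \<exists>i\<in>I. {x, y, z} \<subseteq> u i ` carrier (N i)"
  shows "left_module R L"
proof (rule left_moduleI[OF R])
  have abelian: "abelian_group (N i)" "abelian_monoid (N i)" if "i \<in> I" for i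
    using N[OF that] unfolding left_module_def abelian_group_def by blast+
  note abelian_monoidN = abelian_monoid.a_closed[OF abelian(2)]
    abelian_monoid.zero_closed[OF abelian(2)] abelian_monoid.a_assoc[OF abelian(2)]
    abelian_monoid.a_comm[OF abelian(2)] abelian_monoid.l_zero[OF abelian(2)]
  note smultN = left_module.smult_closed[OF N] left_module.smult_l_distr[OF N]
    left_module.smult_r_distr[OF N] left_module.smult_assoc1[OF N] left_module.smult_one[OF N]
  have rep: thesis if "x \<in> carrier L" "y \<in> carrier L" "z \<in> carrier L"
    and "\<And>i x' y' z'. i \<in> I \<Longrightarrow> x' \<in> carrier (N i) \<Longrightarrow> y' \<in> carrier (N i) \<Longrightarrow>
      z' \<in> carrier (N i) \<Longrightarrow> x = u i x' \<Longrightarrow> y = u i y' \<Longrightarrow> z = u i z' \<Longrightarrow> thesis" for x y z thesis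
    using three[OF that(1-3)] that(4) by auto
  show "x \<oplus>\<^bsub>L\<^esub> y \<in> carrier L" if "x \<in> carrier L" "y \<in> carrier L" for x y
    by (rule rep[OF that(1,2,2)]) (simp add: add[symmetric] mem abelian_monoidN)
  obtain i where i: "i \<in> I"
    using I by blast
  show "\<zero>\<^bsub>L\<^esub> \<in> carrier L"
    unfolding zero[OF i, symmetric] by (rule mem[OF i abelian_monoidN(2)[OF i]])
  show "a \<odot>\<^bsub>L\<^esub> x \<in> carrier L" if "a \<in> carrier R" "x \<in> carrier L" for a x
    by (rule rep[OF that(2,2,2)]) (simp add: smult[symmetric] mem smultN that(1))
  show "(x \<oplus>\<^bsub>L\<^esub> y) \<oplus>\<^bsub>L\<^esub> z = x \<oplus>\<^bsub>L\<^esub> (y \<oplus>\<^bsub>L\<^esub> z)"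
    if "x \<in> carrier L" "y \<in> carrier L" "z \<in> carrier L" for x y z
    by (rule rep[OF that]) (simp add: add[symmetric] abelian_monoidN(1,3))
  show "x \<oplus>\<^bsub>L\<^esub> y = y \<oplus>\<^bsub>L\<^esub> x" if "x \<in> carrier L" "y \<in> carrier L" for x y
    by (rule rep[OF that(1,2,2)]) (simp add: add[symmetric] abelian_monoidN(4))
  show "\<zero>\<^bsub>L\<^esub> \<oplus>\<^bsub>L\<^esub> x = x" if "x \<in> carrier L" for x
  proof (rule rep[OF that that that])
    fix i x' assume i: "i \<in> I" and x': "x' \<in> carrier (N i)" "x = u i x'"
    then show ?thesis
      by (simp add: zero[OF i, symmetric] add[symmetric] abelian_monoidN(1,2,5))
  qed
  show "\<exists>y\<in>carrier L. y \<oplus>\<^bsub>L\<^esub> x = \<zero>\<^bsub>L\<^esub>" if "x \<in> carrier L" for x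
  proof (rule rep[OF that that that])
    fix i x' assume i: "i \<in> I" and x': "x' \<in> carrier (N i)" "x = u i x'"
    have "\<ominus>\<^bsub>N i\<^esub> x' \<in> carrier (N i)"
      by (rule abelian_group.a_inv_closed[OF abelian(1)[OF i] x'(1)])
    moreover from this have "u i (\<ominus>\<^bsub>N i\<^esub> x') \<oplus>\<^bsub>L\<^esub> x = \<zero>\<^bsub>L\<^esub>"
      using i x' by (simp add: add[symmetric] abelian_group.l_neg[OF abelian(1)] zero)
    ultimately show ?thesis
      using mem[OF i] by blast
  qed
  show "(a \<oplus>\<^bsub>R\<^esub> b) \<odot>\<^bsub>L\<^esub> x = a \<odot>\<^bsub>L\<^esub> x \<oplus>\<^bsub>L\<^esub> b \<odot>\<^bsub>L\<^esub> x"
    if "a \<in> carrier R" "b \<in> carrier R" "x \<in> carrier L" for a b x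
    by (rule rep[OF that(3,3,3)])
      (simp add: add[symmetric] smult[symmetric] smultN that ring.ring_simprules(1)[OF R])
  show "a \<odot>\<^bsub>L\<^esub> (x \<oplus>\<^bsub>L\<^esub> y) = a \<odot>\<^bsub>L\<^esub> x \<oplus>\<^bsub>L\<^esub> a \<odot>\<^bsub>L\<^esub> y"
    if "a \<in> carrier R" "x \<in> carrier L" "y \<in> carrier L" for a x y
    by (rule rep[OF that(2,3,3)])
      (simp add: add[symmetric] smult[symmetric] smultN abelian_monoidN(1) that)
  show "(a \<otimes>\<^bsub>R\<^esub> b) \<odot>\<^bsub>L\<^esub> x = a \<odot>\<^bsub>L\<^esub> (b \<odot>\<^bsub>L\<^esub> x)"
    if "a \<in> carrier R" "b \<in> carrier R" "x \<in> carrier L" for a b x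
    by (rule rep[OF that(3,3,3)])
      (simp add: smult[symmetric] smultN that ring.ring_simprules(5)[OF R])
  show "\<one>\<^bsub>R\<^esub> \<odot>\<^bsub>L\<^esub> x = x" if "x \<in> carrier L" for x
    by (rule rep[OF that that that])
      (simp add: smult[symmetric] smultN ring.ring_simprules(6)[OF R])
qed

lemma
  assumes "left_module R M"
  shows module_abelian: "abelian_group M"
    and module_zero: "\<zero>\<^bsub>M\<^esub> \<in> carrier M"
    and module_add: "x \<in> carrier M \<Longrightarrow> y \<in> carrier M \<Longrightarrow> x \<oplus>\<^bsub>M\<^esub> y \<in> carrier M"
    and module_smult: "a \<in> carrier R \<Longrightarrow> x \<in> carrier M \<Longrightarrow> a \<odot>\<^bsub>M\<^esub> x \<in> carrier M"
proof -
  interpret left_module R M by (rule assms)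
  show "abelian_group M" ..
  show "\<zero>\<^bsub>M\<^esub> \<in> carrier M" by simp
  show "x \<in> carrier M \<Longrightarrow> y \<in> carrier M \<Longrightarrow> x \<oplus>\<^bsub>M\<^esub> y \<in> carrier M" by simp
  show "a \<in> carrier R \<Longrightarrow> x \<in> carrier M \<Longrightarrow> a \<odot>\<^bsub>M\<^esub> x \<in> carrier M" by (rule smult_closed)
qed

lemma hom_closed: "f \<in> module_homs R M N \<Longrightarrow> x \<in> carrier M \<Longrightarrow> f x \<in> carrier N"
  unfolding module_homs_def by blast

lemma hom_add: "f \<in> module_homs R M N \<Longrightarrow> x \<in> carrier M \<Longrightarrow> y \<in> carrier M \<Longrightarrow>
    f (x \<oplus>\<^bsub>M\<^esub> y) = f x \<oplus>\<^bsub>N\<^esub> f y"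
  unfolding module_homs_def by blast

lemma hom_smult: "f \<in> module_homs R M N \<Longrightarrow> a \<in> carrier R \<Longrightarrow> x \<in> carrier M \<Longrightarrow>
    f (a \<odot>\<^bsub>M\<^esub> x) = a \<odot>\<^bsub>N\<^esub> f x"
  unfolding module_homs_def by blast

lemma homI:
  assumes "\<And>x. x \<in> carrier M \<Longrightarrow> f x \<in> carrier N"
    and "\<And>x y. x \<in> carrier M \<Longrightarrow> y \<in> carrier M \<Longrightarrow> f (x \<oplus>\<^bsub>M\<^esub> y) = f x \<oplus>\<^bsub>N\<^esub> f y"
    and "\<And>a x. a \<in> carrier R \<Longrightarrow> x \<in> carrier M \<Longrightarrow> f (a \<odot>\<^bsub>M\<^esub> x) = a \<odot>\<^bsub>N\<^esub> f x"
    and "left_module R M"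
  shows "restrict f (carrier M) \<in> module_homs R M N"
  using assms unfolding module_homs_def by (auto simp: module_add module_smult)

lemma hom_eqI:
  assumes "f \<in> module_homs R M N" and "g \<in> module_homs R M N'"
    and "\<And>x. x \<in> carrier M \<Longrightarrow> f x = g x"
  shows "f = g"
  using assms unfolding module_homs_def by (auto intro: extensionalityI simp: PiE_iff)

lemma hom_compose:
  "f \<in> module_homs R M N \<Longrightarrow> g \<in> module_homs R N P \<Longrightarrow> left_module R M \<Longrightarrow>
   compose (carrier M) g f \<in> module_homs R M P"
  unfolding compose_def by (rule homI) (auto simp: hom_closed hom_add hom_smult)

lemma hom_id: "left_module R M \<Longrightarrow> restrict id (carrier M) \<in> module_homs R M M"
  by (rule homI) auto

lemma hom_zero:
  assumes f: "f \<in> module_homs R M N" and M: "left_module R M" and N: "left_module R N"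
  shows "f \<zero>\<^bsub>M\<^esub> = \<zero>\<^bsub>N\<^esub>"
proof -
  interpret M: abelian_group M by (rule module_abelian[OF M])
  interpret N: abelian_group N by (rule module_abelian[OF N])
  have "f \<zero>\<^bsub>M\<^esub> \<oplus>\<^bsub>N\<^esub> f \<zero>\<^bsub>M\<^esub> = f \<zero>\<^bsub>M\<^esub>"
    using hom_add[OF f, of "\<zero>\<^bsub>M\<^esub>" "\<zero>\<^bsub>M\<^esub>"] by simp
  then show ?thesis
    using hom_closed[OF f M.zero_closed] by (metis N.add.l_cancel_one)
qed

lemma zero_hom:
  assumes M: "left_module R M" and N: "left_module R N"
  shows "restrict (\<lambda>_. \<zero>\<^bsub>N\<^esub>) (carrier M) \<in> module_homs R M N"
proof (rule homI[OF _ _ _ M])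
  interpret N: abelian_group N by (rule module_abelian[OF N])
  show "\<zero>\<^bsub>N\<^esub> \<in> carrier N" by simp
  show "\<zero>\<^bsub>N\<^esub> = \<zero>\<^bsub>N\<^esub> \<oplus>\<^bsub>N\<^esub> \<zero>\<^bsub>N\<^esub>" by simp
  fix a assume a: "a \<in> carrier R"
  have "a \<odot>\<^bsub>N\<^esub> \<zero>\<^bsub>N\<^esub> \<oplus>\<^bsub>N\<^esub> a \<odot>\<^bsub>N\<^esub> \<zero>\<^bsub>N\<^esub> = a \<odot>\<^bsub>N\<^esub> \<zero>\<^bsub>N\<^esub>"
    using left_module.smult_r_distr[OF N a, of "\<zero>\<^bsub>N\<^esub>" "\<zero>\<^bsub>N\<^esub>"] by simp
  then show "\<zero>\<^bsub>N\<^esub> = a \<odot>\<^bsub>N\<^esub> \<zero>\<^bsub>N\<^esub>"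
    using left_module.smult_closed[OF N a N.zero_closed] by (metis N.add.l_cancel_one N.zero_closed)
qed

lemma hom_inj_iff:
  assumes f: "f \<in> module_homs R M N" and M: "left_module R M" and N: "left_module R N"
  shows "inj_on f (carrier M) \<longleftrightarrow> (\<forall>x\<in>carrier M. f x = \<zero>\<^bsub>N\<^esub> \<longrightarrow> x = \<zero>\<^bsub>M\<^esub>)"
proof
  interpret M: abelian_group M by (rule module_abelian[OF M])
  interpret N: abelian_group N by (rule module_abelian[OF N])
  show "inj_on f (carrier M)" if ker: "\<forall>x\<in>carrier M. f x = \<zero>\<^bsub>N\<^esub> \<longrightarrow> x = \<zero>\<^bsub>M\<^esub>"
  proof (rule inj_onI)
    fix x y assume x: "x \<in> carrier M" and y: "y \<in> carrier M" and eq: "f x = f y"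
    have "f (x \<oplus>\<^bsub>M\<^esub> (\<ominus>\<^bsub>M\<^esub> y)) = f (y \<oplus>\<^bsub>M\<^esub> (\<ominus>\<^bsub>M\<^esub> y))"
      using x y eq by (simp add: hom_add[OF f])
    also have "\<dots> = \<zero>\<^bsub>N\<^esub>"
      using y by (simp add: M.r_neg hom_zero[OF f M N])
    finally have "x \<oplus>\<^bsub>M\<^esub> (\<ominus>\<^bsub>M\<^esub> y) = \<zero>\<^bsub>M\<^esub>"
      using ker x y by simp
    then show "x = y"
      using x y M.minus_equality M.minus_minus by (metis M.a_inv_closed)
  qed
qed (metis M f hom_zero N inj_onD module_zero)

section \<open>Limits of modules\<close>

locale modules_in_universe = small_sets U
  for U :: "'u itself" +
  fixes R :: "('r, 'e) ring_scheme"
  assumes ring: "ring R"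
begin

text \<open>
  The elements of the product are families, so a submodule \<open>S\<close> of the product does not have its
  carrier in the universe; \<open>L\<close> is the copy of \<open>S\<close> along an injection of the small set \<open>S\<close> into the
  universe. Both pullbacks and limits of sequences are of this form.
\<close>

lemma submodule_of_countable_product:
  fixes M :: "'j :: countable \<Rightarrow> ('r, 'u) module" and S :: "('j \<Rightarrow> 'u) set"
  assumes M: "\<And>j. M j \<in> Obj (Mod R)"
    and S: "\<And>s j. s \<in> S \<Longrightarrow> s j \<in> carrier (M j)"
    and zero: "(\<lambda>j. \<zero>\<^bsub>M j\<^esub>) \<in> S"
    and add: "\<And>s s'. s \<in> S \<Longrightarrow> s' \<in> S \<Longrightarrow> (\<lambda>j. s j \<oplus>\<^bsub>M j\<^esub> s' j) \<in> S"
    and smult: "\<And>a s. a \<in> carrier R \<Longrightarrow> s \<in> S \<Longrightarrow> (\<lambda>j. a \<odot>\<^bsub>M j\<^esub> s j) \<in> S"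
  obtains L :: "('r, 'u) module" and \<pi> where "L \<in> Obj (Mod R)"
    and "\<And>j. \<pi> j \<in> module_homs R L (M j)"
    and "bij_betw (\<lambda>x j. \<pi> j x) (carrier L) S"
proof -
  define P :: "('r, 'j \<Rightarrow> 'u) module" where
    "P = \<lparr>carrier = S, mult = undefined, one = undefined, zero = (\<lambda>j. \<zero>\<^bsub>M j\<^esub>),
      add = (\<lambda>s s' j. s j \<oplus>\<^bsub>M j\<^esub> s' j), smult = (\<lambda>a s j. a \<odot>\<^bsub>M j\<^esub> s j)\<rparr>"
  have P_simps: "carrier P = S" "\<zero>\<^bsub>P\<^esub> = (\<lambda>j. \<zero>\<^bsub>M j\<^esub>)"
    "s \<oplus>\<^bsub>P\<^esub> s' = (\<lambda>j. s j \<oplus>\<^bsub>M j\<^esub> s' j)" "a \<odot>\<^bsub>P\<^esub> s = (\<lambda>j. a \<odot>\<^bsub>M j\<^esub> s j)" for s s' a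
    by (simp_all add: P_def)
  have Mj: "left_module R (M j)" for j
    using M by simp
  note abelian = module_abelian[OF Mj] abelian_group.axioms(1)[OF module_abelian[OF Mj]]
  note monoidM = abelian_monoid.a_assoc[OF abelian(2)] abelian_monoid.a_comm[OF abelian(2)]
    abelian_monoid.l_zero[OF abelian(2)]
  \<comment> \<open>Closure under scalar multiplication makes \<open>S\<close> closed under negation.\<close>
  have minus: "(\<ominus>\<^bsub>R\<^esub> \<one>\<^bsub>R\<^esub>) \<odot>\<^bsub>M j\<^esub> x \<oplus>\<^bsub>M j\<^esub> x = \<zero>\<^bsub>M j\<^esub>" if x: "x \<in> carrier (M j)" for j x
  proof -
    interpret left_module R "M j" by (rule Mj)
    have "(\<ominus>\<^bsub>R\<^esub> \<one>\<^bsub>R\<^esub> \<oplus>\<^bsub>R\<^esub> \<one>\<^bsub>R\<^esub>) \<odot>\<^bsub>M j\<^esub> x = \<zero>\<^bsub>R\<^esub> \<odot>\<^bsub>M j\<^esub> x"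
      by (simp add: R.l_neg)
    moreover have "\<zero>\<^bsub>R\<^esub> \<odot>\<^bsub>M j\<^esub> x = \<zero>\<^bsub>M j\<^esub>"
      using smult_l_distr[of "\<zero>\<^bsub>R\<^esub>" "\<zero>\<^bsub>R\<^esub>" x] x smult_closed[of "\<zero>\<^bsub>R\<^esub>" x]
      by (simp add: M.add.l_cancel_one)
    ultimately show ?thesis
      using x by (simp add: smult_l_distr smult_one)
  qed
  have P: "left_module R P"
  proof (rule left_moduleI[OF ring]; unfold P_simps)
    fix s assume s: "s \<in> S"
    have "(\<lambda>j. (\<ominus>\<^bsub>R\<^esub> \<one>\<^bsub>R\<^esub>) \<odot>\<^bsub>M j\<^esub> s j) \<in> S"
      using s ring.ring_simprules(3,6)[OF ring] by (intro smult) auto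
    then show "\<exists>s'\<in>S. (\<lambda>j. s' j \<oplus>\<^bsub>M j\<^esub> s j) = (\<lambda>j. \<zero>\<^bsub>M j\<^esub>)"
      by (rule rev_bexI) (simp add: minus S s)
  qed (auto simp: zero add smult S monoidM left_module.smult_l_distr[OF Mj]
      left_module.smult_r_distr[OF Mj] left_module.smult_assoc1[OF Mj]
      left_module.smult_one[OF Mj])
  have small_S: "small TYPE('u) S"
    by (rule small_subset[OF small_countable_sequences[of "\<lambda>j. carrier (M j)"]]) (use M S in auto)
  obtain e :: "('j \<Rightarrow> 'u) \<Rightarrow> 'u" where e: "inj_on e S"
    using small_embeds[OF small_S] by blast
  define d where "d = inv_into S e"
  have d [simp]: "d (e s) = s" if "s \<in> S" for s
    using e that by (simp add: d_def)
  define L :: "('r, 'u) module" where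
    "L = \<lparr>carrier = e ` S, mult = undefined, one = undefined, zero = e \<zero>\<^bsub>P\<^esub>,
      add = (\<lambda>x y. e (d x \<oplus>\<^bsub>P\<^esub> d y)), smult = (\<lambda>a x. e (a \<odot>\<^bsub>P\<^esub> d x))\<rparr>"
  have L_simps: "carrier L = e ` S" "\<zero>\<^bsub>L\<^esub> = e \<zero>\<^bsub>P\<^esub>"
    "x \<oplus>\<^bsub>L\<^esub> y = e (d x \<oplus>\<^bsub>P\<^esub> d y)" "a \<odot>\<^bsub>L\<^esub> x = e (a \<odot>\<^bsub>P\<^esub> d x)" for x y a
    by (simp_all add: L_def)
  have L: "left_module R L"
    by (rule left_module_locally[OF ring, of "{()}" "\<lambda>_. P" "\<lambda>_. e"])
      (auto simp: P L_simps, auto simp: P_simps)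
  show ?thesis
  proof (rule that)
    show "L \<in> Obj (Mod R)"
      using L small_image[OF small_S] by (simp add: L_simps)
    show "restrict (\<lambda>x. d x j) (carrier L) \<in> module_homs R L (M j)" for j
      by (rule homI[OF _ _ _ L]) (auto simp: L_simps S, auto simp: P_simps add smult)
    show "bij_betw (\<lambda>x j. restrict (\<lambda>x. d x j) (carrier L) x) (carrier L) S"
      unfolding bij_betw_def
    proof
      show "inj_on (\<lambda>x j. restrict (\<lambda>x. d x j) (carrier L) x) (carrier L)"
      proof (rule inj_onI)
        fix x y assume xy: "x \<in> carrier L" "y \<in> carrier L"
          and eq: "(\<lambda>j. restrict (\<lambda>x. d x j) (carrier L) x) = (\<lambda>j. restrict (\<lambda>x. d x j) (carrier L) y)"
        have "d x = d y"
          using fun_cong[OF eq] xy by (intro ext) simp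
        then show "x = y"
          using xy by (auto simp: L_simps)
      qed
      show "(\<lambda>x j. restrict (\<lambda>x. d x j) (carrier L) x) ` carrier L = S"
        by (auto simp: L_simps image_image)
    qed
  qed
qed

lemma lift_into_product:
  fixes M :: "'j \<Rightarrow> ('r, 'u) module"
  assumes L: "left_module R L" and N: "left_module R N"
    and \<pi>: "\<And>j. \<pi> j \<in> module_homs R L (M j)"
    and bij: "bij_betw (\<lambda>x j. \<pi> j x) (carrier L) S"
    and v: "\<And>j. v j \<in> module_homs R N (M j)"
    and S: "\<And>x. x \<in> carrier N \<Longrightarrow> (\<lambda>j. v j x) \<in> S"
  shows "\<exists>h\<in>module_homs R N L. \<forall>j. \<forall>x\<in>carrier N. \<pi> j (h x) = v j x"
proof -
  have "\<forall>x\<in>carrier N. \<exists>y\<in>carrier L. \<forall>j. \<pi> j y = v j x"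
  proof
    fix x assume "x \<in> carrier N"
    then have "(\<lambda>j. v j x) \<in> (\<lambda>y j. \<pi> j y) ` carrier L"
      unfolding bij_betw_imp_surj_on[OF bij] by (rule S)
    then show "\<exists>y\<in>carrier L. \<forall>j. \<pi> j y = v j x"
      by (auto simp: fun_eq_iff)
  qed
  then obtain h where h: "\<And>x. x \<in> carrier N \<Longrightarrow> h x \<in> carrier L"
    "\<And>x j. x \<in> carrier N \<Longrightarrow> \<pi> j (h x) = v j x"
    by metis
  have eqI: "x = y" if "x \<in> carrier L" "y \<in> carrier L" "\<And>j. \<pi> j x = \<pi> j y" for x y
    using bij_betw_imp_inj_on[OF bij] that by (simp add: inj_on_def fun_eq_iff)
  have "restrict h (carrier N) \<in> module_homs R N L"
  proof (rule homI[OF _ _ _ N])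
    show "h x \<in> carrier L" if "x \<in> carrier N" for x
      using h that by simp
    show "h (x \<oplus>\<^bsub>N\<^esub> y) = h x \<oplus>\<^bsub>L\<^esub> h y" if "x \<in> carrier N" "y \<in> carrier N" for x y
      by (rule eqI)
        (simp_all add: h that module_add[OF N] module_add[OF L] hom_add[OF \<pi>] hom_add[OF v])
    show "h (a \<odot>\<^bsub>N\<^esub> x) = a \<odot>\<^bsub>L\<^esub> h x" if "a \<in> carrier R" "x \<in> carrier N" for a x
      by (rule eqI)
        (simp_all add: h that module_smult[OF N] module_smult[OF L] hom_smult[OF \<pi>] hom_smult[OF v])
  qed
  then show ?thesis
    using h(2) by (intro bexI) auto
qed

text \<open>
  The limit is described by its elements instead of a universal property: they correspond to the
  compatible sequences of elements.
\<close>

definition is_sequence_limit ::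
  "(nat \<Rightarrow> ('r, 'u) module) \<Rightarrow> (nat \<Rightarrow> 'u \<Rightarrow> 'u) \<Rightarrow> ('r, 'u) module \<Rightarrow> (nat \<Rightarrow> 'u \<Rightarrow> 'u) \<Rightarrow> bool"
  where "is_sequence_limit Q p L \<pi> \<longleftrightarrow>
     L \<in> Obj (Mod R) \<and> (\<forall>k. \<pi> k \<in> module_homs R L (Q k)) \<and>
     bij_betw (\<lambda>x k. \<pi> k x) (carrier L)
       {s. (\<forall>k. s k \<in> carrier (Q k)) \<and> (\<forall>k. p k (s (Suc k)) = s k)}"

lemma sequence_limit_exists:
  assumes Q: "\<And>k. Q k \<in> Obj (Mod R)" and p: "\<And>k. p k \<in> module_homs R (Q (Suc k)) (Q k)"
  shows "\<exists>L \<pi>. is_sequence_limit Q p L \<pi>"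
proof -
  let ?S = "{s. (\<forall>k. s k \<in> carrier (Q k)) \<and> (\<forall>k. p k (s (Suc k)) = s k)}"
  have Qk: "left_module R (Q k)" for k
    using Q by simp
  obtain L \<pi> where "L \<in> Obj (Mod R)" "\<And>k. \<pi> k \<in> module_homs R L (Q k)"
    "bij_betw (\<lambda>x k. \<pi> k x) (carrier L) ?S"
  proof (rule submodule_of_countable_product[of Q ?S])
    show "(\<lambda>k. \<zero>\<^bsub>Q k\<^esub>) \<in> ?S"
      by (simp add: module_zero[OF Qk] hom_zero[OF p Qk Qk])
  qed (use Q in \<open>auto simp: module_add[OF Qk] module_smult[OF Qk] hom_add[OF p] hom_smult[OF p]\<close>)
  then show ?thesis
    unfolding is_sequence_limit_def by blast
qed

lemma
  assumes "is_sequence_limit Q p L \<pi>"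
  shows sequence_limit_Obj: "left_module R L" "small TYPE('u) (carrier L)"
    and sequence_limit_hom: "\<pi> k \<in> module_homs R L (Q k)"
    and sequence_limit_compat: "x \<in> carrier L \<Longrightarrow> p k (\<pi> (Suc k) x) = \<pi> k x"
    and sequence_limit_eqI:
      "x \<in> carrier L \<Longrightarrow> y \<in> carrier L \<Longrightarrow> (\<And>k. \<pi> k x = \<pi> k y) \<Longrightarrow> x = y"
    and sequence_limit_point:
      "(\<And>k. s k \<in> carrier (Q k)) \<Longrightarrow> (\<And>k. p k (s (Suc k)) = s k) \<Longrightarrow>
       \<exists>x\<in>carrier L. \<forall>k. \<pi> k x = s k"
proof -
  let ?S = "{s. (\<forall>k. s k \<in> carrier (Q k)) \<and> (\<forall>k. p k (s (Suc k)) = s k)}"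
  have bij: "bij_betw (\<lambda>x k. \<pi> k x) (carrier L) ?S"
    using assms by (simp add: is_sequence_limit_def)
  show "left_module R L" "small TYPE('u) (carrier L)" "\<pi> k \<in> module_homs R L (Q k)"
    using assms by (simp_all add: is_sequence_limit_def)
  show "p k (\<pi> (Suc k) x) = \<pi> k x" if "x \<in> carrier L"
    using bij_betwE[OF bij] that by blast
  show "x = y" if "x \<in> carrier L" "y \<in> carrier L" "\<And>k. \<pi> k x = \<pi> k y"
    using bij_betw_imp_inj_on[OF bij] that by (simp add: inj_on_def fun_eq_iff)
  show "\<exists>x\<in>carrier L. \<forall>k. \<pi> k x = s k"
    if "\<And>k. s k \<in> carrier (Q k)" "\<And>k. p k (s (Suc k)) = s k"
  proof -
    have "s \<in> (\<lambda>x k. \<pi> k x) ` carrier L"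
      unfolding bij_betw_imp_surj_on[OF bij] using that by blast
    then show ?thesis by auto
  qed
qed

lemma sequence_limit_lift:
  assumes L: "is_sequence_limit Q p L \<pi>" and N: "left_module R N"
    and v: "\<And>k. v k \<in> module_homs R N (Q k)"
    and pv: "\<And>k x. x \<in> carrier N \<Longrightarrow> p k (v (Suc k) x) = v k x"
  shows "\<exists>h\<in>module_homs R N L. \<forall>k. \<forall>x\<in>carrier N. \<pi> k (h x) = v k x"
  using L unfolding is_sequence_limit_def
  by (intro lift_into_product[OF _ N _ _ v]) (auto simp: hom_closed[OF v] pv)

text \<open>
  In addition to a compatible cocone, an elementwise description of the direct limit: every element
  comes from some stage, and two elements of one stage become equal only if they become equal at a
  later stage. The universal property follows (\<open>module_direct_limit_lift\<close>), and the description
  itself gives access to the elements of the limit of a tower of endomorphisms.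
\<close>

definition is_module_direct_limit ::
  "'i set \<Rightarrow> 'i rel \<Rightarrow> ('i \<Rightarrow> ('r, 'u) module) \<Rightarrow> ('i \<Rightarrow> 'i \<Rightarrow> 'u \<Rightarrow> 'u)
    \<Rightarrow> ('r, 'u) module \<Rightarrow> ('i \<Rightarrow> 'u \<Rightarrow> 'u) \<Rightarrow> bool"
  where "is_module_direct_limit I r F t L u \<longleftrightarrow>
     L \<in> Obj (Mod R) \<and> (\<forall>i\<in>I. u i \<in> module_homs R (F i) L) \<and>
     (\<forall>i j. (i, j) \<in> r \<longrightarrow> (\<forall>x\<in>carrier (F i). u j (t i j x) = u i x)) \<and>
     (\<forall>y\<in>carrier L. \<exists>i\<in>I. \<exists>x\<in>carrier (F i). y = u i x) \<and>
     (\<forall>i\<in>I. \<forall>x\<in>carrier (F i). \<forall>y\<in>carrier (F i). u i x = u i y \<longrightarrow>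
        (\<exists>j. (i, j) \<in> r \<and> t i j x = t i j y))"

text \<open>
  The usual quotient of the disjoint union of the modules, with the equivalence classes moved into
  the universe along an injection \<open>e\<close>. The operations choose representatives at a common stage, which
  exist because the index set is directed.
\<close>

lemma module_direct_limit_exists:
  fixes I :: "'i set" and F :: "'i \<Rightarrow> ('r, 'u) module"
  assumes small_I: "small TYPE('u) I" and dir: "directed_poset I r"
    and F: "\<And>i. i \<in> I \<Longrightarrow> F i \<in> Obj (Mod R)"
    and t: "\<And>i j. (i, j) \<in> r \<Longrightarrow> t i j \<in> module_homs R (F i) (F j)"
    and tt: "\<And>i j k x. (i, j) \<in> r \<Longrightarrow> (j, k) \<in> r \<Longrightarrow> x \<in> carrier (F i) \<Longrightarrow>
        t j k (t i j x) = t i k x"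
  shows "\<exists>L u. is_module_direct_limit I r F t L u"
proof -
  have r: "r \<subseteq> I \<times> I" "\<And>i. i \<in> I \<Longrightarrow> (i, i) \<in> r"
    "\<And>i j k. (i, j) \<in> r \<Longrightarrow> (j, k) \<in> r \<Longrightarrow> (i, k) \<in> r"
    using dir unfolding directed_poset_def partial_order_on_def preorder_on_def refl_on_def
      trans_def by blast+
  have upper: "\<exists>k. (i, k) \<in> r \<and> (j, k) \<in> r" if "i \<in> I" "j \<in> I" for i j
    using dir that unfolding directed_poset_def by blast
  have Fi: "left_module R (F i)" if "i \<in> I" for i
    using F[OF that] by simp
  have Fr: "left_module R (F i)" "left_module R (F j)" if "(i, j) \<in> r" for i j
    using that r(1) Fi by auto
  define A where "A = (SIGMA i:I. carrier (F i))"
  define E where "E i x j y \<longleftrightarrow> (\<exists>k. (i, k) \<in> r \<and> (j, k) \<in> r \<and> t i k x = t j k y)" for i x j y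
  \<comment> \<open>Elements identified at one stage are identified at every later stage.\<close>
  have later: "t i l x = t j l y"
    if "t i k x = t j k y" "(i, k) \<in> r" "(j, k) \<in> r" "(k, l) \<in> r"
      "x \<in> carrier (F i)" "y \<in> carrier (F j)" for i j k l x y
    using tt[OF that(2,4,5)] tt[OF that(3,4,6)] that(1) by simp
  have E_refl: "E i x i x" if "i \<in> I" for i x
    using r(2)[OF that] unfolding E_def by blast
  have E_sym: "E j y i x" if "E i x j y" for i x j y
    using that unfolding E_def by metis
  have E_trans: "E i x l z" if ij: "E i x j y" and jl: "E j y l z"
    and x: "x \<in> carrier (F i)" and y: "y \<in> carrier (F j)" and z: "z \<in> carrier (F l)"
    for i x j y l z
  proof -
    obtain k where k: "(i, k) \<in> r" "(j, k) \<in> r" "t i k x = t j k y"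
      using ij unfolding E_def by blast
    obtain k' where k': "(j, k') \<in> r" "(l, k') \<in> r" "t j k' y = t l k' z"
      using jl unfolding E_def by blast
    obtain m where m: "(k, m) \<in> r" "(k', m) \<in> r"
      using upper[of k k'] k(1) k'(1) r(1) by blast
    have "t i m x = t l m z"
      using later[OF k(3,1,2) m(1) x y] later[OF k'(3,1,2) m(2) y z] by simp
    then show ?thesis
      using r(3)[OF k(1) m(1)] r(3)[OF k'(2) m(2)] unfolding E_def by blast
  qed
  define cls where "cls i x = {(j, y) \<in> A. E i x j y}" for i x
  have cls_eq: "cls i x = cls j y \<longleftrightarrow> E i x j y" if "(i, x) \<in> A" "(j, y) \<in> A" for i x j y
  proof
    assume "cls i x = cls j y"
    moreover have "(j, y) \<in> cls j y"
      using that E_refl by (auto simp: cls_def A_def)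
    ultimately show "E i x j y"
      by (auto simp: cls_def)
  next
    assume E: "E i x j y"
    show "cls i x = cls j y"
      unfolding cls_def using that E_trans[OF E] E_trans[OF E_sym[OF E]]
      by (auto simp: A_def)
  qed
  have small_A: "small TYPE('u) A"
    unfolding A_def using F by (intro small_Sigma small_I) simp
  obtain e :: "('i \<times> 'u) set \<Rightarrow> 'u" where e: "inj_on e ((\<lambda>(i, x). cls i x) ` A)"
    using small_embeds[OF small_image[OF small_A]] by blast
  define c where "c i x = e (cls i x)" for i x
  have c_eq: "c i x = c j y \<longleftrightarrow> E i x j y"
    if "i \<in> I" "x \<in> carrier (F i)" "j \<in> I" "y \<in> carrier (F j)" for i x j y
  proof -
    have A: "(i, x) \<in> A" "(j, y) \<in> A"
      using that by (auto simp: A_def)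
    have "c i x = c j y \<longleftrightarrow> cls i x = cls j y"
      unfolding c_def by (rule inj_on_eq_iff[OF e]) (use A in force)+
    then show ?thesis
      using cls_eq[OF A] by simp
  qed
  have c_t: "c j (t i j x) = c i x" if "(i, j) \<in> r" "x \<in> carrier (F i)" for i j x
  proof -
    have ij: "i \<in> I" "j \<in> I"
      using that r(1) by auto
    have "E j (t i j x) i x"
      unfolding E_def using that tt[OF that(1) r(2)[OF ij(2)] that(2)] r(2)[OF ij(2)] by blast
    then show ?thesis
      using c_eq ij that hom_closed[OF t[OF that(1)]] by blast
  qed
  define L :: "('r, 'u) module" where
    "L = \<lparr>carrier = (\<lambda>(i, x). c i x) ` A, mult = undefined, one = undefined,
      zero = (SOME z. \<exists>i\<in>I. z = c i \<zero>\<^bsub>F i\<^esub>),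
      add = (\<lambda>a b. SOME z. \<exists>i\<in>I. \<exists>x\<in>carrier (F i). \<exists>y\<in>carrier (F i).
        a = c i x \<and> b = c i y \<and> z = c i (x \<oplus>\<^bsub>F i\<^esub> y)),
      smult = (\<lambda>s a. SOME z. \<exists>i\<in>I. \<exists>x\<in>carrier (F i). a = c i x \<and> z = c i (s \<odot>\<^bsub>F i\<^esub> x))\<rparr>"
  have L_simps: "carrier L = (\<lambda>(i, x). c i x) ` A"
    "\<zero>\<^bsub>L\<^esub> = (SOME z. \<exists>i\<in>I. z = c i \<zero>\<^bsub>F i\<^esub>)"
    "a \<oplus>\<^bsub>L\<^esub> b = (SOME z. \<exists>i\<in>I. \<exists>x\<in>carrier (F i). \<exists>y\<in>carrier (F i).
        a = c i x \<and> b = c i y \<and> z = c i (x \<oplus>\<^bsub>F i\<^esub> y))"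
    "s \<odot>\<^bsub>L\<^esub> a = (SOME z. \<exists>i\<in>I. \<exists>x\<in>carrier (F i). a = c i x \<and> z = c i (s \<odot>\<^bsub>F i\<^esub> x))" for a b s
    by (simp_all add: L_def)
  have c_mem: "c i x \<in> carrier L" if "i \<in> I" "x \<in> carrier (F i)" for i x
    unfolding L_simps(1) A_def using that by (intro image_eqI[of _ _ "(i, x)"]) auto
  have c_zero: "c i \<zero>\<^bsub>F i\<^esub> = c j \<zero>\<^bsub>F j\<^esub>" if ij: "i \<in> I" "j \<in> I" for i j
  proof -
    obtain k where k: "(i, k) \<in> r" "(j, k) \<in> r"
      using upper ij by blast
    show ?thesis
      using c_t[OF k(1) module_zero[OF Fi[OF ij(1)]]] c_t[OF k(2) module_zero[OF Fi[OF ij(2)]]]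
        hom_zero[OF t[OF k(1)] Fr[OF k(1)]] hom_zero[OF t[OF k(2)] Fr[OF k(2)]] by simp
  qed
  have L_zero: "c i \<zero>\<^bsub>F i\<^esub> = \<zero>\<^bsub>L\<^esub>" if i: "i \<in> I" for i
    unfolding L_simps(2)
  proof (rule some_equality[symmetric])
    show "\<exists>j\<in>I. c i \<zero>\<^bsub>F i\<^esub> = c j \<zero>\<^bsub>F j\<^esub>"
      using i by blast
    show "z = c i \<zero>\<^bsub>F i\<^esub>" if "\<exists>j\<in>I. z = c j \<zero>\<^bsub>F j\<^esub>" for z
      using that c_zero[OF _ i] by blast
  qed
  have c_add: "c i (x \<oplus>\<^bsub>F i\<^esub> y) = c j (x' \<oplus>\<^bsub>F j\<^esub> y')"
    if i: "i \<in> I" "x \<in> carrier (F i)" "y \<in> carrier (F i)"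
      and j: "j \<in> I" "x' \<in> carrier (F j)" "y' \<in> carrier (F j)"
      and eq: "c i x = c j x'" "c i y = c j y'" for i j x y x' y'
  proof -
    obtain k where k: "(i, k) \<in> r" "(j, k) \<in> r" "t i k x = t j k x'"
      using eq(1) c_eq[OF i(1,2) j(1,2)] unfolding E_def by blast
    obtain k' where k': "(i, k') \<in> r" "(j, k') \<in> r" "t i k' y = t j k' y'"
      using eq(2) c_eq[OF i(1,3) j(1,3)] unfolding E_def by blast
    obtain m where m: "(k, m) \<in> r" "(k', m) \<in> r"
      using upper[of k k'] k(1) k'(1) r(1) by blast
    have im: "(i, m) \<in> r" and jm: "(j, m) \<in> r"
      using r(3) k m by blast+
    have "t i m x = t j m x'"
      by (rule later[OF k(3,1,2) m(1) i(2) j(2)])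
    moreover have "t i m y = t j m y'"
      by (rule later[OF k'(3,1,2) m(2) i(3) j(3)])
    ultimately have "t i m (x \<oplus>\<^bsub>F i\<^esub> y) = t j m (x' \<oplus>\<^bsub>F j\<^esub> y')"
      by (simp add: hom_add[OF t[OF im] i(2,3)] hom_add[OF t[OF jm] j(2,3)])
    then show ?thesis
      using c_t[OF im module_add[OF Fi[OF i(1)] i(2,3)]]
        c_t[OF jm module_add[OF Fi[OF j(1)] j(2,3)]] by simp
  qed
  have L_add: "c i (x \<oplus>\<^bsub>F i\<^esub> y) = c i x \<oplus>\<^bsub>L\<^esub> c i y"
    if i: "i \<in> I" "x \<in> carrier (F i)" "y \<in> carrier (F i)" for i x y
    unfolding L_simps(3)
  proof (rule some_equality[symmetric])
    show "\<exists>j\<in>I. \<exists>x'\<in>carrier (F j). \<exists>y'\<in>carrier (F j).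
        c i x = c j x' \<and> c i y = c j y' \<and> c i (x \<oplus>\<^bsub>F i\<^esub> y) = c j (x' \<oplus>\<^bsub>F j\<^esub> y')"
      by (intro bexI[of _ i] bexI[of _ x] bexI[of _ y] conjI refl i)
    show "z = c i (x \<oplus>\<^bsub>F i\<^esub> y)"
      if ex: "\<exists>j\<in>I. \<exists>x'\<in>carrier (F j). \<exists>y'\<in>carrier (F j).
        c i x = c j x' \<and> c i y = c j y' \<and> z = c j (x' \<oplus>\<^bsub>F j\<^esub> y')" for z
    proof -
      obtain j x' y' where j: "j \<in> I" "x' \<in> carrier (F j)" "y' \<in> carrier (F j)"
        and eq: "c i x = c j x'" "c i y = c j y'" and z: "z = c j (x' \<oplus>\<^bsub>F j\<^esub> y')"
        using ex by blast
      show ?thesis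
        unfolding z by (rule c_add[OF i j eq, symmetric])
    qed
  qed
  have c_smult: "c i (s \<odot>\<^bsub>F i\<^esub> x) = c j (s \<odot>\<^bsub>F j\<^esub> x')"
    if s: "s \<in> carrier R" and i: "i \<in> I" "x \<in> carrier (F i)"
      and j: "j \<in> I" "x' \<in> carrier (F j)" and eq: "c i x = c j x'" for i j x x' s
  proof -
    obtain k where k: "(i, k) \<in> r" "(j, k) \<in> r" "t i k x = t j k x'"
      using eq c_eq[OF i j] unfolding E_def by blast
    have "t i k (s \<odot>\<^bsub>F i\<^esub> x) = t j k (s \<odot>\<^bsub>F j\<^esub> x')"
      by (simp add: hom_smult[OF t[OF k(1)] s i(2)] hom_smult[OF t[OF k(2)] s j(2)] k(3))
    then show ?thesis
      using c_t[OF k(1) module_smult[OF Fi[OF i(1)] s i(2)]]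
        c_t[OF k(2) module_smult[OF Fi[OF j(1)] s j(2)]] by simp
  qed
  have L_smult: "c i (s \<odot>\<^bsub>F i\<^esub> x) = s \<odot>\<^bsub>L\<^esub> c i x"
    if s: "s \<in> carrier R" and i: "i \<in> I" "x \<in> carrier (F i)" for i s x
    unfolding L_simps(4)
  proof (rule some_equality[symmetric])
    show "\<exists>j\<in>I. \<exists>x'\<in>carrier (F j). c i x = c j x' \<and> c i (s \<odot>\<^bsub>F i\<^esub> x) = c j (s \<odot>\<^bsub>F j\<^esub> x')"
      by (intro bexI[of _ i] bexI[of _ x] conjI refl i)
    show "z = c i (s \<odot>\<^bsub>F i\<^esub> x)"
      if ex: "\<exists>j\<in>I. \<exists>x'\<in>carrier (F j). c i x = c j x' \<and> z = c j (s \<odot>\<^bsub>F j\<^esub> x')" for z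
    proof -
      obtain j x' where j: "j \<in> I" "x' \<in> carrier (F j)"
        and eq: "c i x = c j x'" and z: "z = c j (s \<odot>\<^bsub>F j\<^esub> x')"
        using ex by blast
      show ?thesis
        unfolding z by (rule c_smult[OF s i j eq, symmetric])
    qed
  qed
  have L: "left_module R L"
  proof (rule left_module_locally[OF ring, of I F c])
    show "I \<noteq> {}"
      using dir by (simp add: directed_poset_def)
    show "\<exists>i\<in>I. {x, y, z} \<subseteq> c i ` carrier (F i)"
      if mem: "x \<in> carrier L" "y \<in> carrier L" "z \<in> carrier L" for x y z
    proof -
      obtain i x' where x: "i \<in> I" "x' \<in> carrier (F i)" "x = c i x'"
        using mem(1) by (auto simp: L_simps(1) A_def)
      obtain j y' where y: "j \<in> I" "y' \<in> carrier (F j)" "y = c j y'"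
        using mem(2) by (auto simp: L_simps(1) A_def)
      obtain k z' where z: "k \<in> I" "z' \<in> carrier (F k)" "z = c k z'"
        using mem(3) by (auto simp: L_simps(1) A_def)
      obtain l where l: "(i, l) \<in> r" "(j, l) \<in> r"
        using upper x(1) y(1) by blast
      obtain m where m: "(l, m) \<in> r" "(k, m) \<in> r"
        using upper[of l k] l(1) z(1) r(1) by blast
      have im: "(i, m) \<in> r" and jm: "(j, m) \<in> r"
        using r(3) l m by blast+
      have "x = c m (t i m x')" "y = c m (t j m y')" "z = c m (t k m z')"
        using c_t[OF im x(2)] c_t[OF jm y(2)] c_t[OF m(2) z(2)] x y z by simp_all
      moreover have "t i m x' \<in> carrier (F m)" "t j m y' \<in> carrier (F m)" "t k m z' \<in> carrier (F m)"
        using hom_closed[OF t] im jm m(2) x y z by blast+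
      moreover have "m \<in> I"
        using m(2) r(1) by blast
      ultimately show ?thesis by blast
    qed
  qed (simp_all only: Fi c_mem L_zero L_add L_smult)
  have L_small: "small TYPE('u) (carrier L)"
    unfolding L_simps(1) by (rule small_image[OF small_A])
  define u where "u i = restrict (c i) (carrier (F i))" for i
  have "is_module_direct_limit I r F t L u"
    unfolding is_module_direct_limit_def
  proof (intro conjI allI ballI impI)
    show "L \<in> Obj (Mod R)"
      using L L_small by simp
    show "u i \<in> module_homs R (F i) L" if "i \<in> I" for i
      unfolding u_def by (rule homI[OF _ _ _ Fi[OF that]]) (simp_all only: that c_mem L_add L_smult)
    show "u j (t i j x) = u i x" if "(i, j) \<in> r" "x \<in> carrier (F i)" for i j x
      using c_t[OF that] that(2) hom_closed[OF t[OF that(1)] that(2)] by (simp add: u_def)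
    show "\<exists>i\<in>I. \<exists>x\<in>carrier (F i). y = u i x" if "y \<in> carrier L" for y
      using that by (force simp: L_simps(1) A_def u_def)
    show "\<exists>j. (i, j) \<in> r \<and> t i j x = t i j y"
      if "i \<in> I" "x \<in> carrier (F i)" "y \<in> carrier (F i)" "u i x = u i y" for i x y
      using c_eq[of i x i y] that by (auto simp: u_def E_def)
  qed
  then show ?thesis by blast
qed

text \<open>
  The induced map sends the image of \<open>x\<close> at stage \<open>i\<close> to \<open>v i x\<close>. This is well defined because two
  representatives of an element agree at a common later stage, where \<open>v\<close> is compatible.
\<close>

lemma module_direct_limit_lift:
  assumes L: "is_module_direct_limit I r F t L u" and dir: "directed_poset I r"
    and F: "\<And>i. i \<in> I \<Longrightarrow> left_module R (F i)"
    and t: "\<And>i j. (i, j) \<in> r \<Longrightarrow> t i j \<in> module_homs R (F i) (F j)"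
    and v: "\<And>i. i \<in> I \<Longrightarrow> v i \<in> module_homs R (F i) N"
    and vt: "\<And>i j x. (i, j) \<in> r \<Longrightarrow> x \<in> carrier (F i) \<Longrightarrow> v j (t i j x) = v i x"
  shows "\<exists>h\<in>module_homs R L N. \<forall>i\<in>I. \<forall>x\<in>carrier (F i). h (u i x) = v i x"
proof -
  have r: "r \<subseteq> I \<times> I"
    using dir unfolding directed_poset_def partial_order_on_def preorder_on_def by blast
  have u: "u i \<in> module_homs R (F i) L" if "i \<in> I" for i
    using L that unfolding is_module_direct_limit_def by blast
  have ut: "u j (t i j x) = u i x" if "(i, j) \<in> r" "x \<in> carrier (F i)" for i j x
    using L that unfolding is_module_direct_limit_def by blast
  have Lm: "left_module R L"
    using L unfolding is_module_direct_limit_def by simp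
  have surj: "\<exists>i\<in>I. \<exists>x\<in>carrier (F i). y = u i x" if "y \<in> carrier L" for y
    using L that unfolding is_module_direct_limit_def by blast
  have eq: "\<exists>j. (i, j) \<in> r \<and> t i j x = t i j y"
    if "i \<in> I" "x \<in> carrier (F i)" "y \<in> carrier (F i)" "u i x = u i y" for i x y
    using L that unfolding is_module_direct_limit_def by blast
  \<comment> \<open>Two elements have representatives at a common stage, and the value of \<open>v\<close> does not depend on
    the representative.\<close>
  have common: "\<exists>k\<in>I. \<exists>x\<in>carrier (F k). \<exists>y\<in>carrier (F k).
      a = u k x \<and> b = u k y \<and> (\<forall>i\<in>I. \<forall>x'\<in>carrier (F i). a = u i x' \<longrightarrow> v i x' = v k x)"
    if "a \<in> carrier L" "b \<in> carrier L" for a b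
  proof -
    obtain i x where x: "i \<in> I" "x \<in> carrier (F i)" "a = u i x"
      using surj[OF \<open>a \<in> carrier L\<close>] by blast
    obtain j y where y: "j \<in> I" "y \<in> carrier (F j)" "b = u j y"
      using surj[OF \<open>b \<in> carrier L\<close>] by blast
    obtain k where k: "(i, k) \<in> r" "(j, k) \<in> r" "k \<in> I"
      using dir x(1) y(1) unfolding directed_poset_def by blast
    note tx = hom_closed[OF t[OF k(1)] x(2)] and ty = hom_closed[OF t[OF k(2)] y(2)]
    have vk: "v i' x' = v k (t i k x)" if x': "i' \<in> I" "x' \<in> carrier (F i')" "a = u i' x'" for i' x'
    proof -
      obtain m where m: "(i', m) \<in> r" "(k, m) \<in> r" "m \<in> I"
        using dir x'(1) k(3) unfolding directed_poset_def by blast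
      note mem = hom_closed[OF t[OF m(1)] x'(2)] hom_closed[OF t[OF m(2)] tx]
      have "u m (t i' m x') = u m (t k m (t i k x))"
        using ut[OF m(1) x'(2)] ut[OF m(2) tx] ut[OF k(1) x(2)] x(3) x'(3) by simp
      then obtain l where l: "(m, l) \<in> r" "t m l (t i' m x') = t m l (t k m (t i k x))"
        using eq[OF m(3) mem] by blast
      have "v m (t i' m x') = v m (t k m (t i k x))"
        using vt[OF l(1) mem(1)] vt[OF l(1) mem(2)] l(2) by simp
      then show ?thesis
        using vt[OF m(1) x'(2)] vt[OF m(2) tx] by simp
    qed
    have "a = u k (t i k x)" "b = u k (t j k y)"
      using ut[OF k(1) x(2)] ut[OF k(2) y(2)] x y by simp_all
    then show ?thesis
      by (intro bexI[of _ k] bexI[of _ "t i k x"] bexI[of _ "t j k y"] conjI ballI impI vk k tx ty)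
  qed
  define h where "h a = (SOME b. \<exists>i\<in>I. \<exists>x\<in>carrier (F i). a = u i x \<and> b = v i x)" for a
  have h: "h (u i x) = v i x" if x: "i \<in> I" "x \<in> carrier (F i)" for i x
    unfolding h_def
  proof (rule some_equality)
    show "\<exists>j\<in>I. \<exists>y\<in>carrier (F j). u i x = u j y \<and> v i x = v j y"
      by (intro bexI[of _ i] bexI[of _ x]) (simp_all add: x)
    fix b assume "\<exists>j\<in>I. \<exists>y\<in>carrier (F j). u i x = u j y \<and> b = v j y"
    then obtain j y where y: "j \<in> I" "y \<in> carrier (F j)" "u i x = u j y" "b = v j y"
      by blast
    have "u i x \<in> carrier L"
      by (rule hom_closed[OF u[OF x(1)] x(2)])
    from common[OF this this] obtain a' where
      "\<forall>j\<in>I. \<forall>x'\<in>carrier (F j). u i x = u j x' \<longrightarrow> v j x' = a'"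
      by blast
    then show "b = v i x"
      using x y by simp
  qed
  have "restrict h (carrier L) \<in> module_homs R L N"
  proof (rule homI[OF _ _ _ Lm])
    fix a assume a: "a \<in> carrier L"
    then obtain i x where x: "i \<in> I" "x \<in> carrier (F i)" "a = u i x"
      using surj by blast
    show "h a \<in> carrier N"
      unfolding x(3) h[OF x(1,2)] by (rule hom_closed[OF v[OF x(1)] x(2)])
    show "h (s \<odot>\<^bsub>L\<^esub> a) = s \<odot>\<^bsub>N\<^esub> h a" if s: "s \<in> carrier R" for s
      using h[OF x(1) module_smult[OF F[OF x(1)] s x(2)]] h[OF x(1,2)]
      by (simp add: x(3) hom_smult[OF u[OF x(1)] s x(2)] hom_smult[OF v[OF x(1)] s x(2)])
  next
    fix a b assume "a \<in> carrier L" "b \<in> carrier L"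
    from common[OF this] obtain i x y where
      i: "i \<in> I" and xy: "x \<in> carrier (F i)" "y \<in> carrier (F i)" "a = u i x" "b = u i y"
      by blast
    show "h (a \<oplus>\<^bsub>L\<^esub> b) = h a \<oplus>\<^bsub>N\<^esub> h b"
      using h[OF i module_add[OF F[OF i] xy(1,2)]] h[OF i xy(1)] h[OF i xy(2)]
      by (simp add: xy(3,4) hom_add[OF u[OF i] xy(1,2)] hom_add[OF v[OF i] xy(1,2)])
  qed
  moreover have "restrict h (carrier L) (u i x) = v i x" if "i \<in> I" "x \<in> carrier (F i)" for i x
    using h[OF that] hom_closed[OF u[OF that(1)] that(2)] by simp
  ultimately show ?thesis by blast
qed

end

section \<open>Complexes\<close>

lemma Ch_simps [simp]:
  "K \<in> Obj (Ch R) \<longleftrightarrow> is_complex R K"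
  "Hom (Ch R) = chain_maps R"
  "Comp (Ch R) K g f n = compose (carrier (Term K n)) (g n) (f n)"
  "Ident (Ch R) K n = restrict id (carrier (Term K n))"
  by (simp_all add: Ch_def)

lemma
  assumes "is_complex R (K :: ('r, 'u) chain_complex)"
  shows complex_module: "left_module R (Term K n)"
    and complex_small: "small TYPE('u) (carrier (Term K n))"
    and complex_diff: "Diff K n \<in> module_homs R (Term K n) (Term K (n - 1))"
    and complex_diff_diff:
      "x \<in> carrier (Term K n) \<Longrightarrow> Diff K (n - 1) (Diff K n x) = \<zero>\<^bsub>Term K (n - 2)\<^esub>"
  using assms unfolding is_complex_def by simp_all

lemma complexes_of_iff:
  "Y \<in> complexes_of R \<X> \<longleftrightarrow> is_complex R Y \<and> (\<forall>n. Term Y n \<in> \<X>)"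
  by (simp add: complexes_of_def)

lemma chain_map_hom: "f \<in> chain_maps R K L \<Longrightarrow> f n \<in> module_homs R (Term K n) (Term L n)"
  unfolding chain_maps_def by blast

lemma chain_map_comm: "f \<in> chain_maps R K L \<Longrightarrow> x \<in> carrier (Term K n) \<Longrightarrow>
    f (n - 1) (Diff K n x) = Diff L n (f n x)"
  unfolding chain_maps_def by blast

lemma chain_map_closed:
  "f \<in> chain_maps R K L \<Longrightarrow> x \<in> carrier (Term K n) \<Longrightarrow> f n x \<in> carrier (Term L n)"
  by (rule hom_closed[OF chain_map_hom])

lemma chain_mapI:
  assumes "\<And>n. f n \<in> module_homs R (Term K n) (Term L n)"
    and "\<And>n x. x \<in> carrier (Term K n) \<Longrightarrow> f (n - 1) (Diff K n x) = Diff L n (f n x)"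
  shows "f \<in> chain_maps R K L"
  using assms unfolding chain_maps_def by blast

lemma chain_map_eqI:
  assumes "f \<in> chain_maps R K L" and "g \<in> chain_maps R K L'"
    and "\<And>n x. x \<in> carrier (Term K n) \<Longrightarrow> f n x = g n x"
  shows "f = g"
  by (rule ext) (rule hom_eqI[OF chain_map_hom[OF assms(1)] chain_map_hom[OF assms(2)] assms(3)])

lemma Ch_Comp_apply:
  "x \<in> carrier (Term K n) \<Longrightarrow> Comp (Ch R) K g f n x = g n (f n x)"
  by (simp add: compose_eq)

lemma Ch_Comp:
  assumes f: "f \<in> chain_maps R K L" and g: "g \<in> chain_maps R L M" and K: "is_complex R K"
  shows "Comp (Ch R) K g f \<in> chain_maps R K M"
proof (rule chain_mapI)
  show "Comp (Ch R) K g f n \<in> module_homs R (Term K n) (Term M n)" for n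
    using hom_compose[OF chain_map_hom[OF f] chain_map_hom[OF g] complex_module[OF K]] by simp
  show "Comp (Ch R) K g f (n - 1) (Diff K n x) = Diff M n (Comp (Ch R) K g f n x)"
    if x: "x \<in> carrier (Term K n)" for n x
    using hom_closed[OF complex_diff[OF K] x] chain_map_comm[OF f x]
      chain_map_comm[OF g chain_map_closed[OF f x]] x
    by (simp add: Ch_Comp_apply del: Ch_simps)
qed

lemma Ch_Ident: "is_complex R K \<Longrightarrow> Ident (Ch R) K \<in> chain_maps R K K"
  by (rule chain_mapI) (auto simp: hom_id complex_module hom_closed[OF complex_diff])

lemma Ch_Comp_assoc:
  assumes "f \<in> chain_maps R K L"
  shows "Comp (Ch R) K h (Comp (Ch R) K g f) = Comp (Ch R) K (Comp (Ch R) L h g) f"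
  by (intro ext) (auto simp: compose_def restrict_def chain_map_closed[OF assms])

lemma Ch_Ident_left:
  assumes f: "f \<in> chain_maps R K L" and K: "is_complex R K" and L: "is_complex R L"
  shows "Comp (Ch R) K (Ident (Ch R) L) f = f"
  by (rule chain_map_eqI[OF Ch_Comp[OF f Ch_Ident[OF L] K] f])
    (simp add: compose_eq chain_map_closed[OF f])

lemma Ch_Ident_right:
  assumes f: "f \<in> chain_maps R K L" and K: "is_complex R K"
  shows "Comp (Ch R) K f (Ident (Ch R) K) = f"
  by (rule chain_map_eqI[OF Ch_Comp[OF Ch_Ident[OF K] f K] f]) (simp add: compose_eq)

definition zero_differential :: "(int \<Rightarrow> ('r, 'u) module) \<Rightarrow> ('r, 'u) chain_complex" where
  "zero_differential P =
     \<lparr>Term = P, Diff = (\<lambda>n. restrict (\<lambda>_. \<zero>\<^bsub>P (n - 1)\<^esub>) (carrier (P n)))\<rparr>"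

lemma zero_differential_simps [simp]:
  "Term (zero_differential P) = P"
  "x \<in> carrier (P n) \<Longrightarrow> Diff (zero_differential P) n x = \<zero>\<^bsub>P (n - 1)\<^esub>"
  by (simp_all add: zero_differential_def)

context modules_in_universe
begin

lemma zero_differential_complex:
  assumes "\<And>n. P n \<in> Obj (Mod R)"
  shows "is_complex R (zero_differential P)"
proof -
  have P: "left_module R (P n)" for n
    using assms by simp
  show ?thesis
    unfolding is_complex_def
    using assms zero_hom[OF P P] by (auto simp: zero_differential_def module_zero[OF P])
qed

lemma zero_differential_chain_map:
  assumes f: "\<And>n. f n \<in> module_homs R (P n) (P' n)"
    and P: "\<And>n. left_module R (P n)" and P': "\<And>n. left_module R (P' n)"
  shows "f \<in> chain_maps R (zero_differential P) (zero_differential P')"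
  by (rule chain_mapI) (simp_all add: f hom_zero[OF f P P'] hom_closed[OF f])

text \<open>
  The composite of \<open>d\<close> successive maps of the tower, from stage \<open>i + d\<close> down to stage \<open>i\<close>; these are
  the transition maps of the tower as an inverse system over \<open>\<nat>\<close>.
\<close>

primrec composite_down ::
  "(nat \<Rightarrow> ('r, 'u) module) \<Rightarrow> (nat \<Rightarrow> 'u \<Rightarrow> 'u) \<Rightarrow> nat \<Rightarrow> nat \<Rightarrow> 'u \<Rightarrow> 'u"
where
  "composite_down P q i 0 = restrict id (carrier (P i))"
| "composite_down P q i (Suc d) =
     compose (carrier (P (i + Suc d))) (composite_down P q i d) (q (i + d))"

lemma composite_down_hom:
  assumes P: "\<And>k. left_module R (P k)" and q: "\<And>k. q k \<in> module_homs R (P (Suc k)) (P k)"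
  shows "composite_down P q i d \<in> module_homs R (P (i + d)) (P i)"
proof (induction d)
  case 0
  then show ?case
    using hom_id[OF P, of i] by (simp only: composite_down.simps add_0_right)
next
  case (Suc d)
  then show ?case
    using hom_compose[OF q Suc.IH P] by simp
qed

lemma composite_down_add:
  assumes q: "\<And>k. q k \<in> module_homs R (P (Suc k)) (P k)"
    and x: "x \<in> carrier (P (i + d + d'))"
  shows "composite_down P q i d (composite_down P q (i + d) d' x) = composite_down P q i (d + d') x"
  using x
proof (induction d' arbitrary: x)
  case (Suc d')
  have "q (i + d + d') x \<in> carrier (P (i + d + d'))"
    by (rule hom_closed[OF q]) (use Suc.prems in simp)
  from Suc.IH[OF this] show ?case
    using Suc.prems by (simp add: compose_eq add.assoc)
qed simp

lemma composite_down_compatible: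
  assumes s: "\<And>k. s k \<in> carrier (P k)" and qs: "\<And>k. q k (s (Suc k)) = s k"
  shows "composite_down P q i d (s (i + d)) = s i"
proof (induction d)
  case (Suc d)
  then show ?case
    using s[of "Suc (i + d)"] by (simp add: compose_eq qs)
qed (simp add: s)

lemma directed_poset_nat:
  assumes e: "inj (e :: nat \<Rightarrow> 'a)"
  shows "directed_poset (range e) {(e i, e j) | i j. i \<le> j}"
proof -
  let ?r = "{(e i, e j) | i j. i \<le> j}"
  have "\<exists>k\<in>range e. (a, k) \<in> ?r \<and> (b, k) \<in> ?r" if a: "a \<in> range e" and b: "b \<in> range e" for a b
  proof -
    obtain i j where "a = e i" "b = e j"
      using a b by blast
    moreover have "(e i, e (max i j)) \<in> ?r" "(e j, e (max i j)) \<in> ?r"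
      by (blast intro: max.cobounded1 max.cobounded2)+
    ultimately show ?thesis by blast
  qed
  moreover have "partial_order_on (range e) ?r"
    unfolding partial_order_on_def preorder_on_def refl_on_def trans_def antisym_def
    by (auto simp: inj_eq[OF e])
  ultimately show ?thesis
    unfolding directed_poset_def by simp
qed

text \<open>
  The hypothesis speaks of limits of complexes, but a family of modules becomes a complex with zero
  differential, and then each term of the limit is the limit of the terms. The limit of these
  complexes must be tested against cones from arbitrary complexes \<open>N\<close>; the induced map respects the
  differential of \<open>N\<close> because its components do, and they determine it.
\<close>

lemma sequence_limits_in_class:
  fixes P :: "nat \<Rightarrow> int \<Rightarrow> ('r, 'u) module" and L :: "int \<Rightarrow> ('r, 'u) module"
  assumes closed: "closed_under_inverse_limits TYPE('u) (Ch R) (complexes_of R \<X>)"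
    and \<X>: "\<X> \<subseteq> Obj (Mod R)"
    and P: "\<And>k n. P k n \<in> \<X>"
    and q: "\<And>k n. q k n \<in> module_homs R (P (Suc k) n) (P k n)"
    and L: "\<And>n. is_sequence_limit (\<lambda>k. P k n) (\<lambda>k. q k n) (L n) (\<pi> n)"
  shows "L n \<in> \<X>"
proof -
  have P_Obj: "P k n \<in> Obj (Mod R)" for k n
    using P \<X> by blast
  have Pm: "left_module R (P k n)" for k n
    using P_Obj by simp
  have L_Obj: "L n \<in> Obj (Mod R)" and Lm: "left_module R (L n)" for n
    using L[of n] by (simp_all add: is_sequence_limit_def)
  note \<pi> = sequence_limit_hom[OF L]
  \<comment> \<open>Index sets are subsets of the universe, so the tower is indexed by a copy of \<open>\<nat>\<close> in it.\<close>
  obtain e :: "nat \<Rightarrow> 'u" where e: "inj e"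
    using small_embeds[OF small_nat] by blast
  define m where "m = inv_into UNIV e"
  have m [simp]: "m (e k) = k" for k
    using e by (simp add: m_def)
  define r where "r = {(e i, e j) | i j. i \<le> j}"
  define F where "F a = zero_differential (P (m a))" for a
  define t where "t a b n = composite_down (\<lambda>k. P k n) (\<lambda>k. q k n) (m a) (m b - m a)" for a b n
  have rE: "\<exists>i d. a = e i \<and> b = e (i + d)" if "(a, b) \<in> r" for a b
    using that unfolding r_def le_iff_add by blast
  have t_hom: "t (e i) (e (i + d)) n \<in> module_homs R (P (i + d) n) (P i n)" for i d n
    using composite_down_hom[of "\<lambda>k. P k n" "\<lambda>k. q k n", OF Pm q] by (simp add: t_def)
  have F_complex: "is_complex R (F a)" for a
    unfolding F_def by (rule zero_differential_complex[OF P_Obj])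
  have "small TYPE('u) (range e)"
    by (rule small_image[OF small_nat])
  moreover have "directed_poset (range e) r"
    unfolding r_def by (rule directed_poset_nat[OF e])
  moreover have "inverse_system (Ch R) (range e) r F t"
    unfolding inverse_system_def
  proof (intro conjI ballI allI impI)
    show "F a \<in> Obj (Ch R)" for a
      using F_complex by simp
    show "t a a = Ident (Ch R) (F a)" for a
      by (rule ext) (simp add: t_def F_def)
    show "t a b \<in> Hom (Ch R) (F b) (F a)" if ab: "(a, b) \<in> r" for a b
    proof -
      obtain i d where "a = e i" "b = e (i + d)"
        using rE[OF ab] by blast
      then show ?thesis
        unfolding F_def Ch_simps using zero_differential_chain_map[OF t_hom Pm Pm] by simp
    qed
    show "Comp (Ch R) (F c) (t a b) (t b c) = t a c" if abc: "(a, b) \<in> r \<and> (b, c) \<in> r" for a b c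
    proof -
      obtain i d where ab: "a = e i" "b = e (i + d)"
        using rE abc by blast
      obtain j d' where bc: "b = e j" "c = e (j + d')"
        using rE abc by blast
      have c: "c = e (i + d + d')"
        using ab(2) bc injD[OF e, of "i + d" j] by simp
      show ?thesis
      proof (rule ext)
        fix n
        have "Comp (Ch R) (F c) (t a b) (t b c) n \<in> module_homs R (P (i + d + d') n) (P i n)"
          unfolding Ch_simps using hom_compose[OF t_hom t_hom Pm] by (simp add: F_def ab c)
        moreover have "t a c n \<in> module_homs R (P (i + d + d') n) (P i n)"
          using t_hom[of i "d + d'" n] by (simp add: ab c add.assoc)
        ultimately show "Comp (Ch R) (F c) (t a b) (t b c) n = t a c n"
        proof (rule hom_eqI)
          fix x assume "x \<in> carrier (P (i + d + d') n)"
          then show "Comp (Ch R) (F c) (t a b) (t b c) n x = t a c n x"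
            using composite_down_add[of "\<lambda>k. q k n" "\<lambda>k. P k n" x i d d', OF q]
            by (simp add: F_def ab(1) c compose_eq t_def ab(2))
        qed
      qed
    qed
  qed
  moreover have "\<forall>a\<in>range e. F a \<in> complexes_of R \<X>"
    using F_complex P by (auto simp: complexes_of_iff F_def)
  moreover have "is_inverse_limit (Ch R) (range e) r F t (zero_differential L) (\<lambda>a n. \<pi> n (m a))"
    unfolding is_inverse_limit_def
  proof (intro conjI allI impI)
    have \<pi>_map: "(\<lambda>n. \<pi> n k) \<in> chain_maps R (zero_differential L) (zero_differential (P k))" for k
      by (rule zero_differential_chain_map[OF \<pi> Lm Pm])
    show "compatible_cone (Ch R) (range e) r F t (zero_differential L) (\<lambda>a n. \<pi> n (m a))"
      unfolding compatible_cone_def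
    proof (intro conjI ballI allI impI)
      show "zero_differential L \<in> Obj (Ch R)"
        using zero_differential_complex[OF L_Obj] by simp
      show "(\<lambda>n. \<pi> n (m a)) \<in> Hom (Ch R) (zero_differential L) (F a)" for a
        using \<pi>_map by (simp add: F_def)
      show "Comp (Ch R) (zero_differential L) (t a b) (\<lambda>n. \<pi> n (m b)) = (\<lambda>n. \<pi> n (m a))"
        if ab: "(a, b) \<in> r" for a b
      proof (rule ext)
        fix n
        obtain i d where id: "a = e i" "b = e (i + d)"
          using rE[OF ab] by blast
        have "compose (carrier (L n)) (t a b n) (\<pi> n (m b)) = \<pi> n (m a)"
        proof (rule hom_eqI[OF hom_compose[OF _ _ Lm]])
          show "\<pi> n (m b) \<in> module_homs R (L n) (P (i + d) n)"
            using \<pi> by (simp add: id)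
          show "t a b n \<in> module_homs R (P (i + d) n) (P i n)"
            unfolding id by (rule t_hom)
          show "\<pi> n (m a) \<in> module_homs R (L n) (P (m a) n)"
            by (rule \<pi>)
          fix x assume x: "x \<in> carrier (L n)"
          have "composite_down (\<lambda>k. P k n) (\<lambda>k. q k n) i d (\<pi> n (i + d) x) = \<pi> n i x"
            by (rule composite_down_compatible[where s = "\<lambda>k. \<pi> n k x"])
              (simp_all add: hom_closed[OF \<pi> x] sequence_limit_compat[OF L x])
          then show "compose (carrier (L n)) (t a b n) (\<pi> n (m b)) x = \<pi> n (m a) x"
            using x by (simp add: compose_eq id t_def)
        qed
        then show "Comp (Ch R) (zero_differential L) (t a b) (\<lambda>n. \<pi> n (m b)) n = \<pi> n (m a)"
          by simp
      qed
    qed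
    fix N v assume cone: "compatible_cone (Ch R) (range e) r F t N v"
    then have N: "is_complex R N"
      by (simp add: compatible_cone_def)
    have v: "v (e k) \<in> chain_maps R N (zero_differential (P k))" for k
      using cone by (simp add: compatible_cone_def F_def)
    have v_hom: "v (e k) n \<in> module_homs R (Term N n) (P k n)" for k n
      using chain_map_hom[OF v] by simp
    have qv: "q k n (v (e (Suc k)) n x) = v (e k) n x" if x: "x \<in> carrier (Term N n)" for k n x
    proof -
      have "(e k, e (Suc k)) \<in> r"
        unfolding r_def by (blast intro: le_SucI)
      then have "Comp (Ch R) N (t (e k) (e (Suc k))) (v (e (Suc k))) = v (e k)"
        using cone by (simp add: compatible_cone_def)
      then have "Comp (Ch R) N (t (e k) (e (Suc k))) (v (e (Suc k))) n x = v (e k) n x"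
        by simp
      then show ?thesis
        using x hom_closed[OF v_hom x, of "Suc k"] hom_closed[OF q, of "v (e (Suc k)) n x" k n]
        by (simp add: compose_eq t_def)
    qed
    have "\<forall>n. \<exists>h\<in>module_homs R (Term N n) (L n).
        \<forall>k. \<forall>x\<in>carrier (Term N n). \<pi> n k (h x) = v (e k) n x"
      using sequence_limit_lift[OF L complex_module[OF N] v_hom qv] by blast
    then obtain h where h: "\<And>n. h n \<in> module_homs R (Term N n) (L n)"
      "\<And>n k x. x \<in> carrier (Term N n) \<Longrightarrow> \<pi> n k (h n x) = v (e k) n x"
      by metis
    have h_map: "h \<in> chain_maps R N (zero_differential L)"
    proof (rule chain_mapI)
      fix n x assume x: "x \<in> carrier (Term N n)"
      note dx = hom_closed[OF complex_diff[OF N] x]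
      have "h (n - 1) (Diff N n x) = \<zero>\<^bsub>L (n - 1)\<^esub>"
      proof (rule sequence_limit_eqI[OF L hom_closed[OF h(1) dx] module_zero[OF Lm]])
        show "\<pi> (n - 1) k (h (n - 1) (Diff N n x)) = \<pi> (n - 1) k \<zero>\<^bsub>L (n - 1)\<^esub>" for k
          using chain_map_comm[OF v x, of k]
          by (simp add: h(2)[OF dx] hom_closed[OF v_hom x] hom_zero[OF \<pi> Lm Pm])
      qed
      then show "h (n - 1) (Diff N n x) = Diff (zero_differential L) n (h n x)"
        by (simp add: hom_closed[OF h(1) x])
    qed (simp add: h)
    show "\<exists>!h. h \<in> Hom (Ch R) N (zero_differential L) \<and>
        (\<forall>a\<in>range e. Comp (Ch R) N (\<lambda>n. \<pi> n (m a)) h = v a)"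
    proof (rule ex1I[of _ h])
      have "Comp (Ch R) N (\<lambda>n. \<pi> n k) h = v (e k)" for k
        by (rule chain_map_eqI[OF Ch_Comp[OF h_map \<pi>_map N] v]) (simp add: compose_eq h)
      then show "h \<in> Hom (Ch R) N (zero_differential L) \<and>
          (\<forall>a\<in>range e. Comp (Ch R) N (\<lambda>n. \<pi> n (m a)) h = v a)"
        using h_map by simp
      fix h' assume h': "h' \<in> Hom (Ch R) N (zero_differential L) \<and>
          (\<forall>a\<in>range e. Comp (Ch R) N (\<lambda>n. \<pi> n (m a)) h' = v a)"
      then have h'_map: "h' \<in> chain_maps R N (zero_differential L)"
        by simp
      show "h' = h"
      proof (rule chain_map_eqI[OF h'_map h_map])
        fix n x assume x: "x \<in> carrier (Term N n)"
        have "\<pi> n k (h' n x) = v (e k) n x" for k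
        proof -
          have "Comp (Ch R) N (\<lambda>n. \<pi> n (m (e k))) h' = v (e k)"
            using h' by blast
          then have "Comp (Ch R) N (\<lambda>n. \<pi> n (m (e k))) h' n x = v (e k) n x"
            by simp
          then show ?thesis
            using x by (simp add: compose_eq)
        qed
        moreover have "h' n x \<in> carrier (L n)"
          using chain_map_closed[OF h'_map x] by simp
        ultimately show "h' n x = h n x"
          by (intro sequence_limit_eqI[OF L _ hom_closed[OF h(1) x]]) (simp_all add: h(2)[OF x])
      qed
    qed
  qed
  ultimately have "zero_differential L \<in> complexes_of R \<X>"
    using closed unfolding closed_under_inverse_limits_def by blast
  then show ?thesis
    by (simp add: complexes_of_iff)
qed

end

section \<open>Precovers of complexes\<close>

context modules_in_universe
begin

text \<open>
  The complex \<open>Q'\<close> is the pullback of \<open>Q\<close> and \<open>G P\<close> over \<open>G Q\<close>, where \<open>G\<close> is the right adjoint of the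
  functor forgetting the differential of a complex, \<open>(G P)\<^sub>n = P\<^sub>n \<times> P\<^sub>n\<^sub>-\<^sub>1\<close>. As \<open>G\<close> is a right adjoint,
  \<open>G P \<rightarrow> G Q\<close> inherits the lifting property of the termwise precovers, and the pullback inherits it
  from \<open>G P \<rightarrow> G Q\<close>.
\<close>

lemma precover_step:
  fixes Q :: "('r, 'u) chain_complex"
  assumes Q: "is_complex R Q" and \<X>: "\<X> \<subseteq> Obj (Mod R)"
    and \<phi>: "\<And>n. is_precover (Mod R) \<X> (Term Q n) (P n) (\<phi> n)"
  shows "\<exists>Q' p a. is_complex R Q' \<and> p \<in> chain_maps R Q' Q \<and>
    (\<forall>n. a n \<in> module_homs R (Term Q' n) (P n)) \<and>
    (\<forall>n. \<forall>x\<in>carrier (Term Q' n). \<phi> n (a n x) = p n x) \<and>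
    (\<forall>Y\<in>complexes_of R \<X>. \<forall>f\<in>chain_maps R Y Q. \<exists>f'\<in>chain_maps R Y Q'. Comp (Ch R) Y p f' = f)"
proof -
  note Qm = complex_module[OF Q] and dQ = complex_diff[OF Q]
  have P: "P n \<in> \<X>" and \<phi>_hom: "\<phi> n \<in> module_homs R (P n) (Term Q n)" for n
    using \<phi>[of n] by (simp_all add: is_precover_def)
  have P_Obj: "P n \<in> Obj (Mod R)" for n
    using P \<X> by blast
  then have Pm: "left_module R (P n)" for n
    by simp
  \<comment> \<open>The factors of the product are indexed by the booleans, with \<open>True\<close> for the factor \<open>P n\<close>; \<open>S n\<close> is
    the pullback in degree \<open>n\<close>.\<close>
  define M where "M n b = (if b then P n else P (n - 1))" for n and b :: bool
  have M_simps [simp]: "M n True = P n" "M n False = P (n - 1)" for n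
    by (simp_all add: M_def)
  have Mm: "left_module R (M n b)" for n b
    by (cases b) (simp_all add: Pm)
  define S where "S n = {s. (\<forall>b. s b \<in> carrier (M n b)) \<and>
    Diff Q n (\<phi> n (s True)) = \<phi> (n - 1) (s False)}" for n
  have "\<exists>T \<pi>. T \<in> Obj (Mod R) \<and> (\<forall>b. \<pi> b \<in> module_homs R T (M n b)) \<and>
      bij_betw (\<lambda>x b. \<pi> b x) (carrier T) (S n)" for n
  proof -
    obtain T \<pi> where "T \<in> Obj (Mod R)" "\<And>b. \<pi> b \<in> module_homs R T (M n b)"
      "bij_betw (\<lambda>x b. \<pi> b x) (carrier T) (S n)"
    proof (rule submodule_of_countable_product[of "M n" "S n"])
      show "M n b \<in> Obj (Mod R)" for b
        using P_Obj by (cases b) simp_all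
      have S_mem: "s b \<in> carrier (M n b)" if "s \<in> S n" for s b
        using that unfolding S_def by blast
      have S: "s True \<in> carrier (P n)" "s False \<in> carrier (P (n - 1))"
        "Diff Q n (\<phi> n (s True)) = \<phi> (n - 1) (s False)" if s: "s \<in> S n" for s
        using S_mem[OF s, of True] S_mem[OF s, of False] s by (simp_all add: S_def)
      show "s b \<in> carrier (M n b)" if "s \<in> S n" for s b
        by (rule S_mem[OF that])
      show "(\<lambda>b. \<zero>\<^bsub>M n b\<^esub>) \<in> S n"
        unfolding S_def
        by (simp add: module_zero[OF Mm] hom_zero[OF \<phi>_hom Pm Qm] hom_zero[OF dQ Qm Qm])
      show "(\<lambda>b. s b \<oplus>\<^bsub>M n b\<^esub> s' b) \<in> S n" if s: "s \<in> S n" and s': "s' \<in> S n" for s s'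
        unfolding S_def using S[OF s] S[OF s'] S_mem[OF s] S_mem[OF s']
        by (simp add: module_add[OF Mm] hom_add[OF \<phi>_hom] hom_add[OF dQ] hom_closed[OF \<phi>_hom])
      show "(\<lambda>b. c \<odot>\<^bsub>M n b\<^esub> s b) \<in> S n" if c: "c \<in> carrier R" and s: "s \<in> S n" for c s
        unfolding S_def using S[OF s] S_mem[OF s] c
        by (simp add: module_smult[OF Mm] hom_smult[OF \<phi>_hom] hom_smult[OF dQ] hom_closed[OF \<phi>_hom])
    qed blast
    then show ?thesis by blast
  qed
  then obtain T \<pi> where T: "\<And>n. T n \<in> Obj (Mod R)"
    and \<pi>: "\<And>n b. \<pi> n b \<in> module_homs R (T n) (M n b)"
    and bij: "\<And>n. bij_betw (\<lambda>x b. \<pi> n b x) (carrier (T n)) (S n)"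
    by metis
  have Tm: "left_module R (T n)" for n
    using T by simp
  have \<pi>P: "\<pi> n True \<in> module_homs R (T n) (P n)" "\<pi> n False \<in> module_homs R (T n) (P (n - 1))" for n
    using \<pi>[of n True] \<pi>[of n False] by simp_all
  have T_eq: "Diff Q n (\<phi> n (\<pi> n True x)) = \<phi> (n - 1) (\<pi> n False x)"
    if x: "x \<in> carrier (T n)" for n x
  proof -
    have "(\<lambda>b. \<pi> n b x) \<in> S n"
      by (rule bij_betw_apply[OF bij x])
    then show ?thesis
      unfolding S_def by simp
  qed
  have T_eqI: "x = y" if xy: "x \<in> carrier (T n)" "y \<in> carrier (T n)"
    and eq: "\<pi> n True x = \<pi> n True y" "\<pi> n False x = \<pi> n False y" for n x y
  proof (rule inj_onD[OF bij_betw_imp_inj_on[OF bij] _ xy])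
    show "(\<lambda>b. \<pi> n b x) = (\<lambda>b. \<pi> n b y)"
      using eq by (auto simp: fun_eq_iff all_bool_eq)
  qed
  \<comment> \<open>The homomorphisms into \<open>T n\<close> are the pairs of homomorphisms that satisfy the equation
    defining the pullback.\<close>
  have lift: "\<exists>h\<in>module_homs R N (T n). \<forall>x\<in>carrier N. \<pi> n True (h x) = f x \<and> \<pi> n False (h x) = g x"
    if N: "left_module R N" and f: "f \<in> module_homs R N (P n)" and g: "g \<in> module_homs R N (P (n - 1))"
      and fg: "\<And>x. x \<in> carrier N \<Longrightarrow> Diff Q n (\<phi> n (f x)) = \<phi> (n - 1) (g x)" for N n f g
  proof -
    have "\<exists>h\<in>module_homs R N (T n). \<forall>b. \<forall>x\<in>carrier N. \<pi> n b (h x) = (if b then f else g) x"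
    proof (rule lift_into_product[OF Tm N \<pi> bij])
      show "(if b then f else g) \<in> module_homs R N (M n b)" for b
        using f g by (cases b) simp_all
      show "(\<lambda>b. (if b then f else g) x) \<in> S n" if x: "x \<in> carrier N" for x
        unfolding S_def using hom_closed[OF f x] hom_closed[OF g x] fg[OF x]
        by (simp add: all_bool_eq)
    qed
    then show ?thesis by (auto simp: all_bool_eq)
  qed
  \<comment> \<open>The differential \<open>(x, y) \<mapsto> (y, 0)\<close> of the pullback.\<close>
  have "\<exists>d\<in>module_homs R (T n) (T (n - 1)). \<forall>x\<in>carrier (T n).
      \<pi> (n - 1) True (d x) = \<pi> n False x \<and>
      \<pi> (n - 1) False (d x) = restrict (\<lambda>_. \<zero>\<^bsub>P (n - 1 - 1)\<^esub>) (carrier (T n)) x" for n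
  proof (rule lift[OF Tm \<pi>P(2) zero_hom[OF Tm Pm]])
    fix x assume x: "x \<in> carrier (T n)"
    have "Diff Q (n - 1) (\<phi> (n - 1) (\<pi> n False x)) = \<zero>\<^bsub>Term Q (n - 2)\<^esub>"
      unfolding T_eq[OF x, symmetric]
      by (rule complex_diff_diff[OF Q hom_closed[OF \<phi>_hom hom_closed[OF \<pi>P(1) x]]])
    then show "Diff Q (n - 1) (\<phi> (n - 1) (\<pi> n False x)) =
        \<phi> (n - 1 - 1) (restrict (\<lambda>_. \<zero>\<^bsub>P (n - 1 - 1)\<^esub>) (carrier (T n)) x)"
      using x hom_zero[OF \<phi>_hom Pm Qm, of "n - 2"] by simp
  qed
  then obtain d where d: "\<And>n. d n \<in> module_homs R (T n) (T (n - 1))"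
    and \<pi>d: "\<And>n x. x \<in> carrier (T n) \<Longrightarrow> \<pi> (n - 1) True (d n x) = \<pi> n False x"
    "\<And>n x. x \<in> carrier (T n) \<Longrightarrow> \<pi> (n - 1) False (d n x) = \<zero>\<^bsub>P (n - 2)\<^esub>"
    by (simp add: diff_diff_eq) metis
  define Q' where "Q' = \<lparr>Term = T, Diff = d\<rparr>"
  have Q'_simps [simp]: "Term Q' = T" "Diff Q' = d"
    by (simp_all add: Q'_def)
  have Q': "is_complex R Q'"
    unfolding is_complex_def
  proof (intro conjI allI ballI)
    fix n x assume "x \<in> carrier (Term Q' n)"
    then have x: "x \<in> carrier (T n)" by simp
    note dx = hom_closed[OF d x]
    show "Diff Q' (n - 1) (Diff Q' n x) = \<zero>\<^bsub>Term Q' (n - 2)\<^esub>"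
    proof (simp, rule T_eqI)
      show "d (n - 1) (d n x) \<in> carrier (T (n - 2))"
        using hom_closed[OF d dx] by simp
      show "\<pi> (n - 2) True (d (n - 1) (d n x)) = \<pi> (n - 2) True \<zero>\<^bsub>T (n - 2)\<^esub>"
        using \<pi>d(1)[OF dx] \<pi>d(2)[OF x] hom_zero[OF \<pi>P(1) Tm Pm, of "n - 2"] by simp
      show "\<pi> (n - 2) False (d (n - 1) (d n x)) = \<pi> (n - 2) False \<zero>\<^bsub>T (n - 2)\<^esub>"
        using \<pi>d(2)[OF dx] hom_zero[OF \<pi>P(2) Tm Pm, of "n - 2"] by simp
    qed (rule module_zero[OF Tm])
  qed (use T d in simp_all)
  define p where "p n = compose (carrier (T n)) (\<phi> n) (\<pi> n True)" for n
  have p_apply: "p n x = \<phi> n (\<pi> n True x)" if "x \<in> carrier (T n)" for n x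
    using that by (simp add: p_def compose_eq)
  have p: "p \<in> chain_maps R Q' Q"
  proof (rule chain_mapI)
    show "p n \<in> module_homs R (Term Q' n) (Term Q n)" for n
      unfolding p_def using hom_compose[OF \<pi>P(1) \<phi>_hom Tm] by simp
    show "p (n - 1) (Diff Q' n x) = Diff Q n (p n x)" if "x \<in> carrier (Term Q' n)" for n x
      using that hom_closed[OF d] by (simp add: p_apply \<pi>d T_eq)
  qed
  have "\<exists>f'\<in>chain_maps R Y Q'. Comp (Ch R) Y p f' = f"
    if "Y \<in> complexes_of R \<X>" and f: "f \<in> chain_maps R Y Q" for Y f
  proof -
    have Y: "is_complex R Y" and YX: "\<And>n. Term Y n \<in> \<X>"
      using \<open>Y \<in> complexes_of R \<X>\<close> by (simp_all add: complexes_of_iff)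
    note Ym = complex_module[OF Y] and dY = complex_diff[OF Y]
    have "\<exists>g\<in>module_homs R (Term Y n) (P n). compose (carrier (Term Y n)) (\<phi> n) g = f n" for n
      using \<phi>[of n] YX[of n] chain_map_hom[OF f, of n] by (simp add: is_precover_def)
    then obtain g where g: "\<And>n. g n \<in> module_homs R (Term Y n) (P n)"
      and g_eq: "\<And>n. compose (carrier (Term Y n)) (\<phi> n) (g n) = f n"
      by metis
    have \<phi>g: "\<phi> n (g n y) = f n y" if y: "y \<in> carrier (Term Y n)" for n y
      using fun_cong[OF g_eq, of n y] y by (simp add: compose_eq)
    have "\<exists>h\<in>module_homs R (Term Y n) (T n). \<forall>y\<in>carrier (Term Y n). \<pi> n True (h y) = g n y \<and>
        \<pi> n False (h y) = compose (carrier (Term Y n)) (g (n - 1)) (Diff Y n) y" for n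
    proof (rule lift[OF Ym g hom_compose[OF dY g Ym]])
      fix y assume y: "y \<in> carrier (Term Y n)"
      then show "Diff Q n (\<phi> n (g n y)) =
          \<phi> (n - 1) (compose (carrier (Term Y n)) (g (n - 1)) (Diff Y n) y)"
        by (simp add: \<phi>g hom_closed[OF dY] compose_eq chain_map_comm[OF f])
    qed
    then obtain h where h: "\<And>n. h n \<in> module_homs R (Term Y n) (T n)"
      and \<pi>h: "\<And>n y. y \<in> carrier (Term Y n) \<Longrightarrow> \<pi> n True (h n y) = g n y"
      "\<And>n y. y \<in> carrier (Term Y n) \<Longrightarrow> \<pi> n False (h n y) = g (n - 1) (Diff Y n y)"
      by (simp add: compose_eq) metis
    have h_map: "h \<in> chain_maps R Y Q'"
    proof (rule chain_mapI)
      show "h n \<in> module_homs R (Term Y n) (Term Q' n)" for n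
        using h by simp
      fix n y assume y: "y \<in> carrier (Term Y n)"
      note dy = hom_closed[OF dY y] and hy = hom_closed[OF h y]
      show "h (n - 1) (Diff Y n y) = Diff Q' n (h n y)"
      proof (simp, rule T_eqI[OF hom_closed[OF h dy] hom_closed[OF d hy]])
        show "\<pi> (n - 1) True (h (n - 1) (Diff Y n y)) = \<pi> (n - 1) True (d n (h n y))"
          by (simp add: \<pi>h y dy \<pi>d hy)
        show "\<pi> (n - 1) False (h (n - 1) (Diff Y n y)) = \<pi> (n - 1) False (d n (h n y))"
          using hom_zero[OF g Ym Pm, of "n - 2"]
          by (simp add: \<pi>h y dy \<pi>d hy complex_diff_diff[OF Y])
      qed
    qed
    moreover have "Comp (Ch R) Y p h = f"
      by (rule chain_map_eqI[OF Ch_Comp[OF h_map p Y] f])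
        (simp add: compose_eq p_apply hom_closed[OF h] \<pi>h \<phi>g)
    ultimately show ?thesis by blast
  qed
  moreover have "\<forall>n. \<pi> n True \<in> module_homs R (Term Q' n) (P n)"
    using \<pi>P by simp
  moreover have "\<forall>n. \<forall>x\<in>carrier (Term Q' n). \<phi> n (\<pi> n True x) = p n x"
    by (simp add: p_apply)
  ultimately show ?thesis
    using Q' p by (intro exI[of _ Q'] exI[of _ p] exI[of _ "\<lambda>n. \<pi> n True"] conjI) blast+
qed

text \<open>
  The precover is the limit \<open>Y\<close> of the tower \<open>Q\<close> that starts with \<open>K\<close> and is continued by
  \<open>precover_step\<close>. A chain map to \<open>K\<close> lifts to \<open>Y\<close> by choosing lifts to the stages one after the other.
\<close>

theorem precovers_of_complexes:
  fixes K :: "('r, 'u) chain_complex"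
  assumes closed: "closed_under_inverse_limits TYPE('u) (Ch R) (complexes_of R \<X>)"
    and \<X>: "\<X> \<subseteq> Obj (Mod R)"
    and precovers: "\<And>M. M \<in> Obj (Mod R) \<Longrightarrow> \<exists>P \<phi>. is_precover (Mod R) \<X> M P \<phi>"
    and K: "is_complex R K"
  shows "\<exists>Y \<psi>. is_precover (Ch R) (complexes_of R \<X>) K Y \<psi>"
proof -
  \<comment> \<open>\<open>Q'\<close> is a possible next stage after \<open>Q\<close>, reached through the precovers \<open>\<phi>\<close> of its terms.\<close>
  define good where "good Q P \<phi> Q' p a \<longleftrightarrow>
    (\<forall>n. is_precover (Mod R) \<X> (Term Q n) (P n) (\<phi> n)) \<and>
    is_complex R Q' \<and> p \<in> chain_maps R Q' Q \<and>
    (\<forall>n. a n \<in> module_homs R (Term Q' n) (P n)) \<and>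
    (\<forall>n. \<forall>x\<in>carrier (Term Q' n). \<phi> n (a n x) = p n x) \<and>
    (\<forall>Y\<in>complexes_of R \<X>. \<forall>f\<in>chain_maps R Y Q. \<exists>f'\<in>chain_maps R Y Q'. Comp (Ch R) Y p f' = f)"
    for Q P \<phi> and Q' :: "('r, 'u) chain_complex" and p a
  have "\<exists>P \<phi> Q' p a. is_complex R Q \<longrightarrow> good Q P \<phi> Q' p a" for Q
  proof (cases "is_complex R Q")
    case True
    have "\<exists>P \<phi>. is_precover (Mod R) \<X> (Term Q n) P \<phi>" for n
      by (rule precovers) (simp add: complex_module[OF True] complex_small[OF True])
    then obtain P \<phi> where P: "\<And>n. is_precover (Mod R) \<X> (Term Q n) (P n) (\<phi> n)"
      by metis
    show ?thesis
      unfolding good_def using precover_step[OF True \<X> P] P by blast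
  qed simp
  then obtain Pf \<phi>f Qf pf af where
    good: "\<And>Q. is_complex R Q \<Longrightarrow> good Q (Pf Q) (\<phi>f Q) (Qf Q) (pf Q) (af Q)"
    by metis
  define Q where "Q k = (Qf ^^ k) K" for k
  have Q0: "Q 0 = K" and Q_Suc: "Q (Suc k) = Qf (Q k)" for k
    by (simp_all add: Q_def)
  have Q: "is_complex R (Q k)" for k
  proof (induction k)
    case (Suc k)
    then show ?case
      using good[OF Suc] by (simp add: Q_Suc good_def)
  qed (simp add: Q0 K)
  define P where "P k = Pf (Q k)" for k
  define \<phi> where "\<phi> k = \<phi>f (Q k)" for k
  define p where "p k = pf (Q k)" for k
  define a where "a k = af (Q k)" for k
  have goodk: "good (Q k) (P k) (\<phi> k) (Q (Suc k)) (p k) (a k)" for k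
    unfolding P_def \<phi>_def p_def a_def Q_Suc by (rule good[OF Q])
  have P: "P k n \<in> \<X>" and \<phi>: "\<phi> k n \<in> module_homs R (P k n) (Term (Q k) n)" for k n
    using goodk[of k] by (simp_all add: good_def is_precover_def)
  have p: "p k \<in> chain_maps R (Q (Suc k)) (Q k)" for k
    using goodk[of k] by (simp add: good_def)
  have a: "a k n \<in> module_homs R (Term (Q (Suc k)) n) (P k n)" for k n
    using goodk[of k] by (simp add: good_def)
  have \<phi>a: "\<phi> k n (a k n x) = p k n x" if "x \<in> carrier (Term (Q (Suc k)) n)" for k n x
    using goodk[of k] that by (simp add: good_def)
  have lift: "\<exists>f'\<in>chain_maps R Y (Q (Suc k)). Comp (Ch R) Y (p k) f' = f"
    if "Y \<in> complexes_of R \<X>" "f \<in> chain_maps R Y (Q k)" for Y f k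
    using goodk[of k] that unfolding good_def by blast
  have Pm: "left_module R (P k n)" for k n
    using subsetD[OF \<X> P] by simp
  note Qm = complex_module[OF Q] and dQ = complex_diff[OF Q] and p_hom = chain_map_hom[OF p]

  have "\<exists>L \<pi>. is_sequence_limit (\<lambda>k. Term (Q k) n) (\<lambda>k. p k n) L \<pi>" for n
    by (rule sequence_limit_exists) (simp_all add: Qm complex_small[OF Q] p_hom)
  then obtain L \<pi> where L: "\<And>n. is_sequence_limit (\<lambda>k. Term (Q k) n) (\<lambda>k. p k n) (L n) (\<pi> n)"
    by metis
  note Lm = sequence_limit_Obj(1)[OF L] and \<pi> = sequence_limit_hom[OF L]
    and p\<pi> = sequence_limit_compat[OF L] and L_eqI = sequence_limit_eqI[OF L]

  \<comment> \<open>The maps \<open>a\<close> and \<open>\<phi>\<close> interleave the towers \<open>Q\<close> and \<open>P\<close>, which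
    therefore have the same limit.\<close>
  define q where "q k n = compose (carrier (P (Suc k) n)) (a k n) (\<phi> (Suc k) n)" for k n
  define \<rho> where "\<rho> n k = compose (carrier (L n)) (a k n) (\<pi> n (Suc k))" for n k
  have \<rho>_apply: "\<rho> n k x = a k n (\<pi> n (Suc k) x)" if "x \<in> carrier (L n)" for n k x
    using that by (simp add: \<rho>_def compose_eq)
  have \<phi>\<rho>: "\<phi> k n (\<rho> n k x) = \<pi> n k x" if x: "x \<in> carrier (L n)" for n k x
    using \<phi>a[OF hom_closed[OF \<pi> x]] p\<pi>[OF x] by (simp add: \<rho>_apply[OF x])
  have \<rho>: "\<rho> n k \<in> module_homs R (L n) (P k n)" for n k
    unfolding \<rho>_def by (rule hom_compose[OF \<pi> a Lm])
  have "is_sequence_limit (\<lambda>k. P k n) (\<lambda>k. q k n) (L n) (\<rho> n)" for n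
    unfolding is_sequence_limit_def
  proof (intro conjI allI)
    show "L n \<in> Obj (Mod R)"
      using sequence_limit_Obj[OF L] by simp
    show "\<rho> n k \<in> module_homs R (L n) (P k n)" for k
      by (rule \<rho>)
    let ?S = "{s. (\<forall>k. s k \<in> carrier (P k n)) \<and> (\<forall>k. q k n (s (Suc k)) = s k)}"
    show "bij_betw (\<lambda>x k. \<rho> n k x) (carrier (L n)) ?S"
      unfolding bij_betw_def
    proof
      show "inj_on (\<lambda>x k. \<rho> n k x) (carrier (L n))"
      proof (rule inj_onI, rule L_eqI)
        fix x y k assume x: "x \<in> carrier (L n)" and y: "y \<in> carrier (L n)"
          and eq: "(\<lambda>k. \<rho> n k x) = (\<lambda>k. \<rho> n k y)"
        show "\<pi> n k x = \<pi> n k y"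
          using \<phi>\<rho>[OF x, of k] \<phi>\<rho>[OF y, of k] fun_cong[OF eq, of k] by simp
      qed
      show "(\<lambda>x k. \<rho> n k x) ` carrier (L n) = ?S"
      proof (intro equalityI subsetI)
        fix s assume "s \<in> (\<lambda>x k. \<rho> n k x) ` carrier (L n)"
        then obtain x where x: "x \<in> carrier (L n)" and s: "s = (\<lambda>k. \<rho> n k x)"
          by blast
        have "q k n (\<rho> n (Suc k) x) = \<rho> n k x" for k
          using hom_closed[OF \<rho> x, of "Suc k"]
          unfolding \<rho>_apply[OF x, of k] by (simp add: q_def compose_eq \<phi>\<rho>[OF x])
        then show "s \<in> ?S"
          using hom_closed[OF \<rho> x] by (simp add: s)
      next
        fix s assume "s \<in> ?S"
        then have s: "\<And>k. s k \<in> carrier (P k n)" and qs: "\<And>k. q k n (s (Suc k)) = s k"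
          by blast+
        have as: "a k n (\<phi> (Suc k) n (s (Suc k))) = s k" for k
          using qs[of k] s[of "Suc k"] by (simp add: q_def compose_eq)
        have "\<exists>x\<in>carrier (L n). \<forall>k. \<pi> n k x = \<phi> k n (s k)"
        proof (rule sequence_limit_point[OF L])
          show "\<phi> k n (s k) \<in> carrier (Term (Q k) n)" for k
            by (rule hom_closed[OF \<phi> s])
          show "p k n (\<phi> (Suc k) n (s (Suc k))) = \<phi> k n (s k)" for k
            using \<phi>a[OF hom_closed[OF \<phi> s], of k] as[of k] by simp
        qed
        then obtain x where x: "x \<in> carrier (L n)" and \<pi>x: "\<And>k. \<pi> n k x = \<phi> k n (s k)"
          by blast
        have "(\<lambda>k. \<rho> n k x) = s"
          by (rule ext) (simp add: \<rho>_apply[OF x] \<pi>x as)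
        then show "s \<in> (\<lambda>x k. \<rho> n k x) ` carrier (L n)"
          using x by blast
      qed
    qed
  qed
  moreover have "q k n \<in> module_homs R (P (Suc k) n) (P k n)" for k n
    unfolding q_def by (rule hom_compose[OF \<phi> a Pm])
  ultimately have L_\<X>: "L n \<in> \<X>" for n
    using sequence_limits_in_class[OF closed \<X>, of P q L \<rho> n] P by blast

  have "\<exists>d\<in>module_homs R (L n) (L (n - 1)). \<forall>k. \<forall>x\<in>carrier (L n).
      \<pi> (n - 1) k (d x) = compose (carrier (L n)) (Diff (Q k) n) (\<pi> n k) x" for n
  proof (rule sequence_limit_lift[OF L Lm hom_compose[OF \<pi> dQ Lm]])
    fix k x assume x: "x \<in> carrier (L n)"
    then show "p k (n - 1) (compose (carrier (L n)) (Diff (Q (Suc k)) n) (\<pi> n (Suc k)) x) =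
        compose (carrier (L n)) (Diff (Q k) n) (\<pi> n k) x"
      using chain_map_comm[OF p hom_closed[OF \<pi> x]] p\<pi>[OF x] by (simp add: compose_eq)
  qed
  then obtain d where d: "\<And>n. d n \<in> module_homs R (L n) (L (n - 1))"
    and \<pi>d: "\<And>n k x. x \<in> carrier (L n) \<Longrightarrow> \<pi> (n - 1) k (d n x) = Diff (Q k) n (\<pi> n k x)"
    by (simp add: compose_eq) metis
  define Y where "Y = \<lparr>Term = L, Diff = d\<rparr>"
  have Y_simps [simp]: "Term Y = L" "Diff Y = d"
    by (simp_all add: Y_def)
  have "is_complex R Y"
    unfolding is_complex_def
  proof (intro conjI allI ballI)
    fix n x assume "x \<in> carrier (Term Y n)"
    then have x: "x \<in> carrier (L n)" by simp
    note dx = hom_closed[OF d x]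
    show "Diff Y (n - 1) (Diff Y n x) = \<zero>\<^bsub>Term Y (n - 2)\<^esub>"
    proof (simp, rule L_eqI)
      show "d (n - 1) (d n x) \<in> carrier (L (n - 2))"
        using hom_closed[OF d dx] by simp
      show "\<pi> (n - 2) k (d (n - 1) (d n x)) = \<pi> (n - 2) k \<zero>\<^bsub>L (n - 2)\<^esub>" for k
        using \<pi>d[OF dx, of k] \<pi>d[OF x, of k] complex_diff_diff[OF Q hom_closed[OF \<pi> x], of k]
          hom_zero[OF \<pi> Lm Qm, of "n - 2" k] by simp
    qed (rule module_zero[OF Lm])
  qed (use sequence_limit_Obj[OF L] d in simp_all)
  then have Y: "Y \<in> complexes_of R \<X>"
    using L_\<X> by (simp add: complexes_of_iff)
  define \<psi> where "\<psi> n = \<pi> n 0" for n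
  have \<psi>: "\<psi> \<in> chain_maps R Y K"
    by (rule chain_mapI) (use \<pi>[of _ 0] \<pi>d[of _ _ 0] in \<open>simp_all add: \<psi>_def Q0\<close>)
  have "\<exists>h\<in>chain_maps R Z Y. Comp (Ch R) Z \<psi> h = f"
    if Z: "Z \<in> complexes_of R \<X>" and f: "f \<in> chain_maps R Z K" for Z f
  proof -
    have Zc: "is_complex R Z"
      using Z by (simp add: complexes_of_iff)
    note Zm = complex_module[OF Zc] and dZ = complex_diff[OF Zc]
    have "\<exists>g. \<forall>k. (g k \<in> chain_maps R Z (Q k) \<and> (k = 0 \<longrightarrow> g k = f)) \<and>
        Comp (Ch R) Z (p k) (g (Suc k)) = g k"
    proof (rule dependent_nat_choice)
      show "\<exists>g. g \<in> chain_maps R Z (Q 0) \<and> (0 = 0 \<longrightarrow> g = f)"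
        using f by (simp add: Q0)
      show "\<exists>g'. (g' \<in> chain_maps R Z (Q (Suc k)) \<and> (Suc k = 0 \<longrightarrow> g' = f)) \<and>
          Comp (Ch R) Z (p k) g' = g"
        if "g \<in> chain_maps R Z (Q k) \<and> (k = 0 \<longrightarrow> g = f)" for g k
        using lift[OF Z, of g k] that by blast
    qed
    then obtain g where g: "\<And>k. g k \<in> chain_maps R Z (Q k)" and g0: "g 0 = f"
      and g_eq: "\<And>k. Comp (Ch R) Z (p k) (g (Suc k)) = g k"
      by blast
    have pg: "p k n (g (Suc k) n z) = g k n z" if "z \<in> carrier (Term Z n)" for k n z
    proof -
      have "Comp (Ch R) Z (p k) (g (Suc k)) n z = g k n z"
        unfolding g_eq ..
      then show ?thesis
        using that by (simp add: compose_eq)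
    qed
    have "\<exists>h\<in>module_homs R (Term Z n) (L n). \<forall>k. \<forall>z\<in>carrier (Term Z n). \<pi> n k (h z) = g k n z" for n
      by (rule sequence_limit_lift[OF L Zm chain_map_hom[OF g] pg])
    then obtain h where h: "\<And>n. h n \<in> module_homs R (Term Z n) (L n)"
      and \<pi>h: "\<And>n k z. z \<in> carrier (Term Z n) \<Longrightarrow> \<pi> n k (h n z) = g k n z"
      by metis
    have h_map: "h \<in> chain_maps R Z Y"
    proof (rule chain_mapI)
      show "h n \<in> module_homs R (Term Z n) (Term Y n)" for n
        using h by simp
      fix n z assume z: "z \<in> carrier (Term Z n)"
      note dz = hom_closed[OF dZ z] and hz = hom_closed[OF h z]
      have "h (n - 1) (Diff Z n z) = d n (h n z)"
        by (rule L_eqI[OF hom_closed[OF h dz] hom_closed[OF d hz]])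
          (simp add: \<pi>h[OF dz] \<pi>d[OF hz] \<pi>h[OF z] chain_map_comm[OF g z])
      then show "h (n - 1) (Diff Z n z) = Diff Y n (h n z)"
        by simp
    qed
    moreover have "Comp (Ch R) Z \<psi> h = f"
      by (rule chain_map_eqI[OF Ch_Comp[OF h_map \<psi> Zc] f])
        (simp add: compose_eq \<psi>_def \<pi>h g0)
    ultimately show ?thesis by blast
  qed
  then show ?thesis
    using Y \<psi> by (intro exI[of _ Y] exI[of _ \<psi>]) (simp add: is_precover_def del: Ch_simps(3))
qed

end

section \<open>Direct limits of complexes\<close>

context modules_in_universe
begin

text \<open>
  Direct limits of complexes are formed termwise, the differential being induced by the differentials
  of the stages.
\<close>

lemma complex_direct_limit_exists:
  fixes I :: "'i set" and F :: "'i \<Rightarrow> ('r, 'u) chain_complex"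
  assumes small_I: "small TYPE('u) I" and dir: "directed_poset I r"
    and sys: "direct_system (Ch R) I r F t"
  shows "\<exists>L u. is_direct_limit (Ch R) I r F t L u \<and>
    (\<forall>n. is_module_direct_limit I r (\<lambda>i. Term (F i) n) (\<lambda>i j. t i j n) (Term L n) (\<lambda>i. u i n))"
proof -
  have r: "r \<subseteq> I \<times> I"
    using dir unfolding directed_poset_def partial_order_on_def preorder_on_def by blast
  have F: "is_complex R (F i)" if "i \<in> I" for i
    using sys that by (simp add: direct_system_def)
  have t: "t i j \<in> chain_maps R (F i) (F j)" if "(i, j) \<in> r" for i j
    using sys that by (simp add: direct_system_def)
  have tt: "t j k n (t i j n x) = t i k n x"
    if ij: "(i, j) \<in> r" and jk: "(j, k) \<in> r" and x: "x \<in> carrier (Term (F i) n)" for i j k n x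
  proof -
    have "Comp (Ch R) (F i) (t j k) (t i j) = t i k"
      using sys ij jk unfolding direct_system_def by blast
    then have "Comp (Ch R) (F i) (t j k) (t i j) n x = t i k n x"
      by simp
    then show ?thesis
      using x by (simp add: compose_eq)
  qed
  note Fm = complex_module[OF F] and dF = complex_diff[OF F] and t_hom = chain_map_hom[OF t]
  have "\<exists>L u. is_module_direct_limit I r (\<lambda>i. Term (F i) n) (\<lambda>i j. t i j n) L u" for n
    by (rule module_direct_limit_exists[OF small_I dir])
      (simp_all add: Fm complex_small[OF F] t_hom tt)
  then obtain L u where
    L: "\<And>n. is_module_direct_limit I r (\<lambda>i. Term (F i) n) (\<lambda>i j. t i j n) (L n) (u n)"
    by metis
  have L_Obj: "L n \<in> Obj (Mod R)" and Lm: "left_module R (L n)" for n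
    using L[of n] by (simp_all add: is_module_direct_limit_def)
  have u: "u n i \<in> module_homs R (Term (F i) n) (L n)" if "i \<in> I" for n i
    using L[of n] that unfolding is_module_direct_limit_def by blast
  have ut: "u n j (t i j n x) = u n i x"
    if "(i, j) \<in> r" "x \<in> carrier (Term (F i) n)" for n i j x
    using L[of n] that unfolding is_module_direct_limit_def by blast
  have surj: "\<exists>i\<in>I. \<exists>x\<in>carrier (Term (F i) n). y = u n i x" if "y \<in> carrier (L n)" for n y
    using L[of n] that unfolding is_module_direct_limit_def by blast
  note lift = module_direct_limit_lift[OF L dir Fm t_hom]
  have "\<exists>d\<in>module_homs R (L n) (L (n - 1)). \<forall>i\<in>I. \<forall>x\<in>carrier (Term (F i) n).
      d (u n i x) = compose (carrier (Term (F i) n)) (u (n - 1) i) (Diff (F i) n) x" for n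
  proof (rule lift)
    show "compose (carrier (Term (F i) n)) (u (n - 1) i) (Diff (F i) n)
        \<in> module_homs R (Term (F i) n) (L (n - 1))" if i: "i \<in> I" for i
      by (rule hom_compose[OF dF[OF i] u[OF i] Fm[OF i]])
    show "compose (carrier (Term (F j) n)) (u (n - 1) j) (Diff (F j) n) (t i j n x) =
        compose (carrier (Term (F i) n)) (u (n - 1) i) (Diff (F i) n) x"
      if ij: "(i, j) \<in> r" and x: "x \<in> carrier (Term (F i) n)" for i j x
    proof -
      have i: "i \<in> I"
        using ij r by blast
      show ?thesis
        using x hom_closed[OF t_hom[OF ij] x] chain_map_comm[OF t[OF ij] x]
          ut[OF ij hom_closed[OF dF[OF i] x]] by (simp add: compose_eq)
    qed
  qed
  then obtain d where d: "\<And>n. d n \<in> module_homs R (L n) (L (n - 1))"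
    and du: "\<And>n i x. i \<in> I \<Longrightarrow> x \<in> carrier (Term (F i) n) \<Longrightarrow>
      d n (u n i x) = u (n - 1) i (Diff (F i) n x)"
    by (simp add: compose_eq) metis
  define C where "C = \<lparr>Term = L, Diff = d\<rparr>"
  have C_simps [simp]: "Term C = L" "Diff C = d"
    by (simp_all add: C_def)
  have C: "is_complex R C"
    unfolding is_complex_def
  proof (intro conjI allI ballI)
    fix n y assume "y \<in> carrier (Term C n)"
    then obtain i x where i: "i \<in> I" and x: "x \<in> carrier (Term (F i) n)" and y: "y = u n i x"
      using surj[of y n] by auto
    show "Diff C (n - 1) (Diff C n y) = \<zero>\<^bsub>Term C (n - 2)\<^esub>"
      using du[OF i x] du[OF i hom_closed[OF dF[OF i] x]] complex_diff_diff[OF F[OF i] x]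
        hom_zero[OF u[OF i] Fm[OF i] Lm, of "n - 2"] by (simp add: y)
  qed (use L_Obj d in simp_all)
  define w where "w i n = u n i" for i n
  have w: "w i \<in> chain_maps R (F i) C" if "i \<in> I" for i
    by (rule chain_mapI) (simp_all add: w_def u du that)
  have wt: "Comp (Ch R) (F i) (w j) (t i j) = w i" if ij: "(i, j) \<in> r" for i j
  proof -
    have ij': "i \<in> I" "j \<in> I"
      using ij r by auto
    show ?thesis
      by (rule chain_map_eqI[OF Ch_Comp[OF t[OF ij] w[OF ij'(2)] F[OF ij'(1)]] w[OF ij'(1)]])
        (simp add: compose_eq w_def ut[OF ij])
  qed
  have "is_direct_limit (Ch R) I r F t C w"
    unfolding is_direct_limit_def
  proof (intro conjI allI impI)
    show "compatible_cocone (Ch R) I r F t C w"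
      unfolding compatible_cocone_def using C w wt by (simp del: Ch_simps(3))
    fix N v assume cocone: "compatible_cocone (Ch R) I r F t N v"
    then have N: "is_complex R N"
      by (simp add: compatible_cocone_def)
    have v: "v i \<in> chain_maps R (F i) N" if "i \<in> I" for i
      using cocone that by (simp add: compatible_cocone_def)
    have vt: "v j n (t i j n x) = v i n x"
      if ij: "(i, j) \<in> r" and x: "x \<in> carrier (Term (F i) n)" for i j n x
    proof -
      have "Comp (Ch R) (F i) (v j) (t i j) = v i"
        using cocone ij unfolding compatible_cocone_def by blast
      then have "Comp (Ch R) (F i) (v j) (t i j) n x = v i n x"
        by simp
      then show ?thesis
        using x by (simp add: compose_eq)
    qed
    have "\<exists>h\<in>module_homs R (L n) (Term N n).
        \<forall>i\<in>I. \<forall>x\<in>carrier (Term (F i) n). h (u n i x) = v i n x" for n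
      by (rule lift) (simp_all add: chain_map_hom[OF v] vt)
    then obtain h where h: "\<And>n. h n \<in> module_homs R (L n) (Term N n)"
      and hu: "\<And>n i x. i \<in> I \<Longrightarrow> x \<in> carrier (Term (F i) n) \<Longrightarrow> h n (u n i x) = v i n x"
      by metis
    have h_map: "h \<in> chain_maps R C N"
    proof (rule chain_mapI)
      show "h n \<in> module_homs R (Term C n) (Term N n)" for n
        using h by simp
      fix n y assume "y \<in> carrier (Term C n)"
      then obtain i x where i: "i \<in> I" and x: "x \<in> carrier (Term (F i) n)" and y: "y = u n i x"
        using surj[of y n] by auto
      show "h (n - 1) (Diff C n y) = Diff N n (h n y)"
        by (simp add: y du[OF i x] hu[OF i x] hu[OF i hom_closed[OF dF[OF i] x]]
            chain_map_comm[OF v[OF i] x])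
    qed
    show "\<exists>!h. h \<in> Hom (Ch R) C N \<and> (\<forall>i\<in>I. Comp (Ch R) (F i) h (w i) = v i)"
    proof (rule ex1I[of _ h])
      have "Comp (Ch R) (F i) h (w i) = v i" if i: "i \<in> I" for i
        by (rule chain_map_eqI[OF Ch_Comp[OF w[OF i] h_map F[OF i]] v[OF i]])
          (simp add: compose_eq w_def hu[OF i])
      then show "h \<in> Hom (Ch R) C N \<and> (\<forall>i\<in>I. Comp (Ch R) (F i) h (w i) = v i)"
        using h_map by (simp del: Ch_simps(3))
      fix h' assume h': "h' \<in> Hom (Ch R) C N \<and> (\<forall>i\<in>I. Comp (Ch R) (F i) h' (w i) = v i)"
      then have h'_map: "h' \<in> chain_maps R C N"
        by simp
      show "h' = h"
      proof (rule chain_map_eqI[OF h'_map h_map])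
        fix n y assume "y \<in> carrier (Term C n)"
        then obtain i x where i: "i \<in> I" and x: "x \<in> carrier (Term (F i) n)" and y: "y = u n i x"
          using surj[of y n] by auto
        have "Comp (Ch R) (F i) h' (w i) = v i"
          using h' i by blast
        then have "Comp (Ch R) (F i) h' (w i) n x = v i n x"
          by simp
        then show "h' n y = h n y"
          using x by (simp add: compose_eq w_def y hu[OF i x])
      qed
    qed
  qed
  then show ?thesis
    using L by (intro exI[of _ C] exI[of _ w]) (simp add: w_def)
qed

end


section \<open>From precovers to covers\<close>

locale complex_in_direct_limit_closed_class = modules_in_universe U R
  for U :: "'u itself" and R :: "('r, 'e) ring_scheme" +
  fixes \<X> :: "('r, 'u) module set" and K :: "('r, 'u) chain_complex"
  assumes direct_limits: "closed_under_direct_limits TYPE('u) (Ch R) (complexes_of R \<X>)"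
    and K: "is_complex R K"
begin

abbreviation precover :: "('r, 'u) chain_complex \<Rightarrow> (int \<Rightarrow> 'u \<Rightarrow> 'u) \<Rightarrow> bool" where
  "precover F \<phi> \<equiv> is_precover (Ch R) (complexes_of R \<X>) K F \<phi>"

text \<open>
  These are the endomorphisms that a cover requires to be invertible.
\<close>

definition endos ::
  "('r, 'u) chain_complex \<Rightarrow> (int \<Rightarrow> 'u \<Rightarrow> 'u) \<Rightarrow> (int \<Rightarrow> 'u \<Rightarrow> 'u) set" where
  "endos F \<phi> = {g \<in> chain_maps R F F. Comp (Ch R) F \<phi> g = \<phi>}"

lemma
  assumes "precover F \<phi>"
  shows precover_class: "F \<in> complexes_of R \<X>"
    and precover_complex: "is_complex R F"
    and precover_map: "\<phi> \<in> chain_maps R F K"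
    and precover_lift: "Y \<in> complexes_of R \<X> \<Longrightarrow> f \<in> chain_maps R Y K \<Longrightarrow>
      \<exists>g\<in>chain_maps R Y F. Comp (Ch R) Y \<phi> g = f"
  using assms by (simp_all add: is_precover_def complexes_of_iff del: Ch_simps(3))

lemma endos_map: "g \<in> endos F \<phi> \<Longrightarrow> g \<in> chain_maps R F F"
  by (simp add: endos_def)

lemma endos_over: "g \<in> endos F \<phi> \<Longrightarrow> Comp (Ch R) F \<phi> g = \<phi>"
  by (simp add: endos_def)

lemma endos_Ident: "precover F \<phi> \<Longrightarrow> Ident (Ch R) F \<in> endos F \<phi>"
  using Ch_Ident_right[OF precover_map precover_complex] Ch_Ident[OF precover_complex]
  unfolding endos_def by blast

lemma endos_Comp:
  assumes "precover F \<phi>" and g: "g \<in> endos F \<phi>" and h: "h \<in> endos F \<phi>"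
  shows "Comp (Ch R) F h g \<in> endos F \<phi>"
  using Ch_Comp[OF endos_map[OF g] endos_map[OF h] precover_complex[OF assms(1)]]
    Ch_Comp_assoc[OF endos_map[OF g], of \<phi> h] endos_over[OF g] endos_over[OF h]
  unfolding endos_def by (simp del: Ch_simps)

text \<open>
  The limit of a system of copies of \<open>F\<close> over \<open>K\<close> stays in the class by closure under direct limits,
  and it is again an object over \<open>K\<close> by the universal property.
\<close>

lemma constant_system_limit:
  fixes I :: "'u set"
  assumes pre: "precover F \<phi>" and small_I: "small TYPE('u) I" and dir: "directed_poset I r"
    and t: "\<And>i j. (i, j) \<in> r \<Longrightarrow> t i j \<in> endos F \<phi>"
    and t_id: "\<And>i. i \<in> I \<Longrightarrow> t i i = Ident (Ch R) F"
    and tt: "\<And>i j k. (i, j) \<in> r \<Longrightarrow> (j, k) \<in> r \<Longrightarrow> Comp (Ch R) F (t j k) (t i j) = t i k"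
  shows "\<exists>L u \<psi>. L \<in> complexes_of R \<X> \<and> \<psi> \<in> chain_maps R L K \<and>
    (\<forall>n. \<forall>y\<in>carrier (Term L n). \<exists>i\<in>I. \<exists>x\<in>carrier (Term F n). y = u i n x) \<and>
    (\<forall>i\<in>I. u i \<in> chain_maps R F L \<and> Comp (Ch R) F \<psi> (u i) = \<phi>) \<and>
    (\<forall>i j. (i, j) \<in> r \<longrightarrow> Comp (Ch R) F (u j) (t i j) = u i)"
proof -
  have sys: "direct_system (Ch R) I r (\<lambda>_. F) t"
    unfolding direct_system_def using precover_complex[OF pre] t_id endos_map[OF t] tt
    by (simp del: Ch_simps(3,4))
  obtain L u where lim: "is_direct_limit (Ch R) I r (\<lambda>_. F) t L u"
    and L: "\<And>n. is_module_direct_limit I r (\<lambda>i. Term F n) (\<lambda>i j. t i j n) (Term L n) (\<lambda>i. u i n)"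
    using complex_direct_limit_exists[OF small_I dir sys] by blast
  have "L \<in> complexes_of R \<X>"
    using direct_limits small_I dir sys lim precover_class[OF pre]
    unfolding closed_under_direct_limits_def by blast
  moreover have "\<exists>i\<in>I. \<exists>x\<in>carrier (Term F n). y = u i n x" if "y \<in> carrier (Term L n)" for n y
    using L[of n] that unfolding is_module_direct_limit_def by blast
  moreover have cocone: "compatible_cocone (Ch R) I r (\<lambda>_. F) t L u"
    using lim by (simp add: is_direct_limit_def)
  moreover have "compatible_cocone (Ch R) I r (\<lambda>_. F) t K (\<lambda>_. \<phi>)"
    unfolding compatible_cocone_def using K precover_map[OF pre] endos_over[OF t]
    by (simp del: Ch_simps(3))
  then have "\<exists>\<psi>. \<psi> \<in> Hom (Ch R) L K \<and> (\<forall>i\<in>I. Comp (Ch R) F \<psi> (u i) = \<phi>)"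
    using lim unfolding is_direct_limit_def by blast
  ultimately show ?thesis
    unfolding compatible_cocone_def by (simp del: Ch_simps(3)) blast
qed

text \<open>
  A linearly ordered system of copies of \<open>F\<close> over \<open>K\<close>, indexed by all of \<open>W\<close> and with \<open>w0\<close> as first
  index: \<open>s i\<close> is the transition map from \<open>w0\<close> to \<open>i\<close>, the maps \<open>v i\<close> form a cocone to \<open>F\<close>, and
  the map \<open>b\<close> from an index to a larger one satisfies \<open>D\<close> relative to the map from \<open>w0\<close>. For
  \<open>D a b\<close> saying that \<open>b\<close> enlarges the kernel of \<open>a\<close>, the maps \<open>s i\<close> have different kernels; for
  \<open>D a b\<close> saying that \<open>b\<close> is not surjective, the maps \<open>v i\<close> have different images if they are injective.

  A maximal system has index set \<open>W\<close>. Otherwise let \<open>v\<close> be a cocone to \<open>F\<close>, which exists by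
  \<open>constant_system_limit\<close> and the precover property. For the map \<open>g\<close> that the hypothesis provides for
  \<open>v w0\<close>, the composites of \<open>g\<close> with the maps \<open>v i\<close> prolong the system by a new largest index.
\<close>

lemma chain_of_endomorphisms:
  fixes W :: "'u set"
  assumes pre: "precover F \<phi>" and W: "small TYPE('u) W" and w0: "w0 \<in> W"
    and grow: "\<And>h. h \<in> endos F \<phi> \<Longrightarrow> \<exists>g\<in>endos F \<phi>. \<forall>a\<in>endos F \<phi>. \<forall>b\<in>endos F \<phi>.
      Comp (Ch R) F b a = h \<longrightarrow> D a (Comp (Ch R) F g b)"
  shows "\<exists>s v. (\<forall>i\<in>W. s i \<in> endos F \<phi> \<and> v i \<in> endos F \<phi>) \<and>
    (\<forall>i\<in>W. \<forall>j\<in>W. i \<noteq> j \<longrightarrow> (\<exists>b\<in>endos F \<phi>.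
      D (s i) b \<and> s j = Comp (Ch R) F b (s i) \<and> v i = Comp (Ch R) F (v j) b \<or>
      D (s j) b \<and> s i = Comp (Ch R) F b (s j) \<and> v j = Comp (Ch R) F (v i) b))"
proof -
  let ?E = "endos F \<phi>" and ?id = "Ident (Ch R) F"
  let ?comp = "Comp (Ch R) F"
  note F = precover_complex[OF pre]
  have comp_E: "?comp h g \<in> ?E" if "g \<in> ?E" "h \<in> ?E" for g h
    by (rule endos_Comp[OF pre that])
  have assoc: "?comp h (?comp g f) = ?comp (?comp h g) f" if "f \<in> ?E" for f g h
    by (rule Ch_Comp_assoc[OF endos_map[OF that]])
  have unit: "?comp ?id f = f" "?comp f ?id = f" if "f \<in> ?E" for f
    using Ch_Ident_left[OF endos_map[OF that] F F] Ch_Ident_right[OF endos_map[OF that] F] by auto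
  have id_E: "?id \<in> ?E"
    by (rule endos_Ident[OF pre])

  \<comment> \<open>A system is encoded as a set of triples (source, target, transition map), so that the order is
    inclusion and the union of a chain is an upper bound: every condition starts from at most two triples.\<close>
  define lin :: "('u \<times> 'u \<times> (int \<Rightarrow> 'u \<Rightarrow> 'u)) set \<Rightarrow> bool" where "lin T \<longleftrightarrow>
    (\<forall>i j e. (i, j, e) \<in> T \<longrightarrow> i \<in> W \<and> j \<in> W \<and> e \<in> ?E \<and> (i, i, ?id) \<in> T \<and> (j, j, ?id) \<in> T \<and>
      (\<exists>a. (w0, i, a) \<in> T)) \<and>
    (\<forall>i j e e'. (i, j, e) \<in> T \<longrightarrow> (i, j, e') \<in> T \<longrightarrow> e = e') \<and>
    (\<forall>i j e e'. (i, j, e) \<in> T \<longrightarrow> (j, i, e') \<in> T \<longrightarrow> i = j) \<and>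
    (\<forall>i j. (i, i, ?id) \<in> T \<longrightarrow> (j, j, ?id) \<in> T \<longrightarrow> (\<exists>e. (i, j, e) \<in> T) \<or> (\<exists>e. (j, i, e) \<in> T)) \<and>
    (\<forall>i j k e f. (i, j, e) \<in> T \<longrightarrow> (j, k, f) \<in> T \<longrightarrow> (i, k, ?comp f e) \<in> T) \<and>
    (\<forall>i j a b. (w0, i, a) \<in> T \<longrightarrow> (i, j, b) \<in> T \<longrightarrow> i \<noteq> j \<longrightarrow> D a b) \<and>
    (w0, w0, ?id) \<in> T" for T
  have linD:
    "\<And>i j e. (i, j, e) \<in> T \<Longrightarrow> i \<in> W \<and> j \<in> W \<and> e \<in> ?E \<and> (i, i, ?id) \<in> T \<and> (j, j, ?id) \<in> T \<and>
      (\<exists>a. (w0, i, a) \<in> T)"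
    "\<And>i j e e'. (i, j, e) \<in> T \<Longrightarrow> (i, j, e') \<in> T \<Longrightarrow> e = e'"
    "\<And>i j e e'. (i, j, e) \<in> T \<Longrightarrow> (j, i, e') \<in> T \<Longrightarrow> i = j"
    "\<And>i j. (i, i, ?id) \<in> T \<Longrightarrow> (j, j, ?id) \<in> T \<Longrightarrow> (\<exists>e. (i, j, e) \<in> T) \<or> (\<exists>e. (j, i, e) \<in> T)"
    "\<And>i j k e f. (i, j, e) \<in> T \<Longrightarrow> (j, k, f) \<in> T \<Longrightarrow> (i, k, ?comp f e) \<in> T"
    "\<And>i j a b. (w0, i, a) \<in> T \<Longrightarrow> (i, j, b) \<in> T \<Longrightarrow> i \<noteq> j \<Longrightarrow> D a b"
    "(w0, w0, ?id) \<in> T"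
    if T: "lin T" for T
  proof -
    note c = T[unfolded lin_def]
    note c1 = c[THEN conjunct1] and c = c[THEN conjunct2]
    note c2 = c[THEN conjunct1] and c = c[THEN conjunct2]
    note c3 = c[THEN conjunct1] and c = c[THEN conjunct2]
    note c4 = c[THEN conjunct1] and c = c[THEN conjunct2]
    note c5 = c[THEN conjunct1] and c = c[THEN conjunct2]
    note c6 = c[THEN conjunct1] and c7 = c[THEN conjunct2]
    show "i \<in> W \<and> j \<in> W \<and> e \<in> ?E \<and> (i, i, ?id) \<in> T \<and> (j, j, ?id) \<in> T \<and> (\<exists>a. (w0, i, a) \<in> T)"
      if "(i, j, e) \<in> T" for i j e
      using c1 that by blast
    show "e = e'" if "(i, j, e) \<in> T" "(i, j, e') \<in> T" for i j e e'
      by (rule c2[rule_format, OF that])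
    show "i = j" if "(i, j, e) \<in> T" "(j, i, e') \<in> T" for i j e e'
      by (rule c3[rule_format, OF that])
    show "(\<exists>e. (i, j, e) \<in> T) \<or> (\<exists>e. (j, i, e) \<in> T)"
      if "(i, i, ?id) \<in> T" "(j, j, ?id) \<in> T" for i j
      by (rule c4[rule_format, OF that])
    show "(i, k, ?comp f e) \<in> T" if "(i, j, e) \<in> T" "(j, k, f) \<in> T" for i j k e f
      by (rule c5[rule_format, OF that])
    show "D a b" if "(w0, i, a) \<in> T" "(i, j, b) \<in> T" "i \<noteq> j" for i j a b
      by (rule c6[rule_format, OF that])
    show "(w0, w0, ?id) \<in> T"
      by (rule c7)
  qed

  have "\<exists>T\<in>{T. lin T}. \<forall>T'\<in>{T. lin T}. T \<subseteq> T' \<longrightarrow> T' = T"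
  proof (rule subset_Zorn_nonempty)
    have "lin {(w0, w0, ?id)}"
      unfolding lin_def using w0 id_E unit(1)[OF id_E] by simp
    then show "{T. lin T} \<noteq> {}" by blast
    fix C assume C: "C \<noteq> {}" "subset.chain {T. lin T} C"
    have lin_C: "lin T" if "T \<in> C" for T
      using C(2) that by (auto simp: subset.chain_def)
    have two: "\<exists>T\<in>C. x \<in> T \<and> y \<in> T" if "x \<in> \<Union>C" "y \<in> \<Union>C" for x y
    proof -
      obtain T1 T2 where T: "T1 \<in> C" "T2 \<in> C" "x \<in> T1" "y \<in> T2"
        using \<open>x \<in> \<Union>C\<close> \<open>y \<in> \<Union>C\<close> by blast
      then have "T1 \<subseteq> T2 \<or> T2 \<subseteq> T1"
        using C(2) by (auto simp: subset_chain_def)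
      then show ?thesis
        using T by blast
    qed
    have "lin (\<Union>C)"
      unfolding lin_def
    proof (intro conjI allI impI)
      fix i j e assume "(i, j, e) \<in> \<Union>C"
      then obtain T where T: "T \<in> C" "(i, j, e) \<in> T" by blast
      note T' = linD(1)[OF lin_C[OF T(1)] T(2)]
      show "i \<in> W" "j \<in> W" "e \<in> ?E"
        using T' by simp_all
      show "(i, i, ?id) \<in> \<Union>C" "(j, j, ?id) \<in> \<Union>C" "\<exists>a. (w0, i, a) \<in> \<Union>C"
        using T' T(1) by blast+
    next
      fix i j e e' assume "(i, j, e) \<in> \<Union>C" "(i, j, e') \<in> \<Union>C"
      from two[OF this] show "e = e'"
        using linD(2)[OF lin_C] by blast
    next
      fix i j e e' assume "(i, j, e) \<in> \<Union>C" "(j, i, e') \<in> \<Union>C"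
      from two[OF this] show "i = j"
        using linD(3)[OF lin_C] by blast
    next
      fix i j assume "(i, i, ?id) \<in> \<Union>C" "(j, j, ?id) \<in> \<Union>C"
      from two[OF this] show "(\<exists>e. (i, j, e) \<in> \<Union>C) \<or> (\<exists>e. (j, i, e) \<in> \<Union>C)"
        using linD(4)[OF lin_C] by blast
    next
      fix i j k e f assume "(i, j, e) \<in> \<Union>C" "(j, k, f) \<in> \<Union>C"
      from two[OF this] show "(i, k, ?comp f e) \<in> \<Union>C"
        using linD(5)[OF lin_C] by blast
    next
      fix i j a b assume "(w0, i, a) \<in> \<Union>C" "(i, j, b) \<in> \<Union>C" and ne: "i \<noteq> j"
      from two[OF this(1,2)] show "D a b"
        using linD(6)[OF lin_C] ne by blast
    next
      show "(w0, w0, ?id) \<in> \<Union>C"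
        using C(1) linD(7)[OF lin_C] by blast
    qed
    then show "\<Union>C \<in> {T. lin T}" by blast
  qed
  then obtain T where T: "lin T" and maximal: "\<And>T'. lin T' \<Longrightarrow> T \<subseteq> T' \<Longrightarrow> T' = T"
    by blast
  note T1 = linD(1)[OF T] and T2 = linD(2)[OF T] and T3 = linD(3)[OF T] and T4 = linD(4)[OF T]
    and T5 = linD(5)[OF T] and T6 = linD(6)[OF T] and T7 = linD(7)[OF T]

  define I where "I = {i. (i, i, ?id) \<in> T}"
  have I_W: "I \<subseteq> W"
    using T1 unfolding I_def by blast
  have w0_I: "w0 \<in> I"
    using T7 by (simp add: I_def)
  have in_I: "i \<in> I" "j \<in> I" if "(i, j, e) \<in> T" for i j e
    using T1[OF that] by (simp_all add: I_def)
  define r where "r = {(i, j). \<exists>e. (i, j, e) \<in> T}"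
  define t where "t i j = (THE e. (i, j, e) \<in> T)" for i j
  have t_eq: "t i j = e" if "(i, j, e) \<in> T" for i j e
    unfolding t_def using that T2 by (intro the_equality) blast+
  have rD: "(i, j, t i j) \<in> T" if "(i, j) \<in> r" for i j
    using that t_eq unfolding r_def by auto
  have dir: "directed_poset I r"
  proof -
    have "\<exists>k\<in>I. (i, k) \<in> r \<and> (j, k) \<in> r" if "i \<in> I" "j \<in> I" for i j
      using T4[of i j] that unfolding I_def r_def by blast
    moreover have "partial_order_on I r"
      unfolding partial_order_on_def preorder_on_def refl_on_def trans_def antisym_def
    proof (intro conjI allI impI ballI)
      show "r \<subseteq> I \<times> I"
        using in_I unfolding r_def by blast
      show "(i, i) \<in> r" if "i \<in> I" for i
        using that unfolding I_def r_def by blast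
      show "(i, k) \<in> r" if "(i, j) \<in> r" "(j, k) \<in> r" for i j k
        using T5 that unfolding r_def by blast
      show "i = j" if "(i, j) \<in> r" "(j, i) \<in> r" for i j
        using T3 that unfolding r_def by blast
    qed
    ultimately show ?thesis
      unfolding directed_poset_def using w0_I by blast
  qed
  have t: "t i j \<in> ?E" if "(i, j) \<in> r" for i j
    using T1[OF rD[OF that]] by blast
  have "\<exists>L u \<psi>. L \<in> complexes_of R \<X> \<and> \<psi> \<in> chain_maps R L K \<and>
    (\<forall>n. \<forall>y\<in>carrier (Term L n). \<exists>i\<in>I. \<exists>x\<in>carrier (Term F n). y = u i n x) \<and>
    (\<forall>i\<in>I. u i \<in> chain_maps R F L \<and> ?comp \<psi> (u i) = \<phi>) \<and>
    (\<forall>i j. (i, j) \<in> r \<longrightarrow> ?comp (u j) (t i j) = u i)"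
  proof (rule constant_system_limit[OF pre small_subset[OF W I_W] dir t])
    show "t i i = ?id" if "i \<in> I" for i
      using that by (intro t_eq) (simp add: I_def)
    show "?comp (t j k) (t i j) = t i k" if "(i, j) \<in> r" "(j, k) \<in> r" for i j k
      using t_eq[OF T5[OF rD[OF that(1)] rD[OF that(2)]]] by simp
  qed
  then obtain L u \<psi> where L: "L \<in> complexes_of R \<X>" and \<psi>: "\<psi> \<in> chain_maps R L K"
    and u: "\<And>i. i \<in> I \<Longrightarrow> u i \<in> chain_maps R F L" and \<psi>u: "\<And>i. i \<in> I \<Longrightarrow> ?comp \<psi> (u i) = \<phi>"
    and ut: "\<And>i j. (i, j) \<in> r \<Longrightarrow> ?comp (u j) (t i j) = u i"
    by blast
  obtain k where k: "k \<in> chain_maps R L F" and \<phi>k: "Comp (Ch R) L \<phi> k = \<psi>"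
    using precover_lift[OF pre L \<psi>] by blast
  define v where "v i = ?comp k (u i)" for i
  have v: "v i \<in> ?E" if i: "i \<in> I" for i
    unfolding endos_def v_def
    using Ch_Comp[OF u[OF i] k F] Ch_Comp_assoc[OF u[OF i], of \<phi> k] \<phi>k \<psi>u[OF i]
    by (simp del: Ch_simps)
  have ve: "?comp (v j) e = v i" if e: "(i, j, e) \<in> T" for i j e
  proof -
    have ij: "(i, j) \<in> r"
      using e unfolding r_def by blast
    show ?thesis
      using Ch_Comp_assoc[OF endos_map[OF t[OF ij]], of k "u j"] ut[OF ij] t_eq[OF e]
      by (simp add: v_def del: Ch_simps)
  qed

  have "W \<subseteq> I"
  proof (rule ccontr)
    assume "\<not> W \<subseteq> I"
    then obtain w where w: "w \<in> W" "w \<notin> I" by blast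
    obtain g where g: "g \<in> ?E"
      and Dg: "\<And>a b. a \<in> ?E \<Longrightarrow> b \<in> ?E \<Longrightarrow> ?comp b a = v w0 \<Longrightarrow> D a (?comp g b)"
      using grow[OF v[OF w0_I]] by blast
    define T' where "T' = T \<union> (\<lambda>i. (i, w, ?comp g (v i))) ` I \<union> {(w, w, ?id)}"
    have T'E: "thesis" if "(i, j, e) \<in> T'"
      and "(i, j, e) \<in> T \<Longrightarrow> i \<in> I \<Longrightarrow> j \<in> I \<Longrightarrow> i \<noteq> w \<Longrightarrow> j \<noteq> w \<Longrightarrow> thesis"
      and "i \<in> I \<Longrightarrow> i \<noteq> w \<Longrightarrow> j = w \<Longrightarrow> e = ?comp g (v i) \<Longrightarrow> thesis"
      and "i = w \<Longrightarrow> j = w \<Longrightarrow> e = ?id \<Longrightarrow> thesis" for i j e thesis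
      using that in_I w(2) unfolding T'_def by blast
    have T'I: "(i, j, e) \<in> T \<Longrightarrow> (i, j, e) \<in> T'" "i \<in> I \<Longrightarrow> (i, w, ?comp g (v i)) \<in> T'"
      "(w, w, ?id) \<in> T'" for i j e
      unfolding T'_def by blast+
    have gv: "?comp g (v i) \<in> ?E" if "i \<in> I" for i
      by (rule comp_E[OF v[OF that] g])
    have "lin T'"
      unfolding lin_def
    proof (intro conjI allI impI)
      fix i j e assume e: "(i, j, e) \<in> T'"
      show "i \<in> W" "j \<in> W"
        by (rule T'E[OF e]; use I_W w(1) in blast)+
      show "e \<in> ?E"
        by (rule T'E[OF e]) (use T1 gv id_E in blast)+
      show "(i, i, ?id) \<in> T'" "(j, j, ?id) \<in> T'"
        by (rule T'E[OF e]; use T'I I_def in blast)+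
      show "\<exists>a. (w0, i, a) \<in> T'"
        by (rule T'E[OF e]; use T'I T1 I_def w0_I in blast)
    next
      fix i j e e' assume e: "(i, j, e) \<in> T'" and e': "(i, j, e') \<in> T'"
      show "e = e'"
        by (rule T'E[OF e]; rule T'E[OF e']; use T2 in blast)
    next
      fix i j e e' assume e: "(i, j, e) \<in> T'" and e': "(j, i, e') \<in> T'"
      show "i = j"
        by (rule T'E[OF e]; rule T'E[OF e']; use T3 in blast)
    next
      fix i j assume i: "(i, i, ?id) \<in> T'" and j: "(j, j, ?id) \<in> T'"
      show "(\<exists>e. (i, j, e) \<in> T') \<or> (\<exists>e. (j, i, e) \<in> T')"
        by (rule T'E[OF i]; rule T'E[OF j]; use T4 T'I in blast)
    next
      fix i j k e f assume e: "(i, j, e) \<in> T'" and f: "(j, k, f) \<in> T'"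
      show "(i, k, ?comp f e) \<in> T'"
      proof (rule T'E[OF f])
        assume f': "(j, k, f) \<in> T" "j \<noteq> w"
        show ?thesis
          by (rule T'E[OF e]; use f' T5 T'I(1) in blast)
      next
        assume j: "j \<in> I" "j \<noteq> w" "k = w" "f = ?comp g (v j)"
        show ?thesis
        proof (rule T'E[OF e])
          assume e': "(i, j, e) \<in> T" "i \<in> I"
          have "?comp f e = ?comp g (v i)"
            using assoc[of e g "v j"] T1[OF e'(1)] ve[OF e'(1)] j(4) by simp
          then show ?thesis
            using T'I(2)[OF e'(2)] j(3) by simp
        qed (use j in blast)+
      next
        assume jk: "j = w" "k = w" "f = ?id"
        have "e \<in> ?E"
          by (rule T'E[OF e]) (use T1 gv id_E in blast)+
        then show ?thesis
          using unit(1) e jk by simp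
      qed
    next
      fix i j a b assume a: "(w0, i, a) \<in> T'" and b: "(i, j, b) \<in> T'" and ne: "i \<noteq> j"
      have w0w: "w0 \<noteq> w"
        using w0_I w(2) by blast
      show "D a b"
      proof (rule T'E[OF b])
        assume b': "(i, j, b) \<in> T" "i \<noteq> w"
        show ?thesis
          by (rule T'E[OF a]; use b' T6 ne in blast)
      next
        assume i: "i \<in> I" "i \<noteq> w" "j = w" "b = ?comp g (v i)"
        show ?thesis
        proof (rule T'E[OF a])
          assume a': "(w0, i, a) \<in> T"
          show ?thesis
            unfolding i(4) using T1[OF a'] v[OF i(1)] ve[OF a'] by (intro Dg) blast+
        qed (use i w0w in blast)+
      next
        assume "i = w" "j = w"
        then show ?thesis
          using ne by blast
      qed
    next
      show "(w0, w0, ?id) \<in> T'"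
        using T'I(1)[OF T7] .
    qed
    then have "T' = T"
      by (rule maximal) (auto simp: T'_def)
    then show False
      using w(2) T'I(3) unfolding I_def by blast
  qed
  then have I: "I = W"
    using I_W by blast
  define s where "s i = t w0 i" for i
  have s: "(w0, i, s i) \<in> T" if "i \<in> W" for i
    unfolding s_def using T1[of i i ?id] that I by (intro rD) (auto simp: I_def r_def)
  have step: "D (s i) b \<and> s j = ?comp b (s i) \<and> v i = ?comp (v j) b"
    if b: "(i, j, b) \<in> T" and ne: "i \<noteq> j" for i j b
  proof -
    have ij: "i \<in> W" "j \<in> W"
      using T1[OF b] by blast+
    show ?thesis
      using T6[OF s[OF ij(1)] b ne] T2[OF s[OF ij(2)] T5[OF s[OF ij(1)] b]] ve[OF b] by simp
  qed
  have pair: "\<exists>b\<in>?E. D (s i) b \<and> s j = ?comp b (s i) \<and> v i = ?comp (v j) b \<or>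
      D (s j) b \<and> s i = ?comp b (s j) \<and> v j = ?comp (v i) b"
    if ij: "i \<in> W" "j \<in> W" "i \<noteq> j" for i j
  proof -
    have "(\<exists>e. (i, j, e) \<in> T) \<or> (\<exists>e. (j, i, e) \<in> T)"
      using T4[of i j] ij I unfolding I_def by blast
    then obtain b where "(i, j, b) \<in> T \<or> (j, i, b) \<in> T" by blast
    then show ?thesis
      using step[of i j b] step[of j i b] ij(3) T1 by (intro bexI[of _ b]) blast+
  qed
  have "s i \<in> ?E" "v i \<in> ?E" if "i \<in> W" for i
    using T1[OF s[OF that]] v[of i] that I by simp_all
  then show ?thesis
    by (intro exI[of _ s] exI[of _ v] conjI ballI impI pair)
qed

lemma small_elements:
  assumes F: "is_complex R (F :: ('r, 'u) chain_complex)"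
  shows "small TYPE('u) (Sigma UNIV (\<lambda>n. carrier (Term F n)))"
  by (rule small_Sigma[OF small_countable complex_small[OF F]])

text \<open>
  The kernels or the images of the maps in a system indexed by \<open>W\<close> cannot be pairwise different.
\<close>

lemma index_set_beyond_element_sets:
  assumes F: "is_complex R (F :: ('r, 'u) chain_complex)"
  obtains W :: "'u set" and w0 where "small TYPE('u) W" and "w0 \<in> W"
    and "\<And>A. (\<And>i. i \<in> W \<Longrightarrow> A i \<subseteq> Sigma UNIV (\<lambda>n. carrier (Term F n))) \<Longrightarrow> \<not> inj_on A W"
proof -
  obtain W :: "'u set" where W: "small TYPE('u) W" "W \<noteq> {}"
    and no: "\<not> (\<exists>f. inj_on f W \<and> f ` W \<subseteq> Pow (Sigma UNIV (\<lambda>n. carrier (Term F n))))"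
    using large_index_set[OF small_Pow[OF small_elements[OF F]]] by metis
  then obtain w0 where w0: "w0 \<in> W" by blast
  show ?thesis
  proof (rule that[OF W(1) w0])
    fix A assume A: "\<And>i. i \<in> W \<Longrightarrow> A i \<subseteq> Sigma UNIV (\<lambda>n. carrier (Term F n))"
    show "\<not> inj_on A W"
      using no A by blast
  qed
qed

text \<open>
  Otherwise every endomorphism \<open>h\<close> is followed by some \<open>g\<close> such that the composite kills an element
  not killed by \<open>h\<close>. A large system then has pairwise different kernels of the maps from its first copy of \<open>F\<close>.
\<close>

lemma stable_kernel_endomorphism:
  assumes pre: "precover F \<phi>"
  shows "\<exists>h\<in>endos F \<phi>. \<forall>g\<in>endos F \<phi>. \<forall>n. \<forall>x\<in>carrier (Term F n).
    g n (h n x) = \<zero>\<^bsub>Term F n\<^esub> \<longrightarrow> h n x = \<zero>\<^bsub>Term F n\<^esub>"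
proof (rule ccontr)
  assume neg: "\<not> ?thesis"
  note F = precover_complex[OF pre]
  note Fm = complex_module[OF F]
  define D where "D a b \<longleftrightarrow> (\<exists>n. \<exists>x\<in>carrier (Term F n).
    b n (a n x) = \<zero>\<^bsub>Term F n\<^esub> \<and> a n x \<noteq> \<zero>\<^bsub>Term F n\<^esub>)" for a b :: "int \<Rightarrow> 'u \<Rightarrow> 'u"
  have grow: "\<exists>g\<in>endos F \<phi>. \<forall>a\<in>endos F \<phi>. \<forall>b\<in>endos F \<phi>.
      Comp (Ch R) F b a = h \<longrightarrow> D a (Comp (Ch R) F g b)" if h: "h \<in> endos F \<phi>" for h
  proof -
    obtain g n x where g: "g \<in> endos F \<phi>" and x: "x \<in> carrier (Term F n)"
      and gh: "g n (h n x) = \<zero>\<^bsub>Term F n\<^esub>" and hx: "h n x \<noteq> \<zero>\<^bsub>Term F n\<^esub>"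
      using neg h by blast
    have "D a (Comp (Ch R) F g b)"
      if a: "a \<in> endos F \<phi>" and b: "b \<in> endos F \<phi>" and ba: "Comp (Ch R) F b a = h" for a b
    proof -
      have ax: "a n x \<in> carrier (Term F n)"
        by (rule chain_map_closed[OF endos_map[OF a] x])
      have "b n (a n x) = h n x"
        unfolding ba[symmetric] using x by (simp add: compose_eq)
      moreover have "b n \<zero>\<^bsub>Term F n\<^esub> = \<zero>\<^bsub>Term F n\<^esub>"
        by (rule hom_zero[OF chain_map_hom[OF endos_map[OF b]] Fm Fm])
      ultimately show ?thesis
        unfolding D_def using gh hx ax
        by (intro exI[of _ n] bexI[of _ x] x) (auto simp: compose_eq)
    qed
    then show ?thesis
      using g by blast
  qed
  obtain W :: "'u set" and w0 where W: "small TYPE('u) W" "w0 \<in> W"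
    and large: "\<And>A. (\<And>i. i \<in> W \<Longrightarrow> A i \<subseteq> Sigma UNIV (\<lambda>n. carrier (Term F n))) \<Longrightarrow> \<not> inj_on A W"
    by (rule index_set_beyond_element_sets[OF F]) blast
  obtain s v where s: "\<And>i. i \<in> W \<Longrightarrow> s i \<in> endos F \<phi>"
    and step: "\<And>i j. i \<in> W \<Longrightarrow> j \<in> W \<Longrightarrow> i \<noteq> j \<Longrightarrow> \<exists>b\<in>endos F \<phi>.
      D (s i) b \<and> s j = Comp (Ch R) F b (s i) \<and> v i = Comp (Ch R) F (v j) b \<or>
      D (s j) b \<and> s i = Comp (Ch R) F b (s j) \<and> v j = Comp (Ch R) F (v i) b"
    using chain_of_endomorphisms[OF pre W grow] by blast
  define ker where "ker i = {(n, x). x \<in> carrier (Term F n) \<and> s i n x = \<zero>\<^bsub>Term F n\<^esub>}" for i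
  have differ: "ker i \<noteq> ker j" if D: "D (s i) b" and b: "s j = Comp (Ch R) F b (s i)" for i j b
  proof -
    obtain n x where x: "x \<in> carrier (Term F n)" "b n (s i n x) = \<zero>\<^bsub>Term F n\<^esub>"
      "s i n x \<noteq> \<zero>\<^bsub>Term F n\<^esub>"
      using D unfolding D_def by blast
    have "s j n x = \<zero>\<^bsub>Term F n\<^esub>"
      unfolding b using x by (simp add: compose_eq)
    then have "(n, x) \<in> ker j" and "(n, x) \<notin> ker i"
      using x by (simp_all add: ker_def)
    then show ?thesis by blast
  qed
  have "inj_on ker W"
  proof (rule inj_onI, rule ccontr)
    fix i j assume ij: "i \<in> W" "j \<in> W" and eq: "ker i = ker j" and ne: "i \<noteq> j"
    from step[OF ij ne] show False
      using differ[of i _ j] differ[of j _ i] eq by blast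
  qed
  moreover have "\<not> inj_on ker W"
    by (rule large) (auto simp: ker_def)
  ultimately show False by blast
qed

text \<open>
  Let \<open>L\<close> be the direct limit of \<open>F \<rightarrow> F \<rightarrow> F \<rightarrow> \<dots>\<close> along an endomorphism \<open>h\<close> with stable kernel. Suppose
  that \<open>g\<close> kills the element \<open>y\<close> of \<open>L\<close> represented by \<open>x\<close> at stage \<open>l\<close>. It is represented by \<open>h x\<close> at
  stage \<open>l + 1\<close>, and going from this stage to \<open>L\<close>, then along \<open>g\<close> and back to \<open>F\<close> over \<open>K\<close> is an
  endomorphism of \<open>F\<close> that kills \<open>h x\<close>. Hence \<open>h x = 0\<close> by the choice of \<open>h\<close>, and \<open>y = 0\<close>.
\<close>

lemma precover_with_injective_endomorphisms:
  assumes pre: "precover F \<phi>"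
  shows "\<exists>L \<psi>. precover L \<psi> \<and> (\<forall>g\<in>endos L \<psi>. \<forall>n. inj_on (g n) (carrier (Term L n)))"
proof -
  note F = precover_complex[OF pre]
  note Fm = complex_module[OF F]
  obtain h where h: "h \<in> endos F \<phi>"
    and stable: "\<And>g n x. g \<in> endos F \<phi> \<Longrightarrow> x \<in> carrier (Term F n) \<Longrightarrow>
      g n (h n x) = \<zero>\<^bsub>Term F n\<^esub> \<Longrightarrow> h n x = \<zero>\<^bsub>Term F n\<^esub>"
    using stable_kernel_endomorphism[OF pre] by blast
  define pow where "pow = rec_nat (Ident (Ch R) F) (\<lambda>_. Comp (Ch R) F h)"
  have pow_0: "pow 0 = Ident (Ch R) F" and pow_Suc: "pow (Suc k) = Comp (Ch R) F h (pow k)" for k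
    by (simp_all add: pow_def)
  have pow_E: "pow k \<in> endos F \<phi>" for k
    by (induction k) (simp_all add: pow_0 pow_Suc endos_Ident[OF pre] endos_Comp[OF pre _ h]
        del: Ch_simps)
  have pow_add: "Comp (Ch R) F (pow k) (pow l) = pow (k + l)" for k l
  proof (induction k)
    case 0
    show ?case
      using Ch_Ident_left[OF endos_map[OF pow_E] F F] by (simp add: pow_0 del: Ch_simps)
  next
    case (Suc k)
    then show ?case
      using Ch_Comp_assoc[OF endos_map[OF pow_E], of h "pow k" l] by (simp add: pow_Suc del: Ch_simps)
  qed
  obtain e :: "nat \<Rightarrow> 'u" where e: "inj e"
    using small_embeds[OF small_nat] by blast
  define m where "m = inv_into UNIV e"
  have m [simp]: "m (e k) = k" for k
    using e by (simp add: m_def)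
  define r where "r = {(e i, e j) | i j. i \<le> j}"
  define t where "t a b = pow (m b - m a)" for a b
  have rE: "\<exists>i d. a = e i \<and> b = e (i + d)" if "(a, b) \<in> r" for a b
    using that unfolding r_def le_iff_add by blast
  have "\<exists>L u \<psi>. L \<in> complexes_of R \<X> \<and> \<psi> \<in> chain_maps R L K \<and>
    (\<forall>n. \<forall>y\<in>carrier (Term L n). \<exists>i\<in>range e. \<exists>x\<in>carrier (Term F n). y = u i n x) \<and>
    (\<forall>i\<in>range e. u i \<in> chain_maps R F L \<and> Comp (Ch R) F \<psi> (u i) = \<phi>) \<and>
    (\<forall>i j. (i, j) \<in> r \<longrightarrow> Comp (Ch R) F (u j) (t i j) = u i)"
  proof (rule constant_system_limit[OF pre small_image[OF small_nat]])
    show "directed_poset (range e) r"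
      unfolding r_def by (rule directed_poset_nat[OF e])
    show "t a b \<in> endos F \<phi>" for a b
      unfolding t_def by (rule pow_E)
    show "t a a = Ident (Ch R) F" for a
      by (simp add: t_def pow_0)
    show "Comp (Ch R) F (t b c) (t a b) = t a c" if ab: "(a, b) \<in> r" and bc: "(b, c) \<in> r" for a b c
    proof -
      obtain i d where i: "a = e i" "b = e (i + d)"
        using rE[OF ab] by blast
      obtain j d' where j: "b = e j" "c = e (j + d')"
        using rE[OF bc] by blast
      have "j = i + d"
        using i(2) j(1) by (simp add: inj_eq[OF e])
      then show ?thesis
        using i j by (simp add: t_def pow_add add.commute del: Ch_simps)
    qed
  qed
  then obtain L u \<psi> where L: "L \<in> complexes_of R \<X>" and \<psi>: "\<psi> \<in> chain_maps R L K"
    and surj: "\<And>n y. y \<in> carrier (Term L n) \<Longrightarrow> \<exists>i\<in>range e. \<exists>x\<in>carrier (Term F n). y = u i n x"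
    and u: "\<And>k. u (e k) \<in> chain_maps R F L" and \<psi>u: "\<And>k. Comp (Ch R) F \<psi> (u (e k)) = \<phi>"
    and ut: "\<And>i j. (i, j) \<in> r \<Longrightarrow> Comp (Ch R) F (u j) (t i j) = u i"
    by blast
  have Lc: "is_complex R L"
    using L by (simp add: complexes_of_iff)
  note Lm = complex_module[OF Lc]
  have shift: "u (e (Suc k)) n (h n x) = u (e k) n x" if x: "x \<in> carrier (Term F n)" for k n x
  proof -
    have "pow (Suc 0) = h"
      using Ch_Ident_right[OF endos_map[OF h] F] by (simp add: pow_0 pow_Suc del: Ch_simps)
    moreover have "(e k, e (Suc k)) \<in> r"
      unfolding r_def by (blast intro: le_SucI)
    ultimately have "Comp (Ch R) F (u (e (Suc k))) h = u (e k)"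
      using ut[of "e k" "e (Suc k)"] by (simp add: t_def del: Ch_simps)
    from fun_cong[OF fun_cong[OF this]] show ?thesis
      using x by (metis Ch_Comp_apply)
  qed
  have preL: "precover L \<psi>"
    unfolding is_precover_def
  proof (intro conjI ballI)
    show "L \<in> complexes_of R \<X>"
      by (rule L)
    show "\<psi> \<in> Hom (Ch R) L K"
      using \<psi> by simp
    fix Y f assume Y: "Y \<in> complexes_of R \<X>" and "f \<in> Hom (Ch R) Y K"
    then have f: "f \<in> chain_maps R Y K"
      by simp
    obtain g where g: "g \<in> chain_maps R Y F" "Comp (Ch R) Y \<phi> g = f"
      using precover_lift[OF pre Y f] by blast
    have Yc: "is_complex R Y"
      using Y by (simp add: complexes_of_iff)
    have "Comp (Ch R) Y \<psi> (Comp (Ch R) Y (u (e 0)) g) = f"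
      using Ch_Comp_assoc[OF g(1), of \<psi> "u (e 0)"] \<psi>u[of 0] g(2) by (simp del: Ch_simps)
    then show "\<exists>g\<in>Hom (Ch R) Y L. Comp (Ch R) Y \<psi> g = f"
      using Ch_Comp[OF g(1) u Yc] unfolding Ch_simps(2) by blast
  qed
  obtain k where k: "k \<in> chain_maps R L F" and \<phi>k: "Comp (Ch R) L \<phi> k = \<psi>"
    using precover_lift[OF pre L \<psi>] by blast
  have "inj_on (g n) (carrier (Term L n))" if g: "g \<in> endos L \<psi>" for g n
  proof -
    note g_map = endos_map[OF g]
    have "y = \<zero>\<^bsub>Term L n\<^esub>" if y: "y \<in> carrier (Term L n)" and gy: "g n y = \<zero>\<^bsub>Term L n\<^esub>" for y
    proof -
      obtain l x where x: "x \<in> carrier (Term F n)" and yx: "y = u (e l) n x"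
        using surj[OF y] by blast
      let ?u = "u (e (Suc l))"
      have gu: "Comp (Ch R) F g ?u \<in> chain_maps R F L"
        by (rule Ch_Comp[OF u g_map F])
      have "Comp (Ch R) F \<phi> (Comp (Ch R) F k (Comp (Ch R) F g ?u)) =
          Comp (Ch R) F \<psi> (Comp (Ch R) F g ?u)"
        using Ch_Comp_assoc[OF gu, of \<phi> k] \<phi>k by (simp del: Ch_simps)
      also have "\<dots> = \<phi>"
        using Ch_Comp_assoc[OF u, of \<psi> g] endos_over[OF g] \<psi>u by (simp del: Ch_simps)
      finally have kgu: "Comp (Ch R) F k (Comp (Ch R) F g ?u) \<in> endos F \<phi>"
        unfolding endos_def using Ch_Comp[OF gu k F] by (simp del: Ch_simps)
      have hx: "h n x \<in> carrier (Term F n)"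
        by (rule chain_map_closed[OF endos_map[OF h] x])
      have "Comp (Ch R) F k (Comp (Ch R) F g ?u) n (h n x) = k n (g n y)"
        unfolding yx using hx shift[OF x, of l] by (simp add: compose_eq)
      also have "\<dots> = \<zero>\<^bsub>Term F n\<^esub>"
        unfolding gy by (rule hom_zero[OF chain_map_hom[OF k] Lm Fm])
      finally have "h n x = \<zero>\<^bsub>Term F n\<^esub>"
        by (rule stable[OF kgu x])
      then show ?thesis
        using shift[OF x, of l] hom_zero[OF chain_map_hom[OF u] Fm Lm] by (simp add: yx)
    qed
    then show ?thesis
      using hom_inj_iff[OF chain_map_hom[OF g_map] Lm Lm] by blast
  qed
  then show ?thesis
    using preL by blast
qed

text \<open>
  If \<open>g\<close> is not surjective, neither is any composite ending with \<open>g\<close>, so there are large systems with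
  no surjective transition maps except identities. As the maps \<open>v i\<close> are injective, their images are
  pairwise different.
\<close>

lemma injective_endomorphisms_surjective:
  assumes pre: "precover F \<phi>"
    and inj: "\<And>g n. g \<in> endos F \<phi> \<Longrightarrow> inj_on (g n) (carrier (Term F n))"
    and g: "g \<in> endos F \<phi>"
  shows "g n ` carrier (Term F n) = carrier (Term F n)"
proof (rule ccontr)
  assume neg: "g n ` carrier (Term F n) \<noteq> carrier (Term F n)"
  note F = precover_complex[OF pre]
  have closed: "f n x \<in> carrier (Term F n)" if "f \<in> endos F \<phi>" "x \<in> carrier (Term F n)" for f n x
    by (rule chain_map_closed[OF endos_map[OF that(1)] that(2)])
  define D where "D a b \<longleftrightarrow> (\<exists>n. \<exists>y\<in>carrier (Term F n). y \<notin> b n ` carrier (Term F n))"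
    for a b :: "int \<Rightarrow> 'u \<Rightarrow> 'u"
  obtain y0 where y0: "y0 \<in> carrier (Term F n)" "y0 \<notin> g n ` carrier (Term F n)"
    using neg closed[OF g] by blast
  have "D a (Comp (Ch R) F g b)" if b: "b \<in> endos F \<phi>" for a b
    unfolding D_def using y0 closed[OF b] by (intro exI[of _ n] bexI[of _ y0]) (auto simp: compose_eq)
  then have grow: "\<exists>g\<in>endos F \<phi>. \<forall>a\<in>endos F \<phi>. \<forall>b\<in>endos F \<phi>.
      Comp (Ch R) F b a = h \<longrightarrow> D a (Comp (Ch R) F g b)" if "h \<in> endos F \<phi>" for h
    using g by blast
  obtain W :: "'u set" and w0 where W: "small TYPE('u) W" "w0 \<in> W"
    and large: "\<And>A. (\<And>i. i \<in> W \<Longrightarrow> A i \<subseteq> Sigma UNIV (\<lambda>n. carrier (Term F n))) \<Longrightarrow> \<not> inj_on A W"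
    by (rule index_set_beyond_element_sets[OF F]) blast
  obtain s v where v: "\<And>i. i \<in> W \<Longrightarrow> v i \<in> endos F \<phi>"
    and step: "\<And>i j. i \<in> W \<Longrightarrow> j \<in> W \<Longrightarrow> i \<noteq> j \<Longrightarrow> \<exists>b\<in>endos F \<phi>.
      D (s i) b \<and> s j = Comp (Ch R) F b (s i) \<and> v i = Comp (Ch R) F (v j) b \<or>
      D (s j) b \<and> s i = Comp (Ch R) F b (s j) \<and> v j = Comp (Ch R) F (v i) b"
    using chain_of_endomorphisms[OF pre W grow] by blast
  define im where "im i = (SIGMA n:UNIV. v i n ` carrier (Term F n))" for i
  have differ: "im i \<noteq> im j"
    if D: "D (s i) b" and vb: "v i = Comp (Ch R) F (v j) b" and b: "b \<in> endos F \<phi>" and j: "j \<in> W"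
    for i j b
  proof -
    obtain n y where y: "y \<in> carrier (Term F n)" "y \<notin> b n ` carrier (Term F n)"
      using D unfolding D_def by blast
    have "v j n y \<notin> v i n ` carrier (Term F n)"
    proof
      assume "v j n y \<in> v i n ` carrier (Term F n)"
      then obtain x where x: "x \<in> carrier (Term F n)" and "v j n y = v i n x"
        by blast
      then have "v j n y = v j n (b n x)"
        by (simp add: vb compose_eq)
      then have "y = b n x"
        by (rule inj_onD[OF inj[OF v[OF j]] _ y(1) closed[OF b x]])
      then show False
        using y(2) x by blast
    qed
    then have "(n, v j n y) \<in> im j" and "(n, v j n y) \<notin> im i"
      using y(1) by (auto simp: im_def)
    then show ?thesis by blast
  qed
  have "inj_on im W"
  proof (rule inj_onI, rule ccontr)
    fix i j assume ij: "i \<in> W" "j \<in> W" and eq: "im i = im j" and ne: "i \<noteq> j"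
    from step[OF ij ne] show False
      using differ[of i _ j] differ[of j _ i] ij eq by blast
  qed
  moreover have "\<not> inj_on im W"
    by (rule large) (use closed[OF v] in \<open>auto simp: im_def\<close>)
  ultimately show False by blast
qed

lemma bijective_chain_map_automorphism:
  assumes F: "is_complex R F" and g: "g \<in> chain_maps R F F"
    and bij: "\<And>n. bij_betw (g n) (carrier (Term F n)) (carrier (Term F n))"
  shows "automorphism (Ch R) F g"
proof -
  note Fm = complex_module[OF F]
  define h where "h n = restrict (inv_into (carrier (Term F n)) (g n)) (carrier (Term F n))" for n
  have h_closed: "h n y \<in> carrier (Term F n)" and gh: "g n (h n y) = y"
    if "y \<in> carrier (Term F n)" for n y
    using that bij_betw_imp_surj_on[OF bij, of n]
    by (simp_all add: h_def inv_into_into f_inv_into_f)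
  have hg: "h n (g n x) = x" if "x \<in> carrier (Term F n)" for n x
    using that bij_betw_imp_inj_on[OF bij, of n] chain_map_closed[OF g that] by (simp add: h_def)
  have g_eqI: "x = y"
    if "g n x = g n y" "x \<in> carrier (Term F n)" "y \<in> carrier (Term F n)" for n x y
    by (rule inj_onD[OF bij_betw_imp_inj_on[OF bij] that])
  note g_hom = chain_map_hom[OF g] and dF = complex_diff[OF F]
  have h: "h \<in> chain_maps R F F"
  proof (rule chain_mapI)
    fix n
    have "restrict (h n) (carrier (Term F n)) \<in> module_homs R (Term F n) (Term F n)"
    proof (rule homI[OF h_closed _ _ Fm])
      show "h n (x \<oplus>\<^bsub>Term F n\<^esub> y) = h n x \<oplus>\<^bsub>Term F n\<^esub> h n y"
        if "x \<in> carrier (Term F n)" "y \<in> carrier (Term F n)" for x y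
        by (rule g_eqI[of n]) (simp_all add: that gh h_closed module_add[OF Fm] hom_add[OF g_hom])
      show "h n (a \<odot>\<^bsub>Term F n\<^esub> x) = a \<odot>\<^bsub>Term F n\<^esub> h n x"
        if "a \<in> carrier R" "x \<in> carrier (Term F n)" for a x
        by (rule g_eqI[of n]) (simp_all add: that gh h_closed module_smult[OF Fm] hom_smult[OF g_hom])
    qed
    then show "h n \<in> module_homs R (Term F n) (Term F n)"
      by (simp add: h_def)
    show "h (n - 1) (Diff F n x) = Diff F n (h n x)" if x: "x \<in> carrier (Term F n)" for x
      by (rule g_eqI[of "n - 1"]) (simp_all add: gh h_closed x hom_closed[OF dF] chain_map_comm[OF g])
  qed
  have "Comp (Ch R) F h g = Ident (Ch R) F"
    by (rule chain_map_eqI[OF Ch_Comp[OF g h F] Ch_Ident[OF F]]) (simp add: compose_eq hg)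
  moreover have "Comp (Ch R) F g h = Ident (Ch R) F"
    by (rule chain_map_eqI[OF Ch_Comp[OF h g F] Ch_Ident[OF F]]) (simp add: compose_eq gh)
  ultimately show ?thesis
    unfolding automorphism_def Ch_simps(2) using g h by blast
qed

theorem cover_if_precover:
  assumes "precover F \<phi>"
  shows "has_cover (Ch R) (complexes_of R \<X>) K"
proof -
  obtain L \<psi> where pre: "precover L \<psi>"
    and inj: "\<And>g n. g \<in> endos L \<psi> \<Longrightarrow> inj_on (g n) (carrier (Term L n))"
    using precover_with_injective_endomorphisms[OF assms] by blast
  have "automorphism (Ch R) L g" if g: "g \<in> Hom (Ch R) L L" "Comp (Ch R) L \<psi> g = \<psi>" for g
  proof (rule bijective_chain_map_automorphism[OF precover_complex[OF pre]])
    show "g \<in> chain_maps R L L"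
      using g(1) by simp
    then have gE: "g \<in> endos L \<psi>"
      using g(2) unfolding endos_def by blast
    show "bij_betw (g n) (carrier (Term L n)) (carrier (Term L n))" for n
      unfolding bij_betw_def
      by (intro conjI inj[OF gE] injective_endomorphisms_surjective[OF pre _ gE] inj)
  qed
  then show ?thesis
    using pre unfolding has_cover_def is_cover_def by blast
qed

end

theorem theorem2p7:
  fixes R :: "('r, 'e) ring_scheme" and \<X> :: "('r, 'u) module set"
  assumes "universe TYPE('u)"
    and "ring R" and "small TYPE('u) (carrier R)"
    and "\<X> \<subseteq> Obj (Mod R)"
    and "closed_under_direct_sums TYPE('u) (Mod R) \<X>"
    and "closed_under_extensions R \<X>"
    and "closed_under_inverse_limits TYPE('u) (Ch R) (complexes_of R \<X>)"
    and "closed_under_direct_limits TYPE('u) (Ch R) (complexes_of R \<X>)"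
    and "\<forall>M \<in> Obj (Mod R). has_cover (Mod R) \<X> M"
  shows "\<forall>K \<in> Obj (Ch R). has_cover (Ch R) (complexes_of R \<X>) K"
proof
  fix K :: "('r, 'u) chain_complex"
  assume "K \<in> Obj (Ch R)"
  then have K: "is_complex R K"
    by simp
  interpret modules_in_universe "TYPE('u)" R
    by (intro modules_in_universe.intro small_sets.intro modules_in_universe_axioms.intro assms)
  interpret complex_in_direct_limit_closed_class "TYPE('u)" R \<X> K
    by (intro complex_in_direct_limit_closed_class.intro complex_in_direct_limit_closed_class_axioms.intro
        modules_in_universe_axioms assms K)
  have "\<exists>P \<phi>. is_precover (Mod R) \<X> M P \<phi>" if "M \<in> Obj (Mod R)" for M
    using assms(9) that unfolding has_cover_def is_cover_def by blast
  from precovers_of_complexes[OF assms(7,4) this K]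
  show "has_cover (Ch R) (complexes_of R \<X>) K"
    using cover_if_precover by blast
qed

end
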